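(* Let $\theta$ be an action of an inverse semigroup $S$ on a locally compact Hausdorff space $X$. Then the following are equivalent. (i) $X$ is second countable and $S^X=\{s\in S\mid X_{s^*s}\neq\emptyset\}$ is countable. (ii) $S\ltimes X^{\mathrm{KS}}$ is second countable. (iii) $S\ltimes^{\mathrm{KS}}C_0(X)$ is separable. (iv) $S\ltimes^{\mathrm{KS}}_rC_0(X)$ is separable.
   Context: An inverse semigroup is a semigroup $S$ in which every $s$ has a unique $s^*$ with $ss^*s=s$, $s^*ss^*=s^*$; $E(S)$ is its commutative subsemigroup of idempotents; $s\le t$ means $ts^*s=s$. An action $\theta$ of $S$ on a topological space $X$ is a semigroup homomorphism $s\mapsto\theta_s$ from $S$ to the inverse semigroup of partial bijections of $X$ (bijections between subsets, composed on the largest possible domain) such that, writing $X_e$ for the subset on which $\theta_e$ ($e\in E(S)$) is the identity (so $\theta_s$ is a bijection $X_{s^*s}\to X_{ss^*}$): each $X_e$ is open, each $\theta_s\colon X_{s^*s}\to X_{ss^*}$ is continuous, and $\bigcup_{e\in E(S)}X_e=X$. The space $X^{\mathrm{KS}}$: let $\widetilde{X_e}=X_e\sqcup\{\infty_e\}$ be the one-point compactification of $X_e$ (a point $\infty_e$ is added even when $X_e$ is compact). Let $\widetilde{X^{\mathrm{KS}}}$ be the set of $\tau\in\prod_{e\in E(S)}\widetilde{X_e}$ such that (1) if $e_1\le e_2$ and $\tau(e_1)\ne\infty_{e_1}$, then $\tau(e_2)=\tau(e_1)$; (2) if $\tau(e_1)\neq\infty_{e_1}$ and $\tau(e_2)\neq\infty_{e_2}$,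 then $\tau(e_1e_2)\neq\infty_{e_1e_2}$; with the topology induced from the product topology. Set $X^{\mathrm{KS}}=\widetilde{X^{\mathrm{KS}}}\setminus\{\infty\}$, $\infty=(\infty_e)_e$; it is locally compact Hausdorff. $S$ acts on $X^{\mathrm{KS}}$ by $X^{\mathrm{KS}}_e=\{\tau\in X^{\mathrm{KS}}\mid\tau(e)\ne\infty_e\}$ and $\theta^{\mathrm{KS}}_s\colon X^{\mathrm{KS}}_{s^*s}\to X^{\mathrm{KS}}_{ss^*}$, $\theta^{\mathrm{KS}}_s(\tau)(e)=\theta_{es}(\tau(s^*es))$ if $\tau(s^*es)\neq\infty_{s^*es}$ and $\infty_e$ otherwise. Transformation groupoid: for an action $\theta$ of $S$ on a locally compact Hausdorff space $Z$, $S\ltimes Z$ is the set of classes $[s,z]$ of pairs $(s,z)$, $z\in Z_{s^*s}$, under $(s,z)\sim(t,w)$ iff $z=w$ and $se=te$, $z\in Z_e$ for some $e\in E(S)$; unit space $\{[e,z]\}\cong Z$, $d([s,z])=z$, $r([s,z])=\theta_s(z)$, $[t,\theta_s(z)][s,z]=[ts,z]$, $[s,z]^{-1}=[s^*,\theta_s(z)]$; basis of open sets $[s,U]=\{[s,z]\mid z\in U\}$, $U\subset Z_{s^*s}$ open. KS-crossed products: $S$ acts on $A=C_0(X)$ via ideals $A_e=C_0(X_e)$ and $\alpha_s\colon C_0(X_{s^*s})\to C_0(X_{ss^*})$, $\alpha_s(f)=f\circ\theta_{s^*}$. Let $S\ltimes^{\mathrm{KS}}_{\mathrm{alg}}A=\bigoplus_{s\in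 S}A_{s^*s}$ (algebraic direct sum), with $\delta_s\,a$ the element having $a\in A_{s^*s}$ in the $s$-th component and $0$ elsewhere; it is a $*$-algebra with $(\delta_s a)(\delta_t b)=\delta_{st}\,\alpha_{t^*}(a\alpha_t(b))$ and $(\delta_s a)^*=\delta_{s^*}\,\alpha_s(a^* )$. The full KS-crossed product $S\ltimes^{\mathrm{KS}}A$ is its universal enveloping C*-algebra. For $e\in E(S)$ put $S_e=\{s\in S\mid s^*s=e\}$ and let $l^2(S_e,A_e)$ be the Hilbert $A_e$-module of square-summable families, with elementary vectors $\delta_t\,y$ ($t\in S_e$, $y\in A_e$). There is a $*$-homomorphism $\ell_e\colon S\ltimes^{\mathrm{KS}}_{\mathrm{alg}}A\to\mathbb B(l^2(S_e,A_e))$ into adjointable operators with $\ell_e(\delta_s a)(\delta_t y)=\delta_{st}\,\alpha_{t^*}(a\alpha_t(y))$ if $s^*st=t$, and $0$ otherwise. The reduced KS-crossed product $S\ltimes^{\mathrm{KS}}_rA$ is the completion of $S\ltimes^{\mathrm{KS}}_{\mathrm{alg}}A$ in the C*-norm $\|T\|_{\mathrm{KS},r}=\sup_{e\in E(S)}\|\ell_e(T)\|$. *)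

theory Defs
  imports "HOL-Analysis.Analysis"
begin

section \<open>Inverse semigroups\<close>

class inverse_semigroup = semigroup_mult +
  assumes ex1_inverse: "\<exists>!t. s * t * s = s \<and> t * s * t = t"

definition sg_inv :: "'s::inverse_semigroup \<Rightarrow> 's"  ("_\<^sup>\<star>" [1000] 999)
  where "s\<^sup>\<star> = (THE t. s * t * s = s \<and> t * s * t = t)"

definition idems :: "'s::inverse_semigroup set"
  where "idems = {e. e * e = e}"

definition nat_le :: "'s::inverse_semigroup \<Rightarrow> 's \<Rightarrow> bool"
  where "nat_le s t \<longleftrightarrow> t * s\<^sup>\<star> * s = s"

lemma sg_inv:
  fixes s :: "'s::inverse_semigroup"
  shows "s * s\<^sup>\<star> * s = s" "s\<^sup>\<star> * s * s\<^sup>\<star> = s\<^sup>\<star>"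
  using theI'[OF ex1_inverse[of s]] by (auto simp: sg_inv_def)

lemma sg_inv_unique:
  fixes s :: "'s::inverse_semigroup"
  assumes "s * t * s = s" "t * s * t = t"
  shows "t = s\<^sup>\<star>"
  using assms sg_inv[of s] ex1_inverse[of s] by blast

lemma sg_inv_inv [simp]: "(s\<^sup>\<star>)\<^sup>\<star> = (s::'s::inverse_semigroup)"
  using sg_inv_unique[of "s\<^sup>\<star>" s] sg_inv[of s] by simp

lemma idem_inv_mult: "s\<^sup>\<star> * s \<in> idems"
  using sg_inv(2)[of s] by (simp add: idems_def mult.assoc[symmetric])

lemma idem_mult_inv: "s * s\<^sup>\<star> \<in> idems"
  using sg_inv(1)[of s] by (simp add: idems_def mult.assoc[symmetric])

lemma idem_inv: "e \<in> idems \<Longrightarrow> e\<^sup>\<star> = e"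
  using sg_inv_unique[of e e] by (simp add: idems_def)

section \<open>Actions by partial bijections\<close>

text \<open>A partial bijection is an injective partial map; \<open>\<circ>\<^sub>m\<close> is composition on the largest
  possible domain.\<close>

definition fixdom :: "('s \<Rightarrow> 'z \<Rightarrow> 'z option) \<Rightarrow> 's \<Rightarrow> 'z set"
  where "fixdom \<theta> e = {x. \<theta> e x = Some x}"

definition sg_action :: "('s::inverse_semigroup \<Rightarrow> 'z \<Rightarrow> 'z option) \<Rightarrow> 'z topology \<Rightarrow> bool"
  where "sg_action \<theta> Z \<longleftrightarrow>
    (\<forall>s. dom (\<theta> s) \<subseteq> topspace Z \<and> ran (\<theta> s) \<subseteq> topspace Z \<and> inj_on (\<theta> s) (dom (\<theta> s))) \<and>
    (\<forall>s t. \<theta> (s * t) = \<theta> s \<circ>\<^sub>m \<theta> t) \<and>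
    (\<forall>e\<in>idems. openin Z (fixdom \<theta> e)) \<and>
    (\<forall>s. continuous_map (subtopology Z (fixdom \<theta> (s\<^sup>\<star> * s))) (subtopology Z (fixdom \<theta> (s * s\<^sup>\<star>)))
           (\<lambda>x. the (\<theta> s x))) \<and>
    (\<Union>e\<in>idems. fixdom \<theta> e) = topspace Z"

lemma dom_sg_action:
  assumes "sg_action \<theta> Z"
  shows "dom (\<theta> s) = fixdom \<theta> (s\<^sup>\<star> * s)"
proof -
  have hom: "\<theta> (a * b) = \<theta> a \<circ>\<^sub>m \<theta> b" for a b
    using assms by (simp add: sg_action_def)
  have inj: "inj_on (\<theta> a) (dom (\<theta> a))" for a
    using assms by (simp add: sg_action_def)
  have "\<theta> (s\<^sup>\<star> * s) x = Some x" if "x \<in> dom (\<theta> s)" for x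
  proof -
    have "\<theta> (s * (s\<^sup>\<star> * s)) x = \<theta> s x"
      using sg_inv(1)[of s] by (simp add: mult.assoc)
    with that obtain z where z: "\<theta> (s\<^sup>\<star> * s) x = Some z" "\<theta> s z = \<theta> s x"
      unfolding hom[of s] map_comp_def by (auto split: option.splits)
    then have "z = x" using inj[of s] that by (metis domIff inj_onD)
    with z show ?thesis by simp
  qed
  moreover have "x \<in> dom (\<theta> s)" if "\<theta> (s\<^sup>\<star> * s) x = Some x" for x
    using that unfolding hom[of "s\<^sup>\<star>"] map_comp_def by (auto split: option.splits)
  ultimately show ?thesis by (auto simp: fixdom_def)
qed

section \<open>The space \<open>X\<^sup>K\<^sup>S\<close> and its action\<close>

text \<open>The point at infinity of the one-point compactification is \<^const>\<open>None\<close>, which is isolated when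
  the original space is compact. Elements of the product are extensional on \<^const>\<open>idems\<close>.\<close>

definition KS_tilde :: "('s::inverse_semigroup \<Rightarrow> 'x \<Rightarrow> 'x option) \<Rightarrow> 'x topology \<Rightarrow> ('s \<Rightarrow> 'x option) topology"
  where "KS_tilde \<theta> X =
    subtopology (product_topology (\<lambda>e. Alexandroff_compactification (subtopology X (fixdom \<theta> e))) idems)
      {\<tau>. (\<forall>e1\<in>idems. \<forall>e2\<in>idems. nat_le e1 e2 \<and> \<tau> e1 \<noteq> None \<longrightarrow> \<tau> e2 = \<tau> e1) \<and>
           (\<forall>e1\<in>idems. \<forall>e2\<in>idems. \<tau> e1 \<noteq> None \<and> \<tau> e2 \<noteq> None \<longrightarrow> \<tau> (e1 * e2) \<noteq> None)}"

definition KS_space :: "('s::inverse_semigroup \<Rightarrow> 'x \<Rightarrow> 'x option) \<Rightarrow> 'x topology \<Rightarrow> ('s \<Rightarrow> 'x option) topology"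
  where "KS_space \<theta> X = subtopology (KS_tilde \<theta> X) (- {\<lambda>e\<in>idems. None})"

definition KS_action :: "('s::inverse_semigroup \<Rightarrow> 'x \<Rightarrow> 'x option) \<Rightarrow> 'x topology \<Rightarrow>
    's \<Rightarrow> ('s \<Rightarrow> 'x option) \<Rightarrow> ('s \<Rightarrow> 'x option) option"
  where "KS_action \<theta> X s \<tau> =
    (if \<tau> \<in> topspace (KS_space \<theta> X) \<and> \<tau> (s\<^sup>\<star> * s) \<noteq> None
     then Some (\<lambda>e\<in>idems. case \<tau> (s\<^sup>\<star> * e * s) of None \<Rightarrow> None | Some x \<Rightarrow> \<theta> (e * s) x)
     else None)"

section \<open>Transformation groupoids\<close>

text \<open>Arrows are equivalence classes of pairs; \<open>arrow_comp h g\<close> is only meaningful when \<open>src h = rng g\<close>.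
  The sets \<open>[s, U]\<close> generating the topology form a base of it.\<close>

record ('g, 'z) top_groupoid =
  arrows :: "'g topology"
  unit_arrow :: "'z \<Rightarrow> 'g"
  src :: "'g \<Rightarrow> 'z"
  rng :: "'g \<Rightarrow> 'z"
  arrow_comp :: "'g \<Rightarrow> 'g \<Rightarrow> 'g"
  inverse_arrow :: "'g \<Rightarrow> 'g"

definition germ_rel :: "('s::inverse_semigroup \<Rightarrow> 'z \<Rightarrow> 'z option) \<Rightarrow> (('s \<times> 'z) \<times> ('s \<times> 'z)) set"
  where "germ_rel \<theta> = {((s, z), (t, w)).
    z \<in> fixdom \<theta> (s\<^sup>\<star> * s) \<and> w \<in> fixdom \<theta> (t\<^sup>\<star> * t) \<and> z = w \<and>
    (\<exists>e\<in>idems. z \<in> fixdom \<theta> e \<and> s * e = t * e)}"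

definition germ :: "('s::inverse_semigroup \<Rightarrow> 'z \<Rightarrow> 'z option) \<Rightarrow> 's \<Rightarrow> 'z \<Rightarrow> ('s \<times> 'z) set"
  where "germ \<theta> s z = germ_rel \<theta> `` {(s, z)}"

definition transformation_groupoid ::
    "('s::inverse_semigroup \<Rightarrow> 'z \<Rightarrow> 'z option) \<Rightarrow> 'z topology \<Rightarrow> (('s \<times> 'z) set, 'z) top_groupoid"
  where "transformation_groupoid \<theta> Z = \<lparr>
    arrows = topology_generated_by
      {germ \<theta> s ` U | s U. openin Z U \<and> U \<subseteq> fixdom \<theta> (s\<^sup>\<star> * s)},
    unit_arrow = (\<lambda>z. germ \<theta> (SOME e. e \<in> idems \<and> z \<in> fixdom \<theta> e) z),
    src = (\<lambda>g. case SOME p. p \<in> g of (s, z) \<Rightarrow> z),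
    rng = (\<lambda>g. case SOME p. p \<in> g of (s, z) \<Rightarrow> the (\<theta> s z)),
    arrow_comp = (\<lambda>h g. case SOME p. p \<in> h of (t, _) \<Rightarrow> case SOME p. p \<in> g of (s, z) \<Rightarrow> germ \<theta> (t * s) z),
    inverse_arrow = (\<lambda>g. case SOME p. p \<in> g of (s, z) \<Rightarrow> germ \<theta> (s\<^sup>\<star>) (the (\<theta> s z))) \<rparr>"

section \<open>Star-algebras, C*-seminorms and completions\<close>

record 'a star_algebra =
  sa_carrier :: "'a set"
  sa_zero :: 'a
  sa_add :: "'a \<Rightarrow> 'a \<Rightarrow> 'a"
  sa_scale :: "complex \<Rightarrow> 'a \<Rightarrow> 'a"
  sa_mult :: "'a \<Rightarrow> 'a \<Rightarrow> 'a"
  sa_star :: "'a \<Rightarrow> 'a"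

record 'a normed_star_algebra = "'a star_algebra" +
  sa_norm :: "'a \<Rightarrow> real"

definition sa_diff :: "('a, 'm) star_algebra_scheme \<Rightarrow> 'a \<Rightarrow> 'a \<Rightarrow> 'a"
  where "sa_diff A x y = sa_add A x (sa_scale A (-1) y)"

definition cstar_seminorm :: "('a, 'm) star_algebra_scheme \<Rightarrow> ('a \<Rightarrow> real) \<Rightarrow> bool"
  where "cstar_seminorm A p \<longleftrightarrow>
    (\<forall>x\<in>sa_carrier A. 0 \<le> p x) \<and>
    (\<forall>c. \<forall>x\<in>sa_carrier A. p (sa_scale A c x) = cmod c * p x) \<and>
    (\<forall>x\<in>sa_carrier A. \<forall>y\<in>sa_carrier A. p (sa_add A x y) \<le> p x + p y) \<and>
    (\<forall>x\<in>sa_carrier A. \<forall>y\<in>sa_carrier A. p (sa_mult A x y) \<le> p x * p y) \<and>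
    (\<forall>x\<in>sa_carrier A. p (sa_mult A (sa_star A x) x) = (p x)\<^sup>2)"

text \<open>Hausdorff completion of a *-algebra in a seminorm: Cauchy sequences modulo null sequences.\<close>

definition cauchy_seqs :: "('a, 'm) star_algebra_scheme \<Rightarrow> ('a \<Rightarrow> real) \<Rightarrow> (nat \<Rightarrow> 'a) set"
  where "cauchy_seqs A p = {f. (\<forall>n. f n \<in> sa_carrier A) \<and>
    (\<forall>\<epsilon>>0. \<exists>N. \<forall>m\<ge>N. \<forall>n\<ge>N. p (sa_diff A (f m) (f n)) < \<epsilon>)}"

definition cauchy_class :: "('a, 'm) star_algebra_scheme \<Rightarrow> ('a \<Rightarrow> real) \<Rightarrow> (nat \<Rightarrow> 'a) \<Rightarrow> (nat \<Rightarrow> 'a) set"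
  where "cauchy_class A p f =
    {g \<in> cauchy_seqs A p. (\<lambda>n. p (sa_diff A (f n) (g n))) \<longlonglongrightarrow> 0}"

definition hausdorff_completion :: "('a, 'm) star_algebra_scheme \<Rightarrow> ('a \<Rightarrow> real) \<Rightarrow> (nat \<Rightarrow> 'a) set normed_star_algebra"
  where "hausdorff_completion A p = (let cls = cauchy_class A p; rep = (\<lambda>x. SOME f. f \<in> x) in \<lparr>
    sa_carrier = cls ` cauchy_seqs A p,
    sa_zero = cls (\<lambda>n. sa_zero A),
    sa_add = (\<lambda>x y. cls (\<lambda>n. sa_add A (rep x n) (rep y n))),
    sa_scale = (\<lambda>c x. cls (\<lambda>n. sa_scale A c (rep x n))),
    sa_mult = (\<lambda>x y. cls (\<lambda>n. sa_mult A (rep x n) (rep y n))),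
    sa_star = (\<lambda>x. cls (\<lambda>n. sa_star A (rep x n))),
    sa_norm = (\<lambda>x. lim (\<lambda>n. p (rep x n))) \<rparr>)"

text \<open>*-homomorphisms of a *-algebra into C*-algebras correspond to its C*-seminorms, so the
  universal enveloping C*-algebra is the completion in the largest C*-seminorm. The supremum is that
  of a bounded set when every element has bounded norm in all *-homomorphisms into C*-algebras; this
  holds for the algebraic crossed product below, which is spanned by elements \<open>x = \<delta>\<^sub>s a\<close> for which
  \<open>x\<^sup>* x\<close> lies in a copy of the C*-algebra \<open>A\<^bsub>s\<^sup>\<star>s\<^esub>\<close>.\<close>

definition enveloping_norm :: "('a, 'm) star_algebra_scheme \<Rightarrow> 'a \<Rightarrow> real"
  where "enveloping_norm A x = Sup {p x | p. cstar_seminorm A p}"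

definition enveloping_cstar_algebra :: "('a, 'm) star_algebra_scheme \<Rightarrow> (nat \<Rightarrow> 'a) set normed_star_algebra"
  where "enveloping_cstar_algebra A = hausdorff_completion A (enveloping_norm A)"

text \<open>The distance is set to zero off the carrier because \<^locale>\<open>Metric_space\<close> demands nonnegativity
  and symmetry for all arguments.\<close>

definition sa_dist :: "('a, 'm) normed_star_algebra_scheme \<Rightarrow> 'a \<Rightarrow> 'a \<Rightarrow> real"
  where "sa_dist B x y =
    (if x \<in> sa_carrier B \<and> y \<in> sa_carrier B then sa_norm B (sa_diff B x y) else 0)"

definition separable_algebra :: "('a, 'm) normed_star_algebra_scheme \<Rightarrow> bool"
  where "separable_algebra B \<longleftrightarrow>
    separable_space (Metric_space.mtopology (sa_carrier B) (sa_dist B))"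

section \<open>KS-crossed products\<close>

text \<open>Functions are extended by zero outside the space, so that \<open>C\<^sub>0(X\<^sub>e)\<close> is literally an ideal of
  \<open>C\<^sub>0(X)\<close>.\<close>

definition C0 :: "'z topology \<Rightarrow> ('z \<Rightarrow> complex) set"
  where "C0 Z = {f. continuous_map Z euclidean f \<and>
    (\<forall>\<epsilon>>0. compactin Z {x \<in> topspace Z. \<epsilon> \<le> cmod (f x)}) \<and> (\<forall>x. x \<notin> topspace Z \<longrightarrow> f x = 0)}"

definition ideal_at :: "('s \<Rightarrow> 'x \<Rightarrow> 'x option) \<Rightarrow> 'x topology \<Rightarrow> 's \<Rightarrow> ('x \<Rightarrow> complex) set"
  where "ideal_at \<theta> X e = C0 (subtopology X (fixdom \<theta> e))"

definition alpha :: "('s::inverse_semigroup \<Rightarrow> 'x \<Rightarrow> 'x option) \<Rightarrow> 's \<Rightarrow> ('x \<Rightarrow> complex) \<Rightarrow> 'x \<Rightarrow> complex"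
  where "alpha \<theta> s f = (\<lambda>y. case \<theta> (s\<^sup>\<star>) y of None \<Rightarrow> 0 | Some x \<Rightarrow> f x)"

text \<open>\<open>pi_term \<theta> t a b\<close> is \<open>\<alpha>\<^bsub>t\<^sup>\<star>\<^esub>(a \<alpha>\<^sub>t(b))\<close>.\<close>

definition pi_term :: "('s::inverse_semigroup \<Rightarrow> 'x \<Rightarrow> 'x option) \<Rightarrow> 's \<Rightarrow>
    ('x \<Rightarrow> complex) \<Rightarrow> ('x \<Rightarrow> complex) \<Rightarrow> 'x \<Rightarrow> complex"
  where "pi_term \<theta> t a b = alpha \<theta> (t\<^sup>\<star>) (\<lambda>x. a x * alpha \<theta> t b x)"

definition sg_supp :: "('s \<Rightarrow> 'x \<Rightarrow> complex) \<Rightarrow> 's set"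
  where "sg_supp T = {s. T s \<noteq> (\<lambda>_. 0)}"

definition delta :: "'s \<Rightarrow> ('x \<Rightarrow> complex) \<Rightarrow> 's \<Rightarrow> 'x \<Rightarrow> complex"
  where "delta s a = (\<lambda>r. if r = s then a else (\<lambda>_. 0))"

text \<open>The operations below are the bilinear (conjugate-linear) extensions of the formulas on elements
  \<open>\<delta>\<^sub>s a\<close>; see the lemmas \<open>KS_alg_mult_delta\<close> and \<open>KS_alg_star_delta\<close>.\<close>

definition KS_alg :: "('s::inverse_semigroup \<Rightarrow> 'x \<Rightarrow> 'x option) \<Rightarrow> 'x topology \<Rightarrow>
    ('s \<Rightarrow> 'x \<Rightarrow> complex) star_algebra"
  where "KS_alg \<theta> X = \<lparr>
    sa_carrier = {T. finite (sg_supp T) \<and> (\<forall>s. T s \<in> ideal_at \<theta> X (s\<^sup>\<star> * s))},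
    sa_zero = (\<lambda>s x. 0),
    sa_add = (\<lambda>T R s x. T s x + R s x),
    sa_scale = (\<lambda>c T s x. c * T s x),
    sa_mult = (\<lambda>T R r x. \<Sum>(s, t) \<in> {(s, t). s \<in> sg_supp T \<and> t \<in> sg_supp R \<and> s * t = r}.
      pi_term \<theta> t (T s) (R t) x),
    sa_star = (\<lambda>T r. alpha \<theta> (r\<^sup>\<star>) (\<lambda>x. cnj (T (r\<^sup>\<star>) x))) \<rparr>"

definition full_KS_crossed_product :: "('s::inverse_semigroup \<Rightarrow> 'x \<Rightarrow> 'x option) \<Rightarrow> 'x topology \<Rightarrow>
    (nat \<Rightarrow> 's \<Rightarrow> 'x \<Rightarrow> complex) set normed_star_algebra"
  where "full_KS_crossed_product \<theta> X = enveloping_cstar_algebra (KS_alg \<theta> X)"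

definition source_fiber :: "'s::inverse_semigroup \<Rightarrow> 's set"
  where "source_fiber e = {s. s\<^sup>\<star> * s = e}"

text \<open>The Hilbert \<open>A\<^sub>e\<close>-module of families \<open>\<xi>\<close> indexed by \<open>S\<^sub>e\<close> (extended by zero) for which
  \<open>\<Sum>\<^sub>t \<xi>\<^sub>t\<^sup>* \<xi>\<^sub>t\<close> converges in the norm of \<open>A\<^sub>e\<close>.\<close>

definition l2_module :: "('s::inverse_semigroup \<Rightarrow> 'x \<Rightarrow> 'x option) \<Rightarrow> 'x topology \<Rightarrow> 's \<Rightarrow>
    ('s \<Rightarrow> 'x \<Rightarrow> complex) set"
  where "l2_module \<theta> X e = {\<xi>. (\<forall>t\<in>source_fiber e. \<xi> t \<in> ideal_at \<theta> X e) \<and>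
    (\<forall>t. t \<notin> source_fiber e \<longrightarrow> \<xi> t = (\<lambda>_. 0)) \<and>
    (\<exists>h\<in>ideal_at \<theta> X e.
      uniform_limit UNIV (\<lambda>F x. \<Sum>t\<in>F. cnj (\<xi> t x) * \<xi> t x) h (finite_subsets_at_top (source_fiber e)))}"

definition l2_inner :: "'s::inverse_semigroup \<Rightarrow> ('s \<Rightarrow> 'x \<Rightarrow> complex) \<Rightarrow> ('s \<Rightarrow> 'x \<Rightarrow> complex) \<Rightarrow> 'x \<Rightarrow> complex"
  where "l2_inner e \<xi> \<eta> = (\<lambda>x. \<Sum>\<^sub>\<infinity>t\<in>source_fiber e. cnj (\<xi> t x) * \<eta> t x)"

text \<open>Supremum over the whole type, which is nonempty even if the space is empty.\<close>

definition sup_norm :: "('x \<Rightarrow> complex) \<Rightarrow> real"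
  where "sup_norm f = (SUP x. cmod (f x))"

definition l2_norm :: "'s::inverse_semigroup \<Rightarrow> ('s \<Rightarrow> 'x \<Rightarrow> complex) \<Rightarrow> real"
  where "l2_norm e \<xi> = sqrt (sup_norm (l2_inner e \<xi> \<xi>))"

text \<open>For \<open>T = \<Sum>\<^sub>s \<delta>\<^sub>s a\<^sub>s\<close> the sum is finite, since \<open>s\<^sup>\<star> s t = t\<close> and \<open>s t = r\<close> force \<open>t = s\<^sup>\<star> r\<close>;
  see \<open>ell_delta\<close> for the values on elementary vectors.\<close>

definition ell :: "('s::inverse_semigroup \<Rightarrow> 'x \<Rightarrow> 'x option) \<Rightarrow> 's \<Rightarrow> ('s \<Rightarrow> 'x \<Rightarrow> complex) \<Rightarrow>
    ('s \<Rightarrow> 'x \<Rightarrow> complex) \<Rightarrow> 's \<Rightarrow> 'x \<Rightarrow> complex"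
  where "ell \<theta> e T \<xi> = (\<lambda>r x.
    \<Sum>(s, t) \<in> {(s, t). s \<in> sg_supp T \<and> t \<in> source_fiber e \<and> s\<^sup>\<star> * s * t = t \<and> s * t = r}.
      pi_term \<theta> t (T s) (\<xi> t) x)"

definition l2_op_norm :: "('s::inverse_semigroup \<Rightarrow> 'x \<Rightarrow> 'x option) \<Rightarrow> 'x topology \<Rightarrow> 's \<Rightarrow>
    (('s \<Rightarrow> 'x \<Rightarrow> complex) \<Rightarrow> ('s \<Rightarrow> 'x \<Rightarrow> complex)) \<Rightarrow> real"
  where "l2_op_norm \<theta> X e F = Sup {l2_norm e (F \<xi>) | \<xi>. \<xi> \<in> l2_module \<theta> X e \<and> l2_norm e \<xi> \<le> 1}"

definition KS_reduced_norm :: "('s::inverse_semigroup \<Rightarrow> 'x \<Rightarrow> 'x option) \<Rightarrow> 'x topology \<Rightarrow>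
    ('s \<Rightarrow> 'x \<Rightarrow> complex) \<Rightarrow> real"
  where "KS_reduced_norm \<theta> X T = (SUP e\<in>idems. l2_op_norm \<theta> X e (ell \<theta> e T))"

definition reduced_KS_crossed_product :: "('s::inverse_semigroup \<Rightarrow> 'x \<Rightarrow> 'x option) \<Rightarrow> 'x topology \<Rightarrow>
    (nat \<Rightarrow> 's \<Rightarrow> 'x \<Rightarrow> complex) set normed_star_algebra"
  where "reduced_KS_crossed_product \<theta> X = hausdorff_completion (KS_alg \<theta> X) (KS_reduced_norm \<theta> X)"

lemma alpha_0 [simp]: "alpha \<theta> s (\<lambda>_. 0) = (\<lambda>_. 0)"
  by (auto simp: alpha_def split: option.splits)

lemma pi_term_0 [simp]:
  "pi_term \<theta> t (\<lambda>_. 0) b = (\<lambda>_. 0)" "pi_term \<theta> t a (\<lambda>_. 0) = (\<lambda>_. 0)"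
  by (simp_all add: pi_term_def)

lemma sg_supp_delta: "sg_supp (delta s a) = (if a = (\<lambda>_. 0) then {} else {s})"
  by (auto simp: sg_supp_def delta_def)

lemma KS_alg_mult_delta:
  "sa_mult (KS_alg \<theta> X) (delta s a) (delta t b) = delta (s * t) (pi_term \<theta> t a b)"
proof (intro ext)
  fix r x
  have "{(u, v). u \<in> sg_supp (delta s a) \<and> v \<in> sg_supp (delta t b) \<and> u * v = r} =
    (if a = (\<lambda>_. 0) \<or> b = (\<lambda>_. 0) \<or> s * t \<noteq> r then {} else {(s, t)})"
    by (auto simp: sg_supp_delta)
  then show "sa_mult (KS_alg \<theta> X) (delta s a) (delta t b) r x = delta (s * t) (pi_term \<theta> t a b) r x"
    by (auto simp: KS_alg_def delta_def)
qed

lemma KS_alg_star_delta: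
  "sa_star (KS_alg \<theta> X) (delta s a) = delta (s\<^sup>\<star>) (alpha \<theta> s (\<lambda>x. cnj (a x)))"
proof (intro ext)
  fix r x
  have "r\<^sup>\<star> = s \<longleftrightarrow> r = s\<^sup>\<star>"
    using sg_inv_inv by metis
  then show "sa_star (KS_alg \<theta> X) (delta s a) r x = delta (s\<^sup>\<star>) (alpha \<theta> s (\<lambda>x. cnj (a x))) r x"
    by (auto simp: KS_alg_def delta_def)
qed

lemma ell_delta:
  assumes "t \<in> source_fiber e"
  shows "ell \<theta> e (delta s a) (delta t y) =
    (if s\<^sup>\<star> * s * t = t then delta (s * t) (pi_term \<theta> t a y) else (\<lambda>_ _. 0))"
proof (intro ext)
  fix r x
  let ?I = "{(u, v). u \<in> sg_supp (delta s a) \<and> v \<in> source_fiber e \<and> u\<^sup>\<star> * u * v = v \<and> u * v = r}"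
  have "v = s\<^sup>\<star> * r" if "(u, v) \<in> ?I" for u v
    using that by (auto simp: sg_supp_delta mult.assoc split: if_splits)
  then have sub: "?I \<subseteq> {(s, s\<^sup>\<star> * r)}"
    by (auto simp: sg_supp_delta split: if_splits)
  have "ell \<theta> e (delta s a) (delta t y) r x =
    (\<Sum>(u, v) \<in> ?I \<inter> {(s, t)}. pi_term \<theta> v (delta s a u) (delta t y v) x)"
    unfolding ell_def
    by (rule sum.mono_neutral_right)
       (use sub finite_subset in \<open>auto simp: delta_def sg_supp_delta split: if_splits\<close>)
  moreover have "?I \<inter> {(s, t)} =
      (if a \<noteq> (\<lambda>_. 0) \<and> s\<^sup>\<star> * s * t = t \<and> s * t = r then {(s, t)} else {})"
    using assms by (auto simp: sg_supp_delta)
  ultimately show "ell \<theta> e (delta s a) (delta t y) r x =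
    (if s\<^sup>\<star> * s * t = t then delta (s * t) (pi_term \<theta> t a y) else (\<lambda>_ _. 0)) r x"
    by (auto simp: delta_def)
qed

end

theory Submission
  imports Defs
begin

text \<open>
  Each of the groupoid and the two completions is second countable or separable exactly if \<open>X\<close> is
  second countable and \<open>S\<^sup>X\<close> is countable; this is proved for each of the three separately, by direct
  arguments that do not identify the crossed products with groupoid C*-algebras.

  For the groupoid, if \<open>X\<close> is second countable and \<open>S\<^sup>X\<close> is countable, then all but countably many
  factors of the product containing \<open>X\<^sup>K\<^sup>S\<close> are single points, so \<open>X\<^sup>K\<^sup>S\<close> is second countable, and
  countably many of the sets \<open>[s, U]\<close> suffice to generate the topology of the arrows.  Conversely, a point \<open>x\<close> of
  \<open>X\<^sub>e\<close> defines the principal point \<open>\<tau>\<close> of \<open>X\<^sup>K\<^sup>S\<close> with value \<open>x\<close> on the idempotents above \<open>e\<close> and infinity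
  elsewhere.  At such a point over \<open>s\<^sup>\<star>s\<close> the germ \<open>[s, \<tau>]\<close> lies in the open set of germs of \<open>t\<close> only
  if \<open>s \<le> t\<close>, which makes the germs, one for each \<open>s\<close> in \<open>S\<^sup>X\<close>, distinguishable by basic open sets; and
  \<open>x \<mapsto> [e, \<tau>]\<close> embeds \<open>X\<^sub>e\<close> into the arrows
  (\<open>second_countable_KS_groupoid_iff\<close>).

  For the algebras, two inequalities for a seminorm \<open>p\<close> on the algebraic crossed product decide the
  matter (\<open>separable_KS_completion_iff\<close>).  The upper bound \<open>p(\<delta>\<^sub>s a) \<le> \<parallel>a\<parallel>\<close> transports
  countable dense subsets of the algebras \<open>C\<^sub>0(X\<^bsub>s\<^sup>\<star>s\<^esub>)\<close> to a dense subset of the completion.  The lower bound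
  \<open>\<bar>\<Sum>\<^bsub>t \<ge> s\<^esub> T\<^sub>t(x)\<bar> \<le> p(T)\<close>, for \<open>x\<close> in \<open>X\<^bsub>s\<^sup>\<star>s\<^esub>\<close>, separates the elements \<open>\<delta>\<^sub>s a\<^sub>s\<close> for different
  \<open>s\<close>, since \<open>s \<le> t\<close> and \<open>t \<le> s\<close> together force \<open>s = t\<close>, and recovers \<open>C\<^sub>0(X\<^sub>e)\<close>, whose separability gives a
  countable base of \<open>X\<^sub>e\<close>.

  Both bounds come from the regular representation over a point \<open>x\<close>, the fibre of the Hilbert modules
  at \<open>x\<close>: there \<open>\<delta>\<^sub>s a\<close> is a weighted partial injection with weights bounded by \<open>\<parallel>a\<parallel>\<close>, and the
  coefficient of \<open>T\<close> from the basis vector \<open>s\<^sup>\<star>s\<close> to \<open>s\<close> is the sum above.  This settles the reduced norm.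
  For the full norm, the operator norm of this representation is itself a C*-seminorm, which gives the
  lower bound; the upper bound holds for every C*-seminorm by the C*-identity and the fact that a real
  function of modulus at most \<open>1\<close> is the mean of two unitary multipliers.
\<close>


section \<open>Inverse semigroups and their actions\<close>

text \<open>With \<open>x = (ef)\<^sup>\<star>\<close>, the element \<open>fxe\<close> is also inverse to \<open>ef\<close>, so \<open>fxe = x\<close>; this makes \<open>x\<close>
  idempotent, and an idempotent is its own inverse.\<close>

lemma idem_mult_closed:
  fixes e f :: "'s::inverse_semigroup"
  assumes e: "e \<in> idems" and f: "f \<in> idems"
  shows "e * f \<in> idems"
proof -
  have ee: "e * e = e" and ff: "f * f = f" using e f by (auto simp: idems_def)
  have ee': "e * (e * z) = e * z" and ff': "f * (f * z) = f * z" for z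
    by (simp_all add: ee ff mult.assoc[symmetric])
  let ?x = "(e * f)\<^sup>\<star>"
  have x1: "e * (f * (?x * (e * f))) = e * f" and x2: "?x * (e * (f * ?x)) = ?x"
    using sg_inv[of "e * f"] by (simp_all add: mult.assoc)
  have x2': "?x * (e * (f * (?x * z))) = ?x * z" for z
    using x2 by (metis mult.assoc)
  have "f * ?x * e = ?x"
    by (rule sg_inv_unique) (simp_all add: mult.assoc ee' ff' x1 x2')
  then have "?x * ?x = ?x"
    by (metis x2' mult.assoc)
  then have "?x \<in> idems" by (simp add: idems_def)
  then show ?thesis using idem_inv sg_inv_inv by metis
qed

text \<open>If \<open>e\<close> and \<open>f\<close> are idempotent then so are \<open>ef\<close> and \<open>fe\<close>, and these two are
  then both inverse to \<open>ef\<close>; uniqueness of inverses makes them equal.\<close>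

lemma idem_commute:
  fixes e f :: "'s::inverse_semigroup"
  assumes e: "e \<in> idems" and f: "f \<in> idems"
  shows "e * f = f * e"
proof -
  have ee: "e * e = e" and ff: "f * f = f" using e f by (auto simp: idems_def)
  have ee': "e * (e * z) = e * z" and ff': "f * (f * z) = f * z" for z
    by (simp_all add: ee ff mult.assoc[symmetric])
  have ef: "e * (f * (e * f)) = e * f" and fe: "f * (e * (f * e)) = f * e"
    using idem_mult_closed[OF e f] idem_mult_closed[OF f e]
    by (simp_all add: idems_def mult.assoc)
  have "f * e = (e * f)\<^sup>\<star>"
    by (rule sg_inv_unique) (simp_all add: mult.assoc ee' ff' ef fe)
  also have "\<dots> = e * f"
    by (rule idem_inv[OF idem_mult_closed[OF e f]])
  finally show ?thesis by simp
qed

lemma idemD: "e \<in> idems \<Longrightarrow> e * e = e"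
  by (simp add: idems_def)

lemma sg_inv_mult:
  fixes s t :: "'s::inverse_semigroup"
  shows "(s * t)\<^sup>\<star> = t\<^sup>\<star> * s\<^sup>\<star>"
proof -
  have c: "(s\<^sup>\<star> * s) * (t * t\<^sup>\<star>) = (t * t\<^sup>\<star>) * (s\<^sup>\<star> * s)"
    by (rule idem_commute[OF idem_inv_mult idem_mult_inv])
  have "t\<^sup>\<star> * s\<^sup>\<star> = (s * t)\<^sup>\<star>"
  proof (rule sg_inv_unique)
    have "s * t * (t\<^sup>\<star> * s\<^sup>\<star>) * (s * t) = s * ((t * t\<^sup>\<star>) * (s\<^sup>\<star> * s)) * t"
      by (simp add: mult.assoc)
    also have "\<dots> = (s * s\<^sup>\<star> * s) * (t * t\<^sup>\<star> * t)"
      by (simp only: c[symmetric]) (simp add: mult.assoc)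
    finally show "s * t * (t\<^sup>\<star> * s\<^sup>\<star>) * (s * t) = s * t" by (simp add: sg_inv)
    have "t\<^sup>\<star> * s\<^sup>\<star> * (s * t) * (t\<^sup>\<star> * s\<^sup>\<star>) = t\<^sup>\<star> * ((s\<^sup>\<star> * s) * (t * t\<^sup>\<star>)) * s\<^sup>\<star>"
      by (simp add: mult.assoc)
    also have "\<dots> = (t\<^sup>\<star> * t * t\<^sup>\<star>) * (s\<^sup>\<star> * s * s\<^sup>\<star>)"
      by (simp only: c) (simp add: mult.assoc)
    finally show "t\<^sup>\<star> * s\<^sup>\<star> * (s * t) * (t\<^sup>\<star> * s\<^sup>\<star>) = t\<^sup>\<star> * s\<^sup>\<star>" by (simp add: sg_inv)
  qed
  then show ?thesis by simp
qed

lemma idem_nat_le_iff: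
  "e \<in> idems \<Longrightarrow> nat_le e f \<longleftrightarrow> f * e = (e :: 's::inverse_semigroup)"
  by (simp add: nat_le_def idem_inv mult.assoc idemD)

lemma nat_le_refl [simp]: "nat_le s (s :: 's::inverse_semigroup)"
  by (simp add: nat_le_def sg_inv)

lemma nat_le_antisym:
  fixes s t :: "'s::inverse_semigroup"
  assumes "nat_le s t" "nat_le t s"
  shows "s = t"
proof -
  have st: "t * (s\<^sup>\<star> * s) = s" and ts: "s * (t\<^sup>\<star> * t) = t"
    using assms by (simp_all add: nat_le_def mult.assoc)
  have "s * (t\<^sup>\<star> * t) = t * ((s\<^sup>\<star> * s) * (t\<^sup>\<star> * t))"
    by (metis st mult.assoc)
  also have "\<dots> = t * ((t\<^sup>\<star> * t) * (s\<^sup>\<star> * s))"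
    by (simp only: idem_commute[OF idem_inv_mult idem_inv_mult])
  also have "\<dots> = (t * t\<^sup>\<star> * t) * (s\<^sup>\<star> * s)"
    by (simp add: mult.assoc)
  also have "\<dots> = s"
    by (simp only: sg_inv st)
  finally show ?thesis using ts by simp
qed

text \<open>The condition on the right says that \<open>t\<close> moves the basis vector \<open>s\<^sup>\<star>s\<close> to \<open>s\<close> in the left
  regular representation, which is how the order enters the norm estimates.\<close>

lemma nat_le_iff_left_mult:
  fixes s t :: "'s::inverse_semigroup"
  shows "nat_le s t \<longleftrightarrow> t * t\<^sup>\<star> * s = s \<and> t\<^sup>\<star> * s = s\<^sup>\<star> * s"
proof
  assume "nat_le s t"
  then have st: "t * (s\<^sup>\<star> * s) = s" by (simp add: nat_le_def mult.assoc)
  have 1: "t * t\<^sup>\<star> * s = s"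
    by (metis st sg_inv(1) mult.assoc)
  have c: "(s\<^sup>\<star> * s) * (t\<^sup>\<star> * t) = (t\<^sup>\<star> * t) * (s\<^sup>\<star> * s)"
    by (rule idem_commute[OF idem_inv_mult idem_inv_mult])
  have "s\<^sup>\<star> = (s\<^sup>\<star> * s) * t\<^sup>\<star>"
    by (subst (1) st[symmetric]) (simp add: sg_inv_mult mult.assoc[symmetric])
  then have "s\<^sup>\<star> * s = (s\<^sup>\<star> * s) * t\<^sup>\<star> * (t * (s\<^sup>\<star> * s))"
    using st by metis
  also have "\<dots> = ((s\<^sup>\<star> * s) * (t\<^sup>\<star> * t)) * (s\<^sup>\<star> * s)" by (simp add: mult.assoc)
  also have "\<dots> = (t\<^sup>\<star> * t) * ((s\<^sup>\<star> * s) * (s\<^sup>\<star> * s))"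
    by (simp only: c) (simp only: mult.assoc)
  also have "\<dots> = t\<^sup>\<star> * (t * (s\<^sup>\<star> * s))" 
    by (simp only: idemD[OF idem_inv_mult]) (simp only: mult.assoc)
  finally have "t\<^sup>\<star> * s = s\<^sup>\<star> * s" by (simp only: st)
  with 1 show "t * t\<^sup>\<star> * s = s \<and> t\<^sup>\<star> * s = s\<^sup>\<star> * s" by simp
next
  assume "t * t\<^sup>\<star> * s = s \<and> t\<^sup>\<star> * s = s\<^sup>\<star> * s"
  then show "nat_le s t" by (simp add: nat_le_def) (metis mult.assoc)
qed

context
  fixes \<theta> :: "'s::inverse_semigroup \<Rightarrow> 'z \<Rightarrow> 'z option" and Z :: "'z topology"
  assumes act: "sg_action \<theta> Z"
begin

lemma action_mult: "\<theta> (s * t) x = (case \<theta> t x of None \<Rightarrow> None | Some y \<Rightarrow> \<theta> s y)"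
  using act by (simp add: sg_action_def map_comp_def)

lemma action_openin_fixdom: "e \<in> idems \<Longrightarrow> openin Z (fixdom \<theta> e)"
  using act by (simp add: sg_action_def)

lemma action_fixdom_subset: "e \<in> idems \<Longrightarrow> fixdom \<theta> e \<subseteq> topspace Z"
  using action_openin_fixdom openin_subset by blast

lemma action_Union_fixdom: "(\<Union>e\<in>idems. fixdom \<theta> e) = topspace Z"
  using act by (simp add: sg_action_def)

lemma action_defined_iff: "(\<exists>y. \<theta> s x = Some y) \<longleftrightarrow> x \<in> fixdom \<theta> (s\<^sup>\<star> * s)"
  using dom_sg_action[OF act, of s] by (auto simp: dom_def)

lemma action_idem: "e \<in> idems \<Longrightarrow> \<theta> e x = (if x \<in> fixdom \<theta> e then Some x else None)"
  using action_defined_iff[of e x] by (auto simp: idem_inv idemD fixdom_def)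

lemma action_inv_iff: "\<theta> s x = Some y \<longleftrightarrow> \<theta> (s\<^sup>\<star>) y = Some x"
proof -
  have *: "\<theta> (s\<^sup>\<star>) y = Some x" if "\<theta> s x = Some y" for s x y
  proof -
    have "\<theta> (s\<^sup>\<star> * s) x = Some x"
      using that action_defined_iff[of s x] by (auto simp: fixdom_def)
    then show ?thesis using that by (simp add: action_mult)
  qed
  show ?thesis using *[of s x y] *[of "s\<^sup>\<star>" y x] by auto
qed

lemma action_fixdom_mult:
  "e \<in> idems \<Longrightarrow> f \<in> idems \<Longrightarrow> fixdom \<theta> (e * f) = fixdom \<theta> e \<inter> fixdom \<theta> f"
  by (auto simp: fixdom_def[of _ "e * f"] action_mult action_idem split: option.splits if_splits)

lemma action_fixdom_mono:
  "e \<in> idems \<Longrightarrow> f \<in> idems \<Longrightarrow> nat_le e f \<Longrightarrow> fixdom \<theta> e \<subseteq> fixdom \<theta> f"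
  using action_fixdom_mult[of f e] by (auto simp: idem_nat_le_iff)

end


section \<open>Second countability\<close>

definition countable_base :: "'a topology \<Rightarrow> 'a set set \<Rightarrow> bool"
  where "countable_base X \<B> \<longleftrightarrow> countable \<B> \<and> (\<forall>V\<in>\<B>. openin X V) \<and>
    (\<forall>U x. openin X U \<and> x \<in> U \<longrightarrow> (\<exists>V\<in>\<B>. x \<in> V \<and> V \<subseteq> U))"

lemma second_countable_iff_countable_base: "second_countable X \<longleftrightarrow> (\<exists>\<B>. countable_base X \<B>)"
  by (simp add: second_countable_def countable_base_def)

lemma countable_baseD:
  assumes "countable_base X \<B>"
  shows "countable \<B>" "V \<in> \<B> \<Longrightarrow> openin X V"
    "openin X U \<Longrightarrow> x \<in> U \<Longrightarrow> \<exists>V\<in>\<B>. x \<in> V \<and> V \<subseteq> U"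
  using assms by (simp_all add: countable_base_def)

lemma second_countable_if_subbase:
  assumes "countable \<S>" and op: "\<And>S. S \<in> \<S> \<Longrightarrow> openin X S"
    and sub: "\<And>U x. openin X U \<Longrightarrow> x \<in> U \<Longrightarrow>
      \<exists>\<F>. finite \<F> \<and> \<F> \<subseteq> \<S> \<and> x \<in> \<Inter>\<F> \<and> topspace X \<inter> \<Inter>\<F> \<subseteq> U"
  shows "second_countable X"
proof -
  let ?B = "(\<lambda>\<F>. topspace X \<inter> \<Inter>\<F>) ` {\<F>. finite \<F> \<and> \<F> \<subseteq> \<S>}"
  have 1: "countable ?B"
    using countable_Collect_finite_subset[OF assms(1)] by simp
  have 2: "openin X V" if VB: "V \<in> ?B" for V
  proof -
    obtain \<F> where "\<F> \<in> {\<F>. finite \<F> \<and> \<F> \<subseteq> \<S>}" and V: "V = topspace X \<inter> \<Inter>\<F>"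
      using VB by (rule imageE)
    then have F: "finite \<F>" "\<F> \<subseteq> \<S>" by simp_all
    have "openin X (topspace X \<inter> \<Inter>\<F>)"
      using F(1,2) by induction (auto simp: op openin_Int inf_left_commute)
    then show ?thesis by (simp only: V)
  qed
  have 3: "\<exists>V\<in>?B. x \<in> V \<and> V \<subseteq> U" if Ux: "openin X U" "x \<in> U" for U x
  proof -
    obtain \<F> where "finite \<F>" "\<F> \<subseteq> \<S>" "x \<in> \<Inter>\<F>" "topspace X \<inter> \<Inter>\<F> \<subseteq> U"
      using sub[OF Ux] by auto
    moreover have "x \<in> topspace X" using Ux openin_subset by blast
    ultimately show ?thesis by (intro bexI[of _ "topspace X \<inter> \<Inter>\<F>"]) auto
  qed
  have "countable_base X ?B"
    unfolding countable_base_def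
    by (intro conjI ballI allI impI) (erule conjE | rule 1 | erule 2 | erule (1) 3)+
  then show ?thesis unfolding second_countable_iff_countable_base by (rule exI)
qed

lemma second_countable_topology_generated_by:
  assumes "countable \<T>" and "\<T> \<subseteq> \<S>"
    and refine: "\<And>S x. S \<in> \<S> \<Longrightarrow> x \<in> S \<Longrightarrow> \<exists>T\<in>\<T>. x \<in> T \<and> T \<subseteq> S"
  shows "second_countable (topology_generated_by \<S>)"
proof (rule second_countable_if_subbase[OF assms(1)])
  show "openin (topology_generated_by \<S>) S" if "S \<in> \<T>" for S
    using that assms(2) by (auto intro: topology_generated_by_Basis)
  show "\<exists>\<F>. finite \<F> \<and> \<F> \<subseteq> \<T> \<and> x \<in> \<Inter>\<F> \<and> topspace (topology_generated_by \<S>) \<inter> \<Inter>\<F> \<subseteq> U"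
    if "openin (topology_generated_by \<S>) U" "x \<in> U" for U x
    using openin_topology_generated_by[OF that(1)] that(2)
  proof (induction U)
    case Empty
    then show ?case by simp
  next
    case (Int a b)
    then obtain F G where "finite F" "F \<subseteq> \<T>" "x \<in> \<Inter>F" "topspace (topology_generated_by \<S>) \<inter> \<Inter>F \<subseteq> a"
      "finite G" "G \<subseteq> \<T>" "x \<in> \<Inter>G" "topspace (topology_generated_by \<S>) \<inter> \<Inter>G \<subseteq> b"
      by (metis IntD1 IntD2)
    then show ?case by (intro exI[of _ "F \<union> G"]) auto
  next
    case (UN K)
    then show ?case by (metis Union_iff Union_upper subset_trans)
  next
    case (Basis S)
    then obtain T where "T \<in> \<T>" "x \<in> T" "T \<subseteq> S" using refine by metis
    then show ?case by (intro exI[of _ "{T}"]) auto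
  qed
qed

text \<open>A factor with at most one point does not contribute to the product, so only the number of
  the remaining factors has to be countable.\<close>

lemma second_countable_product_topology:
  assumes sc: "\<And>i. i \<in> J \<Longrightarrow> second_countable (T i)" and J: "countable J" "J \<subseteq> I"
    and triv: "\<And>i. i \<in> I - J \<Longrightarrow> \<exists>a. topspace (T i) \<subseteq> {a}"
  shows "second_countable (product_topology T I)"
proof -
  obtain \<B> where B: "\<And>i. i \<in> J \<Longrightarrow> countable_base (T i) (\<B> i)"
    using sc unfolding second_countable_iff_countable_base by metis
  note cB = countable_baseD(1)[OF B] and oB = countable_baseD(2)[OF B] and bB = countable_baseD(3)[OF B]
  let ?P = "topspace (product_topology T I)"
  let ?sub = "\<lambda>i V. {f \<in> ?P. f i \<in> V}"
  show ?thesis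
  proof (rule second_countable_if_subbase)
    show "countable (\<Union>i\<in>J. ?sub i ` \<B> i)"
      using J(1) cB by (intro countable_UN countable_image) auto
    show "openin (product_topology T I) S" if "S \<in> (\<Union>i\<in>J. ?sub i ` \<B> i)" for S
    proof -
      obtain i V where i: "i \<in> J" "V \<in> \<B> i" "S = ?sub i V" using \<open>S \<in> _\<close> by auto
      have "continuous_map (product_topology T I) (T i) (\<lambda>f. f i)"
        using J(2) i(1) by (intro continuous_map_product_projection) auto
      from openin_continuous_map_preimage[OF this oB[OF i(1,2)]] show ?thesis by (simp only: i(3))
    qed
    fix U f assume U: "openin (product_topology T I) U" "f \<in> U"
    then have "\<exists>W. finite {i \<in> I. W i \<noteq> topspace (T i)} \<and> (\<forall>i\<in>I. openin (T i) (W i)) \<and>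
        f \<in> Pi\<^sub>E I W \<and> Pi\<^sub>E I W \<subseteq> U"
      unfolding openin_product_topology_alt by simp
    then obtain W where W': "finite {i \<in> I. W i \<noteq> topspace (T i)} \<and> (\<forall>i\<in>I. openin (T i) (W i)) \<and>
        f \<in> Pi\<^sub>E I W \<and> Pi\<^sub>E I W \<subseteq> U"
      by (rule exE)
    then have W: "finite {i \<in> I. W i \<noteq> topspace (T i)}" "\<And>i. i \<in> I \<Longrightarrow> openin (T i) (W i)"
      "f \<in> Pi\<^sub>E I W" "Pi\<^sub>E I W \<subseteq> U"
      by simp_all
    let ?F = "{i \<in> J. W i \<noteq> topspace (T i)}"
    have finF: "finite ?F"
      using finite_subset[OF _ W(1), of ?F] J(2) by auto
    have "\<exists>V\<in>\<B> i. f i \<in> V \<and> V \<subseteq> W i" if "i \<in> ?F" for i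
    proof (rule bB)
      have "i \<in> I" "i \<in> J" using that J(2) by auto
      then show "i \<in> J" "openin (T i) (W i)" "f i \<in> W i" using W(2,3) by (auto simp: PiE_iff)
    qed
    then obtain V where V: "\<And>i. i \<in> ?F \<Longrightarrow> V i \<in> \<B> i \<and> f i \<in> V i \<and> V i \<subseteq> W i" by metis
    have fP: "f \<in> ?P" using U openin_subset by blast
    let ?FF = "(\<lambda>i. ?sub i (V i)) ` ?F"
    have "g \<in> Pi\<^sub>E I W" if g: "g \<in> ?P" "\<And>i. i \<in> ?F \<Longrightarrow> g i \<in> V i" for g
    proof (rule PiE_I)
      show "g i = undefined" if "i \<notin> I" for i 
        using PiE_arb[of g I "\<lambda>i. topspace (T i)" i] g(1) that by simp
      show "g i \<in> W i" if i: "i \<in> I" for i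
      proof (cases "i \<in> ?F")
        case True
        show ?thesis using V[OF True] g(2)[OF True] by auto
      next
        case False
        have gi: "g i \<in> topspace (T i)" "f i \<in> topspace (T i)" "f i \<in> W i"
          using g(1) fP i W(3) by (auto simp: PiE_iff)
        then show ?thesis
        proof (cases "i \<in> J")
          case True
          then show ?thesis using False gi by auto
        next
          case iJ: False
          then obtain a where "topspace (T i) \<subseteq> {a}" using triv[of i] i by auto
          then have "g i = f i" using gi by auto
          then show ?thesis using gi by simp
        qed
      qed
    qed
    note key = this
    have "?P \<inter> \<Inter>?FF \<subseteq> U"
    proof
      fix g assume g: "g \<in> ?P \<inter> \<Inter>?FF"
      then have "g i \<in> V i" if "i \<in> ?F" for i using that by auto
      then show "g \<in> U" using key[of g] g W(4) by auto
    qed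
    moreover have "?FF \<subseteq> (\<Union>i\<in>J. ?sub i ` \<B> i)"
    proof
      fix S assume "S \<in> ?FF"
      then obtain i where i: "i \<in> ?F" "S = ?sub i (V i)" by (rule imageE)
      then have "S \<in> ?sub i ` \<B> i" using V[OF i(1)] by blast
      then show "S \<in> (\<Union>i\<in>J. ?sub i ` \<B> i)" using i(1) by blast
    qed
    moreover have "finite ?FF" "f \<in> \<Inter>?FF"
      using finF V fP by auto
    ultimately show "\<exists>\<F>. finite \<F> \<and> \<F> \<subseteq> (\<Union>i\<in>J. ?sub i ` \<B> i) \<and> f \<in> \<Inter>\<F> \<and> ?P \<inter> \<Inter>\<F> \<subseteq> U"
      by blast
  qed
qed

text \<open>A compact set is covered by finitely many basic sets with compact closure, so complements of
  closures of finite unions of basic sets form a countable neighbourhood base at infinity.\<close>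

lemma second_countable_Alexandroff_compactification:
  assumes sc: "second_countable Z" and lc: "locally_compact_space Z" and H: "Hausdorff_space Z"
  shows "second_countable (Alexandroff_compactification Z)"
proof -
  obtain \<B> where "countable_base Z \<B>"
    using sc unfolding second_countable_iff_countable_base by metis
  note B = countable_baseD[OF this]
  let ?cofin = "\<lambda>\<F>. insert None (Some ` (topspace Z - Z closure_of \<Union>\<F>))"
  let ?F = "{\<F>. finite \<F> \<and> \<F> \<subseteq> \<B> \<and> compactin Z (Z closure_of \<Union>\<F>)}"
  show ?thesis
  proof (rule second_countable_if_subbase)
    show "countable ((`) Some ` \<B> \<union> ?cofin ` ?F)"
      using B(1) countable_subset[OF _ countable_Collect_finite_subset[OF B(1)], of ?F] by auto
    show "openin (Alexandroff_compactification Z) S" if "S \<in> (`) Some ` \<B> \<union> ?cofin ` ?F" for S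
      using that B(2) by (auto simp: openin_Alexandroff_compactification)
    fix U x assume U: "openin (Alexandroff_compactification Z) U" "x \<in> U"
    have "\<exists>S \<in> (`) Some ` \<B> \<union> ?cofin ` ?F. x \<in> S \<and> S \<subseteq> U"
    proof (cases x)
      case (Some z)
      have "openin (Alexandroff_compactification Z) (U \<inter> Some ` topspace Z)"
        using U(1) by (intro openin_Int) auto
      then obtain W where W: "openin Z W" "U \<inter> Some ` topspace Z = Some ` W"
        unfolding openin_Alexandroff_compactification by auto
      have "z \<in> W" using W U openin_subset[OF U(1)] Some by force
      then obtain V where "V \<in> \<B>" "z \<in> V" "V \<subseteq> W" using B(3) W(1) by blast
      then show ?thesis using W(2) Some by (intro bexI[of _ "Some ` V"]) auto
    next
      case None
      with U obtain C where C: "compactin Z C" "closedin Z C" "U = insert None (Some ` (topspace Z - C))"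
        unfolding openin_Alexandroff_compactification by auto
      have "\<exists>V\<in>\<B>. z \<in> V \<and> compactin Z (Z closure_of V)" if "z \<in> C" for z
      proof -
        have "z \<in> topspace Z" using that C(1) compactin_subset_topspace by blast
        then obtain U' K where UK: "openin Z U'" "compactin Z K" "z \<in> U'" "U' \<subseteq> K"
          using lc unfolding locally_compact_space_def by blast
        then obtain V where V: "V \<in> \<B>" "z \<in> V" "V \<subseteq> U'" using B(3) by blast
        have "Z closure_of V \<subseteq> K"
          using V UK compactin_imp_closedin[OF H UK(2)] by (meson closure_of_minimal order_trans)
        then have "compactin Z (Z closure_of V)"
          using closed_compactin[OF UK(2)] by simp
        with V show ?thesis by blast
      qed
      then obtain V where V: "\<And>z. z \<in> C \<Longrightarrow> V z \<in> \<B> \<and> z \<in> V z \<and> compactin Z (Z closure_of (V z))"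
        by metis
      have "\<exists>\<F>. finite \<F> \<and> \<F> \<subseteq> V ` C \<and> C \<subseteq> \<Union>\<F>"
      proof (rule compactinD[OF C(1)])
        show "openin Z U" if "U \<in> V ` C" for U using that V B(2) by auto
        show "C \<subseteq> \<Union> (V ` C)" using V by auto
      qed
      then obtain \<F> where F: "finite \<F>" "\<F> \<subseteq> V ` C" "C \<subseteq> \<Union>\<F>" by blast
      have "compactin Z (\<Union>V\<in>\<F>. Z closure_of V)"
        using F V by (intro compactin_Union) auto
      then have "compactin Z (Z closure_of \<Union>\<F>)"
        using F(1) by (simp add: closure_of_Union)
      moreover have "\<F> \<subseteq> \<B>" using F(2) V by auto
      moreover have "C \<subseteq> Z closure_of \<Union>\<F>"
      proof -
        have "\<Union>\<F> \<subseteq> topspace Z" using \<open>\<F> \<subseteq> \<B>\<close> B(2) openin_subset by blast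
        then show ?thesis using F(3) closure_of_subset by blast
      qed
      ultimately show ?thesis using F(1) C(3) None by (intro bexI[of _ "?cofin \<F>"]) auto
    qed
    then obtain S where "S \<in> (`) Some ` \<B> \<union> ?cofin ` ?F" "x \<in> S" "S \<subseteq> U" by blast
    then show "\<exists>\<F>. finite \<F> \<and> \<F> \<subseteq> (`) Some ` \<B> \<union> ?cofin ` ?F \<and> x \<in> \<Inter>\<F> \<and>
        topspace (Alexandroff_compactification Z) \<inter> \<Inter>\<F> \<subseteq> U"
      by (intro exI[of _ "{S}"]) auto
  qed
qed

lemma second_countable_open_cover:
  assumes "countable \<C>" and op: "\<And>U. U \<in> \<C> \<Longrightarrow> openin X U" and cov: "topspace X \<subseteq> \<Union>\<C>"
    and sc: "\<And>U. U \<in> \<C> \<Longrightarrow> second_countable (subtopology X U)"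
  shows "second_countable X"
proof -
  obtain \<B> where B: "\<And>C. C \<in> \<C> \<Longrightarrow> countable_base (subtopology X C) (\<B> C)"
    using sc unfolding second_countable_iff_countable_base by metis
  note cB = countable_baseD(1)[OF B] and oB = countable_baseD(2)[OF B] and bB = countable_baseD(3)[OF B]
  show ?thesis
    unfolding second_countable_def
  proof (intro exI[of _ "\<Union>C\<in>\<C>. \<B> C"] conjI ballI allI impI)
    show "countable (\<Union>C\<in>\<C>. \<B> C)" using assms(1) cB by auto
    show "openin X V" if "V \<in> (\<Union>C\<in>\<C>. \<B> C)" for V
      using that oB op openin_open_subtopology by blast
    fix U x assume U: "openin X U \<and> x \<in> U"
    then obtain C where C: "C \<in> \<C>" "x \<in> C" using cov openin_subset by blast
    have "openin (subtopology X C) (C \<inter> U)" using U by (simp add: openin_subtopology_Int2)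
    then obtain V where "V \<in> \<B> C" "x \<in> V" "V \<subseteq> C \<inter> U" using bB[OF C(1)] C(2) U by blast
    then show "\<exists>V\<in>\<Union>C\<in>\<C>. \<B> C. x \<in> V \<and> V \<subseteq> U" using C(1) by blast
  qed
qed


section \<open>The space \<open>X\<^sup>K\<^sup>S\<close> and its groupoid\<close>

lemma germ_iff:
  "(t, w) \<in> germ \<kappa> s z \<longleftrightarrow> z \<in> fixdom \<kappa> (s\<^sup>\<star> * s) \<and> w \<in> fixdom \<kappa> (t\<^sup>\<star> * t) \<and> z = w \<and>
    (\<exists>e\<in>idems. z \<in> fixdom \<kappa> e \<and> s * e = t * e)"
  by (auto simp: germ_def germ_rel_def)

text \<open>The assumption makes the germ relation transitive: two witnessing idempotents combine to their product.\<close>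

lemma germ_eq_iff:
  assumes inter: "\<And>e f. e \<in> idems \<Longrightarrow> f \<in> idems \<Longrightarrow> fixdom \<kappa> e \<inter> fixdom \<kappa> f \<subseteq> fixdom \<kappa> (e * f)"
    and z: "z \<in> fixdom \<kappa> (s\<^sup>\<star> * s)" and w: "w \<in> fixdom \<kappa> (t\<^sup>\<star> * t)"
  shows "germ \<kappa> s z = germ \<kappa> t w \<longleftrightarrow> z = w \<and> (\<exists>e\<in>idems. z \<in> fixdom \<kappa> e \<and> s * e = t * e)"
proof
  assume "germ \<kappa> s z = germ \<kappa> t w"
  moreover have "(s, z) \<in> germ \<kappa> s z" using z idem_inv_mult by (auto simp: germ_iff)
  ultimately show "z = w \<and> (\<exists>e\<in>idems. z \<in> fixdom \<kappa> e \<and> s * e = t * e)"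
    by (auto simp: germ_iff intro: sym)
next
  have trans: "germ \<kappa> s z \<subseteq> germ \<kappa> t z"
    if e: "e \<in> idems" "z \<in> fixdom \<kappa> e" "s * e = t * e" and "z \<in> fixdom \<kappa> (t\<^sup>\<star> * t)" for s t e
  proof (rule subrelI)
    fix u v assume "(u, v) \<in> germ \<kappa> s z"
    then obtain f where f: "v = z" "z \<in> fixdom \<kappa> (u\<^sup>\<star> * u)" "f \<in> idems" "z \<in> fixdom \<kappa> f" "s * f = u * f"
      by (auto simp: germ_iff)
    have ef: "e * f = f * e" by (rule idem_commute[OF e(1) f(3)])
    have "t * (e * f) = s * f * e" using e(3) by (metis ef mult.assoc)
    also have "\<dots> = u * (e * f)" using f(5) by (metis ef mult.assoc)
    finally have "t * (e * f) = u * (e * f)" .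
    moreover have "z \<in> fixdom \<kappa> (e * f)" using inter[OF e(1) f(3)] e f by blast
    ultimately show "(u, v) \<in> germ \<kappa> t z"
      using f that(4) idem_mult_closed[OF e(1) f(3)] by (auto simp: germ_iff)
  qed
  assume "z = w \<and> (\<exists>e\<in>idems. z \<in> fixdom \<kappa> e \<and> s * e = t * e)"
  then obtain e where "z = w" "e \<in> idems" "z \<in> fixdom \<kappa> e" "s * e = t * e" by blast
  then show "germ \<kappa> s z = germ \<kappa> t w"
    using trans[of e s t] trans[of e t s] z w by auto
qed

lemma arrows_transformation_groupoid:
  "arrows (transformation_groupoid \<kappa> Z) =
    topology_generated_by {germ \<kappa> s ` U | s U. openin Z U \<and> U \<subseteq> fixdom \<kappa> (s\<^sup>\<star> * s)}"
  by (simp add: transformation_groupoid_def)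

lemma openin_arrows_germs:
  "openin Z U \<Longrightarrow> U \<subseteq> fixdom \<kappa> (s\<^sup>\<star> * s) \<Longrightarrow>
    openin (arrows (transformation_groupoid \<kappa> Z)) (germ \<kappa> s ` U)"
  unfolding arrows_transformation_groupoid by (rule topology_generated_by_Basis) blast

text \<open>The sets \<open>[s, U]\<close> with \<open>U\<close> from a countable base and \<open>s\<close> of nonempty domain refine all
  generating sets.\<close>

lemma second_countable_transformation_groupoid:
  assumes "second_countable Z" and ctb: "countable {s. fixdom \<kappa> (s\<^sup>\<star> * s) \<noteq> {}}"
  shows "second_countable (arrows (transformation_groupoid \<kappa> Z))"
proof -
  obtain \<B> where "countable_base Z \<B>"
    using assms(1) by (auto simp: second_countable_iff_countable_base)
  note B = countable_baseD[OF this]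
  define \<T> where "\<T> = {germ \<kappa> s ` U | s U. U \<in> \<B> \<and> U \<subseteq> fixdom \<kappa> (s\<^sup>\<star> * s)}"
  let ?S = "{s. fixdom \<kappa> (s\<^sup>\<star> * s) \<noteq> {}}"
  show ?thesis
    unfolding arrows_transformation_groupoid
  proof (rule second_countable_topology_generated_by)
    have "\<T> \<subseteq> insert {} ((\<lambda>(s, U). germ \<kappa> s ` U) ` (?S \<times> \<B>))"
    proof
      fix T assume "T \<in> \<T>"
      then obtain s U where sU: "T = germ \<kappa> s ` U" "U \<in> \<B>" "U \<subseteq> fixdom \<kappa> (s\<^sup>\<star> * s)"
        unfolding \<T>_def by blast
      show "T \<in> insert {} ((\<lambda>(s, U). germ \<kappa> s ` U) ` (?S \<times> \<B>))"
      proof (cases "U = {}")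
        case False
        then have "(s, U) \<in> ?S \<times> \<B>" using sU by auto
        then show ?thesis using sU(1) by (intro insertI2) (rule image_eqI, auto)
      qed (use sU in simp)
    qed
    moreover have "countable (?S \<times> \<B>)" using ctb B(1) by (rule countable_SIGMA)
    ultimately show "countable \<T>" by (meson countable_subset countable_insert countable_image)
    show "\<T> \<subseteq> {germ \<kappa> s ` U | s U. openin Z U \<and> U \<subseteq> fixdom \<kappa> (s\<^sup>\<star> * s)}"
      unfolding \<T>_def using B(2) by blast
    fix S g assume "S \<in> {germ \<kappa> s ` U | s U. openin Z U \<and> U \<subseteq> fixdom \<kappa> (s\<^sup>\<star> * s)}" "g \<in> S"
    then obtain s U z where s: "S = germ \<kappa> s ` U" "openin Z U" "U \<subseteq> fixdom \<kappa> (s\<^sup>\<star> * s)"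
      "z \<in> U" "g = germ \<kappa> s z" by blast
    then obtain V where V: "V \<in> \<B>" "z \<in> V" "V \<subseteq> U" using B(3) by blast
    have "germ \<kappa> s ` V \<in> \<T>" unfolding \<T>_def using V s by blast
    then show "\<exists>T\<in>\<T>. g \<in> T \<and> T \<subseteq> S" using V s by blast
  qed
qed

text \<open>The point of \<open>X\<^sup>K\<^sup>S\<close> that records \<open>x\<close> on the filter of idempotents above \<open>e\<close>.  These points
  distinguish elements of the semigroup whose germs at \<open>x\<close> itself coincide.\<close>

definition principal_point :: "'s::inverse_semigroup \<Rightarrow> 'x \<Rightarrow> 's \<Rightarrow> 'x option"
  where "principal_point e x = (\<lambda>f\<in>idems. if nat_le e f then Some x else None)"

lemma principal_point_eq_Some_iff [simp]:
  "f \<in> idems \<Longrightarrow> principal_point e x f = Some y \<longleftrightarrow> nat_le e f \<and> y = x"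
  "f \<in> idems \<Longrightarrow> principal_point e x f = None \<longleftrightarrow> \<not> nat_le e f"
  by (auto simp: principal_point_def)

context
  fixes \<theta> :: "'s::inverse_semigroup \<Rightarrow> 'x \<Rightarrow> 'x option" and X :: "'x topology"
  assumes act: "sg_action \<theta> X"
begin

lemma topspace_fixdom [simp]:
  "e \<in> idems \<Longrightarrow> topspace (subtopology X (fixdom \<theta> e)) = fixdom \<theta> e"
  using action_fixdom_subset[OF act, of e] by auto

lemma KS_space_iff:
  "\<tau> \<in> topspace (KS_space \<theta> X) \<longleftrightarrow>
    \<tau> \<in> extensional idems \<and> (\<forall>e\<in>idems. \<tau> e \<in> insert None (Some ` fixdom \<theta> e)) \<and>
    (\<forall>e1\<in>idems. \<forall>e2\<in>idems. nat_le e1 e2 \<and> \<tau> e1 \<noteq> None \<longrightarrow> \<tau> e2 = \<tau> e1) \<and>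
    (\<forall>e1\<in>idems. \<forall>e2\<in>idems. \<tau> e1 \<noteq> None \<and> \<tau> e2 \<noteq> None \<longrightarrow> \<tau> (e1 * e2) \<noteq> None) \<and>
    \<tau> \<noteq> (\<lambda>e\<in>idems. None)"
proof -
  have "topspace (Alexandroff_compactification (subtopology X (fixdom \<theta> e))) = insert None (Some ` fixdom \<theta> e)"
    if "e \<in> idems" for e
    using that by (simp only: topspace_Alexandroff_compactification topspace_fixdom)
  then have "\<tau> \<in> (\<Pi>\<^sub>E e\<in>idems. topspace (Alexandroff_compactification (subtopology X (fixdom \<theta> e)))) \<longleftrightarrow>
      \<tau> \<in> extensional idems \<and> (\<forall>e\<in>idems. \<tau> e \<in> insert None (Some ` fixdom \<theta> e))"
    unfolding PiE_iff by (metis (no_types, lifting))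
  then show ?thesis
    unfolding KS_space_def KS_tilde_def topspace_subtopology topspace_product_topology
    by (simp only: Int_iff mem_Collect_eq Compl_iff singleton_iff) blast
qed

lemma KS_spaceD:
  assumes "\<tau> \<in> topspace (KS_space \<theta> X)"
  shows "\<tau> \<in> extensional idems" "e \<in> idems \<Longrightarrow> \<tau> e = Some x \<Longrightarrow> x \<in> fixdom \<theta> e"
    "e \<in> idems \<Longrightarrow> f \<in> idems \<Longrightarrow> nat_le e f \<Longrightarrow> \<tau> e = Some x \<Longrightarrow> \<tau> f = Some x"
    "e \<in> idems \<Longrightarrow> f \<in> idems \<Longrightarrow> \<tau> e \<noteq> None \<Longrightarrow> \<tau> f \<noteq> None \<Longrightarrow> \<tau> (e * f) \<noteq> None"
proof -
  note K = assms[unfolded KS_space_iff]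
  show "\<tau> \<in> extensional idems" using K by (elim conjE)
  show "x \<in> fixdom \<theta> e" if "e \<in> idems" "\<tau> e = Some x"
  proof -
    have "\<tau> e \<in> insert None (Some ` fixdom \<theta> e)" using K that(1) by (elim conjE) (rule bspec)
    then show ?thesis using that(2) by auto
  qed
  show "\<tau> f = Some x" if "e \<in> idems" "f \<in> idems" "nat_le e f" "\<tau> e = Some x"
    using K that by (metis option.distinct(1))
  show "\<tau> (e * f) \<noteq> None" if "e \<in> idems" "f \<in> idems" "\<tau> e \<noteq> None" "\<tau> f \<noteq> None"
    using K that by metis
qed

lemma continuous_map_KS_coordinate:
  assumes "e \<in> idems"
  shows "continuous_map (KS_space \<theta> X)
    (Alexandroff_compactification (subtopology X (fixdom \<theta> e))) (\<lambda>\<tau>. \<tau> e)"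
  unfolding KS_space_def KS_tilde_def
  by (intro continuous_map_from_subtopology continuous_map_product_projection assms)

lemma openin_KS_coordinate:
  assumes "e \<in> idems" and "openin (subtopology X (fixdom \<theta> e)) U"
  shows "openin (KS_space \<theta> X) {\<tau> \<in> topspace (KS_space \<theta> X). \<tau> e \<in> Some ` U}"
  by (rule openin_continuous_map_preimage[OF continuous_map_KS_coordinate[OF assms(1)]])
    (use assms(2) in simp)

lemma KS_action_defined:
  "fixdom (KS_action \<theta> X) (s\<^sup>\<star> * s) \<subseteq> {\<tau> \<in> topspace (KS_space \<theta> X). \<tau> (s\<^sup>\<star> * s) \<noteq> None}"
proof -
  have "(s\<^sup>\<star> * s)\<^sup>\<star> * (s\<^sup>\<star> * s) = s\<^sup>\<star> * s"
    by (simp add: idem_inv[OF idem_inv_mult] idemD[OF idem_inv_mult])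
  then show ?thesis by (auto simp: fixdom_def KS_action_def split: if_splits)
qed

lemma fixdom_KS_action:
  assumes e: "e \<in> idems"
  shows "fixdom (KS_action \<theta> X) e = {\<tau> \<in> topspace (KS_space \<theta> X). \<tau> e \<noteq> None}"
proof
  show "fixdom (KS_action \<theta> X) e \<subseteq> {\<tau> \<in> topspace (KS_space \<theta> X). \<tau> e \<noteq> None}"
    using KS_action_defined[of e] e by (simp add: idem_inv idemD)
  show "{\<tau> \<in> topspace (KS_space \<theta> X). \<tau> e \<noteq> None} \<subseteq> fixdom (KS_action \<theta> X) e"
  proof
    fix \<tau> assume "\<tau> \<in> {\<tau> \<in> topspace (KS_space \<theta> X). \<tau> e \<noteq> None}"
    then have \<tau>: "\<tau> \<in> topspace (KS_space \<theta> X)" "\<tau> e \<noteq> None" by auto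
    note K = KS_spaceD[OF \<tau>(1)]
    have "(case \<tau> (e\<^sup>\<star> * f * e) of None \<Rightarrow> None | Some x \<Rightarrow> \<theta> (f * e) x) = \<tau> f" if f: "f \<in> idems" for f
    proof -
      have ef: "e * f = f * e" by (rule idem_commute[OF e f])
      have efe: "e\<^sup>\<star> * f * e = e * f"
        by (simp add: idem_inv[OF e] mult.assoc ef[symmetric]) (simp add: mult.assoc[symmetric] idemD[OF e])
      have le: "nat_le (e * f) f"
        using idem_mult_closed[OF e f] f by (simp add: idem_nat_le_iff ef mult.assoc[symmetric] idemD)
      show ?thesis
      proof (cases "\<tau> (e * f)")
        case None
        then have "\<tau> f = None" using K(4)[OF e f \<tau>(2)] by metis
        then show ?thesis using None by (simp add: efe)
      next
        case (Some x)
        then have "\<tau> f = Some x" using K(3)[OF idem_mult_closed[OF e f] f le] by simp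
        moreover have "x \<in> fixdom \<theta> (e * f)" using K(2)[OF idem_mult_closed[OF e f] Some] .
        then have "\<theta> (f * e) x = Some x" by (simp add: fixdom_def ef)
        ultimately show ?thesis using Some by (simp add: efe)
      qed
    qed
    then have "(\<lambda>f\<in>idems. case \<tau> (e\<^sup>\<star> * f * e) of None \<Rightarrow> None | Some x \<Rightarrow> \<theta> (f * e) x) = \<tau>"
      by (intro extensionalityI[of _ idems]) (simp_all add: K(1))
    then show "\<tau> \<in> fixdom (KS_action \<theta> X) e"
      using \<tau> e by (simp add: fixdom_def KS_action_def idem_inv idemD)
  qed
qed

lemma openin_fixdom_KS_action:
  assumes e: "e \<in> idems"
  shows "openin (KS_space \<theta> X) (fixdom (KS_action \<theta> X) e)"
proof -
  have "fixdom (KS_action \<theta> X) e = {\<tau> \<in> topspace (KS_space \<theta> X). \<tau> e \<in> Some ` fixdom \<theta> e}"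
    using KS_spaceD(2)[OF _ e] by (auto simp: fixdom_KS_action[OF e])
  moreover have "openin (subtopology X (fixdom \<theta> e)) (fixdom \<theta> e)"
    using openin_topspace[of "subtopology X (fixdom \<theta> e)"] e by (simp del: topspace_subtopology)
  ultimately show ?thesis using openin_KS_coordinate[OF e] by simp
qed

lemma fixdom_KS_action_Int:
  assumes "e \<in> idems" "f \<in> idems"
  shows "fixdom (KS_action \<theta> X) e \<inter> fixdom (KS_action \<theta> X) f \<subseteq> fixdom (KS_action \<theta> X) (e * f)"
  using KS_spaceD(4)[OF _ assms] by (auto simp: fixdom_KS_action assms idem_mult_closed)

lemmas germ_KS_eq_iff = germ_eq_iff[of "KS_action \<theta> X", OF fixdom_KS_action_Int]

lemma principal_point_in_KS_space:
  assumes e: "e \<in> idems" and x: "x \<in> fixdom \<theta> e"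
  shows "principal_point e x \<in> topspace (KS_space \<theta> X)"
proof -
  have trans: "nat_le e f2" if "nat_le e f1" "nat_le f1 f2" "f1 \<in> idems" for f1 f2 :: 's
    using that e by (simp add: idem_nat_le_iff) (metis mult.assoc)
  have mult: "nat_le e (f1 * f2)" if "nat_le e f1" "nat_le e f2" for f1 f2 :: 's
    using that e by (simp add: idem_nat_le_iff mult.assoc)
  have "principal_point e x e \<noteq> None" using e by simp
  then have "principal_point e x \<noteq> (\<lambda>e\<in>idems. None)" using e by force
  moreover have "x \<in> fixdom \<theta> f" if "f \<in> idems" "nat_le e f" for f
    using action_fixdom_mono[OF act e that] x by blast
  ultimately show ?thesis
    unfolding KS_space_iff
    using trans mult by (auto simp: principal_point_def idem_mult_closed)
qed

lemma principal_point_in_fixdom_iff: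
  assumes e: "e \<in> idems" and x: "x \<in> fixdom \<theta> e" and f: "f \<in> idems"
  shows "principal_point e x \<in> fixdom (KS_action \<theta> X) f \<longleftrightarrow> nat_le e f"
  using principal_point_in_KS_space[OF e x] f by (auto simp: fixdom_KS_action)

lemma continuous_map_principal_point:
  assumes e: "e \<in> idems"
  shows "continuous_map (subtopology X (fixdom \<theta> e)) (KS_space \<theta> X) (principal_point e)"
proof -
  have "continuous_map (subtopology X (fixdom \<theta> e))
     (Alexandroff_compactification (subtopology X (fixdom \<theta> f))) (\<lambda>x. principal_point e x f)"
    if f: "f \<in> idems" for f
  proof (cases "nat_le e f")
    case True
    have "continuous_map (subtopology X (fixdom \<theta> e))
        (Alexandroff_compactification (subtopology X (fixdom \<theta> f))) Some"
    proof -
      have "continuous_map (subtopology X (fixdom \<theta> e)) (subtopology X (fixdom \<theta> f)) id"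
        using action_fixdom_mono[OF act e f True]
        by (auto simp: continuous_map_in_subtopology intro: continuous_map_from_subtopology)
      from continuous_map_compose[OF this continuous_map_Some] show ?thesis by simp
    qed
    then show ?thesis by (rule continuous_map_eq) (use f True in \<open>simp add: principal_point_def\<close>)
  next
    case False
    have "continuous_map (subtopology X (fixdom \<theta> e))
        (Alexandroff_compactification (subtopology X (fixdom \<theta> f))) (\<lambda>x. None)"
      by simp
    then show ?thesis by (rule continuous_map_eq) (use f False in \<open>simp add: principal_point_def\<close>)
  qed
  then have cont: "continuous_map (subtopology X (fixdom \<theta> e))
     (product_topology (\<lambda>f. Alexandroff_compactification (subtopology X (fixdom \<theta> f))) idems) (principal_point e)"
    unfolding continuous_map_componentwise by (auto simp: principal_point_def)
  have sub: "principal_point e ` topspace (subtopology X (fixdom \<theta> e)) \<subseteq> topspace (KS_space \<theta> X)"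
    unfolding topspace_fixdom[OF e] using principal_point_in_KS_space[OF e] by (rule image_subsetI)
  have eq: "KS_space \<theta> X =
      subtopology (product_topology (\<lambda>f. Alexandroff_compactification (subtopology X (fixdom \<theta> f))) idems)
        (topspace (KS_space \<theta> X))"
    unfolding KS_space_def KS_tilde_def subtopology_subtopology topspace_subtopology subtopology_restrict
    by (rule refl)
  show ?thesis
    by (subst eq) (rule continuous_map_into_subtopology[OF cont], use sub in \<open>simp only: image_subset_iff_funcset\<close>)
qed

lemma second_countable_KS_space:
  assumes lc: "locally_compact_space X" and H: "Hausdorff_space X"
    and sc: "second_countable X" and ctb: "countable {s. fixdom \<theta> (s\<^sup>\<star> * s) \<noteq> {}}"
  shows "second_countable (KS_space \<theta> X)"
proof -
  let ?J = "{e \<in> idems. fixdom \<theta> e \<noteq> {}}"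
  have "second_countable
    (product_topology (\<lambda>e. Alexandroff_compactification (subtopology X (fixdom \<theta> e))) idems)"
  proof (rule second_countable_product_topology)
    show "second_countable (Alexandroff_compactification (subtopology X (fixdom \<theta> e)))" if "e \<in> ?J" for e
      using that
      by (intro second_countable_Alexandroff_compactification second_countable_subtopology sc
          Hausdorff_space_subtopology H locally_compact_space_open_subset lc action_openin_fixdom[OF act])
        (auto simp: H)
    have "?J \<subseteq> {s. fixdom \<theta> (s\<^sup>\<star> * s) \<noteq> {}}" by (auto simp: idem_inv idemD)
    then show "countable ?J" using ctb countable_subset by blast
    show "?J \<subseteq> idems" by blast
    show "\<exists>a. topspace (Alexandroff_compactification (subtopology X (fixdom \<theta> e))) \<subseteq> {a}"
      if "e \<in> idems - ?J" for e
      using that by (intro exI[of _ None]) auto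
  qed
  then show ?thesis
    unfolding KS_space_def KS_tilde_def by (intro second_countable_subtopology)
qed

text \<open>Let \<open>\<tau>\<^sub>s\<close> be a principal point over \<open>s\<^sup>\<star>s\<close>.  The germ \<open>[s, \<tau>\<^sub>s]\<close> lies in the open set of
  germs of \<open>t\<close> only if \<open>s \<le> t\<close>.  So basic sets between \<open>[s, \<tau>\<^sub>s]\<close> and the set of germs of \<open>s\<close> are
  different for different \<open>s\<close>.\<close>

lemma countable_support_if_second_countable_groupoid:
  assumes "second_countable (arrows (transformation_groupoid (KS_action \<theta> X) (KS_space \<theta> X)))"
  shows "countable {s. fixdom \<theta> (s\<^sup>\<star> * s) \<noteq> {}}" (is "countable ?S")
proof -
  let ?K = "KS_action \<theta> X"
  obtain \<G> where "countable_base (arrows (transformation_groupoid ?K (KS_space \<theta> X))) \<G>"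
    using assms by (auto simp: second_countable_iff_countable_base)
  note G = countable_baseD[OF this]
  have "\<forall>s\<in>?S. \<exists>x. x \<in> fixdom \<theta> (s\<^sup>\<star> * s)" by blast
  then obtain x where x: "\<And>s. s \<in> ?S \<Longrightarrow> x s \<in> fixdom \<theta> (s\<^sup>\<star> * s)" by metis
  define p where "p s = principal_point (s\<^sup>\<star> * s) (x s)" for s
  define W where "W s = germ ?K s ` fixdom ?K (s\<^sup>\<star> * s)" for s
  have p: "p s \<in> fixdom ?K (s\<^sup>\<star> * s)" if "s \<in> ?S" for s
    using principal_point_in_fixdom_iff[OF idem_inv_mult x[OF that] idem_inv_mult] by (simp add: p_def)
  have "\<forall>s\<in>?S. \<exists>V. V \<in> \<G> \<and> germ ?K s (p s) \<in> V \<and> V \<subseteq> W s"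
  proof
    fix s assume s: "s \<in> ?S"
    have "openin (arrows (transformation_groupoid ?K (KS_space \<theta> X))) (W s)"
      unfolding W_def by (intro openin_arrows_germs openin_fixdom_KS_action idem_inv_mult order_refl)
    moreover have "germ ?K s (p s) \<in> W s" using p[OF s] by (auto simp: W_def)
    ultimately show "\<exists>V. V \<in> \<G> \<and> germ ?K s (p s) \<in> V \<and> V \<subseteq> W s"
      using G(3) by (metis (no_types))
  qed
  from bchoice[OF this] obtain V
    where "\<forall>s\<in>?S. V s \<in> \<G> \<and> germ ?K s (p s) \<in> V s \<and> V s \<subseteq> W s" by (rule exE)
  then have V: "V s \<in> \<G>" "germ ?K s (p s) \<in> V s" "V s \<subseteq> W s" if "s \<in> ?S" for s
    using that by simp_all
  have le: "nat_le s t" if s: "s \<in> ?S" and sW: "germ ?K s (p s) \<in> W t" for s t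
  proof -
    obtain z where z: "z \<in> fixdom ?K (t\<^sup>\<star> * t)" "germ ?K s (p s) = germ ?K t z"
      using sW by (auto simp: W_def)
    then obtain e where e: "e \<in> idems" "p s \<in> fixdom ?K e" "s * e = t * e"
      using germ_KS_eq_iff[OF _ _ p[OF s] z(1)] by auto
    have "nat_le (s\<^sup>\<star> * s) e"
      using principal_point_in_fixdom_iff[OF idem_inv_mult x[OF s] e(1)] e(2) by (simp add: p_def)
    then have "e * (s\<^sup>\<star> * s) = s\<^sup>\<star> * s" by (simp add: idem_nat_le_iff[OF idem_inv_mult])
    then have "t * (s\<^sup>\<star> * s) = s * (s\<^sup>\<star> * s)" using e(3) by (metis mult.assoc)
    then show ?thesis by (simp add: nat_le_def mult.assoc[symmetric] sg_inv)
  qed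
  have "inj_on V ?S"
  proof (rule inj_onI)
    fix s t assume st: "s \<in> ?S" "t \<in> ?S" "V s = V t"
    have "germ ?K s (p s) \<in> W t" using V[OF st(1)] V[OF st(2)] st(3) by auto
    moreover have "germ ?K t (p t) \<in> W s" using V[OF st(1)] V[OF st(2)] st(3) by auto
    ultimately show "s = t" using le[OF st(1)] le[OF st(2)] nat_le_antisym by metis
  qed
  moreover have "countable (V ` ?S)"
    using V(1) by (intro countable_subset[OF _ G(1)]) auto
  ultimately show ?thesis using countable_image_inj_on by blast
qed

text \<open>\<open>X\<^sub>e\<close> embeds into the groupoid by \<open>x \<mapsto> [e, \<tau>]\<close> with \<open>\<tau>\<close> the principal point of \<open>x\<close> over
  \<open>e\<close>: whether \<open>[e, \<tau>] = [s, \<tau>]\<close> does not depend on \<open>x\<close>, which makes the map continuous.\<close>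

lemma second_countable_fixdom_if_second_countable_groupoid:
  assumes "second_countable (arrows (transformation_groupoid (KS_action \<theta> X) (KS_space \<theta> X)))"
    and e: "e \<in> idems"
  shows "second_countable (subtopology X (fixdom \<theta> e))"
proof -
  let ?K = "KS_action \<theta> X" and ?Z = "KS_space \<theta> X" and ?Y = "subtopology X (fixdom \<theta> e)"
  let ?A = "arrows (transformation_groupoid ?K ?Z)"
  obtain \<G> where "countable_base ?A \<G>"
    using assms by (auto simp: second_countable_iff_countable_base)
  note G = countable_baseD[OF this]
  define j where "j x = germ ?K e (principal_point e x)" for x
  have ee: "e\<^sup>\<star> * e = e" using e by (simp add: idem_inv idemD)
  have pe: "principal_point e x \<in> fixdom ?K (e\<^sup>\<star> * e)" if "x \<in> fixdom \<theta> e" for x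
    using principal_point_in_fixdom_iff[OF e that e] by (simp add: ee)
  have mem: "j x \<in> germ ?K s ` U \<longleftrightarrow> principal_point e x \<in> U \<and> (\<exists>f\<in>idems. nat_le e f \<and> e * f = s * f)"
    if x: "x \<in> fixdom \<theta> e" and U: "U \<subseteq> fixdom ?K (s\<^sup>\<star> * s)" for x s U
  proof -
    have eq: "j x = germ ?K s z \<longleftrightarrow> principal_point e x = z \<and> (\<exists>f\<in>idems. nat_le e f \<and> e * f = s * f)"
      if "z \<in> U" for z
    proof -
      have "z \<in> fixdom ?K (s\<^sup>\<star> * s)" using that U by blast
      then show ?thesis
        unfolding j_def using germ_KS_eq_iff[OF _ _ pe[OF x], of z s] principal_point_in_fixdom_iff[OF e x]
        by auto
    qed
    show ?thesis
    proof
      assume "j x \<in> germ ?K s ` U"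
      then obtain z where "z \<in> U" "j x = germ ?K s z" by blast
      then show "principal_point e x \<in> U \<and> (\<exists>f\<in>idems. nat_le e f \<and> e * f = s * f)"
        using eq by metis
    next
      assume *: "principal_point e x \<in> U \<and> (\<exists>f\<in>idems. nat_le e f \<and> e * f = s * f)"
      then have "j x = germ ?K s (principal_point e x)" using eq by metis
      then show "j x \<in> germ ?K s ` U" using * by (metis imageI)
    qed
  qed
  have "continuous_map ?Y ?A j"
    unfolding arrows_transformation_groupoid continuous_on_generated_topo_iff
  proof (intro conjI allI impI)
    fix T assume "T \<in> {germ ?K s ` U | s U. openin ?Z U \<and> U \<subseteq> fixdom ?K (s\<^sup>\<star> * s)}"
    then obtain s U where s: "T = germ ?K s ` U" "openin ?Z U" "U \<subseteq> fixdom ?K (s\<^sup>\<star> * s)" by blast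
    have "j -` T \<inter> topspace ?Y = (if \<exists>f\<in>idems. nat_le e f \<and> e * f = s * f
        then {x \<in> topspace ?Y. principal_point e x \<in> U} else {})"
      unfolding s(1) using mem[OF _ s(3)] e by auto
    then show "openin ?Y (j -` T \<inter> topspace ?Y)"
      using openin_continuous_map_preimage[OF continuous_map_principal_point[OF e] s(2)] by auto
  next
    have "j x \<in> germ ?K e ` fixdom ?K (e\<^sup>\<star> * e)" if "x \<in> fixdom \<theta> e" for x
      unfolding j_def using pe[OF that] by (rule imageI)
    moreover have "germ ?K e ` fixdom ?K (e\<^sup>\<star> * e) \<in>
        {germ ?K s ` U | s U. openin ?Z U \<and> U \<subseteq> fixdom ?K (s\<^sup>\<star> * s)}"
      using openin_fixdom_KS_action[OF idem_inv_mult] by blast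
    ultimately show "j ` topspace ?Y \<subseteq> \<Union> {germ ?K s ` U | s U. openin ?Z U \<and> U \<subseteq> fixdom ?K (s\<^sup>\<star> * s)}"
      using e by (auto simp del: topspace_subtopology) (metis (mono_tags, lifting) UnionI)
  qed
  note pre = openin_continuous_map_preimage[OF this]
  have "countable_base ?Y ((\<lambda>B. {x \<in> topspace ?Y. j x \<in> B}) ` \<G>)"
    unfolding countable_base_def
  proof (intro conjI ballI allI impI)
    show "countable ((\<lambda>B. {x \<in> topspace ?Y. j x \<in> B}) ` \<G>)" using G(1) by simp
    show "openin ?Y V" if "V \<in> (\<lambda>B. {x \<in> topspace ?Y. j x \<in> B}) ` \<G>" for V
      using that G(2) pre by blast
    fix U x assume "openin ?Y U \<and> x \<in> U"
    then have U: "openin ?Y U" "x \<in> U" by auto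
    have xe: "x \<in> fixdom \<theta> e" using openin_subset[OF U(1)] U(2) e by auto
    define C where "C = {\<tau> \<in> topspace ?Z. \<tau> e \<in> Some ` U}"
    have C: "openin ?Z C" "C \<subseteq> fixdom ?K (e\<^sup>\<star> * e)"
      unfolding C_def using openin_KS_coordinate[OF e U(1)] by (auto simp: ee fixdom_KS_action[OF e])
    have memC: "j y \<in> germ ?K e ` C \<longleftrightarrow> y \<in> U" if "y \<in> fixdom \<theta> e" for y
    proof -
      have "\<exists>f\<in>idems. nat_le e f \<and> e * f = e * f" using e nat_le_refl by blast
      moreover have "principal_point e y \<in> C \<longleftrightarrow> y \<in> U"
        using e principal_point_in_KS_space[OF e that] by (auto simp: C_def image_iff)
      ultimately show ?thesis using mem[OF that C(2)] by (simp only: simp_thms)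
    qed
    have "j x \<in> germ ?K e ` C" using memC[OF xe] U(2) by (rule iffD2)
    from G(3)[OF openin_arrows_germs[OF C] this]
    obtain B where B: "B \<in> \<G>" "j x \<in> B" "B \<subseteq> germ ?K e ` C" by (elim bexE conjE)
    show "\<exists>V\<in>(\<lambda>B. {x \<in> topspace ?Y. j x \<in> B}) ` \<G>. x \<in> V \<and> V \<subseteq> U"
    proof (intro bexI[of _ "{x \<in> topspace ?Y. j x \<in> B}"] conjI)
      show "x \<in> {x \<in> topspace ?Y. j x \<in> B}"
        using xe B(2) e by (simp del: topspace_subtopology)
      show "{y \<in> topspace ?Y. j y \<in> B} \<subseteq> U"
      proof clarify
        fix y assume y: "y \<in> topspace ?Y" "j y \<in> B"
        then show "y \<in> U" using memC[of y] B(3) e by (metis subsetD topspace_fixdom)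
      qed
    qed (use B(1) in \<open>rule imageI\<close>)
  qed
  then show ?thesis by (auto simp: second_countable_iff_countable_base)
qed

lemma second_countable_if_fixdoms:
  assumes "countable {s. fixdom \<theta> (s\<^sup>\<star> * s) \<noteq> {}}"
    and "\<And>e. e \<in> idems \<Longrightarrow> second_countable (subtopology X (fixdom \<theta> e))"
  shows "second_countable X"
proof (rule second_countable_open_cover)
  let ?J = "{e \<in> idems. fixdom \<theta> e \<noteq> {}}"
  have "?J \<subseteq> {s. fixdom \<theta> (s\<^sup>\<star> * s) \<noteq> {}}" by (auto simp: idem_inv idemD)
  then show "countable (fixdom \<theta> ` ?J)" using assms(1) countable_subset by blast
  show "openin X U" if "U \<in> fixdom \<theta> ` ?J" for U using that action_openin_fixdom[OF act] by auto
  show "topspace X \<subseteq> \<Union> (fixdom \<theta> ` ?J)"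
    unfolding action_Union_fixdom[OF act, symmetric] by auto
  show "second_countable (subtopology X U)" if "U \<in> fixdom \<theta> ` ?J" for U using that assms(2) by auto
qed

theorem second_countable_KS_groupoid_iff:
  assumes lc: "locally_compact_space X" and H: "Hausdorff_space X"
  shows "second_countable (arrows (transformation_groupoid (KS_action \<theta> X) (KS_space \<theta> X))) \<longleftrightarrow>
    second_countable X \<and> countable {s. fixdom \<theta> (s\<^sup>\<star> * s) \<noteq> {}}"
proof
  assume "second_countable (arrows (transformation_groupoid (KS_action \<theta> X) (KS_space \<theta> X)))"
  then show "second_countable X \<and> countable {s. fixdom \<theta> (s\<^sup>\<star> * s) \<noteq> {}}"
    using countable_support_if_second_countable_groupoid second_countable_if_fixdoms
      second_countable_fixdom_if_second_countable_groupoid by metis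
next
  assume A: "second_countable X \<and> countable {s. fixdom \<theta> (s\<^sup>\<star> * s) \<noteq> {}}"
  have "{s. fixdom (KS_action \<theta> X) (s\<^sup>\<star> * s) \<noteq> {}} \<subseteq> {s. fixdom \<theta> (s\<^sup>\<star> * s) \<noteq> {}}"
  proof clarsimp
    fix s assume "fixdom (KS_action \<theta> X) (s\<^sup>\<star> * s) \<noteq> {}" "fixdom \<theta> (s\<^sup>\<star> * s) = {}"
    then obtain \<tau> where "\<tau> \<in> topspace (KS_space \<theta> X)" "\<tau> (s\<^sup>\<star> * s) \<noteq> None"
      using fixdom_KS_action[OF idem_inv_mult] by blast
    then show False using \<open>fixdom \<theta> (s\<^sup>\<star> * s) = {}\<close> KS_spaceD(2)[OF _ idem_inv_mult] by fastforce
  qed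
  then have "countable {s. fixdom (KS_action \<theta> X) (s\<^sup>\<star> * s) \<noteq> {}}"
    using A countable_subset by blast
  then show "second_countable (arrows (transformation_groupoid (KS_action \<theta> X) (KS_space \<theta> X)))"
    using second_countable_transformation_groupoid second_countable_KS_space[OF lc H] A by blast
qed

end


section \<open>Continuous functions vanishing at infinity\<close>

lemma C0_I:
  assumes cont: "continuous_map Z euclidean f"
    and cpt: "\<And>\<epsilon>. \<epsilon> > 0 \<Longrightarrow> \<exists>K. compactin Z K \<and> {x \<in> topspace Z. \<epsilon> \<le> cmod (f x)} \<subseteq> K"
    and out: "\<And>x. x \<notin> topspace Z \<Longrightarrow> f x = 0"
  shows "f \<in> C0 Z"
proof -
  have "compactin Z {x \<in> topspace Z. \<epsilon> \<le> cmod (f x)}" if \<epsilon>: "\<epsilon> > 0" for \<epsilon>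
  proof -
    have "closed {z::complex. \<epsilon> \<le> cmod z}"
      by (intro closed_Collect_le continuous_intros)
    then have "closedin Z {x \<in> topspace Z. f x \<in> {z. \<epsilon> \<le> cmod z}}"
      by (intro closedin_continuous_map_preimage[OF cont]) simp
    then show ?thesis using cpt[OF \<epsilon>] closed_compactin by fastforce
  qed
  then show ?thesis using cont out by (simp add: C0_def)
qed

lemma C0_D:
  assumes "f \<in> C0 Z"
  shows "continuous_map Z euclidean f" "\<epsilon> > 0 \<Longrightarrow> compactin Z {x \<in> topspace Z. \<epsilon> \<le> cmod (f x)}"
    "x \<notin> topspace Z \<Longrightarrow> f x = 0"
  using assms by (auto simp: C0_def)

lemma C0_bounded:
  assumes "f \<in> C0 Z"
  shows "\<exists>M>0. \<forall>x. cmod (f x) \<le> M"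
proof -
  let ?K = "{x \<in> topspace Z. 1 \<le> cmod (f x)}"
  have "compactin euclidean (f ` ?K)"
    using image_compactin[OF C0_D(2)[OF assms, of 1] C0_D(1)[OF assms]] by simp
  then have "bounded (f ` ?K)" by (simp add: compact_imp_bounded)
  then obtain b where b: "\<And>z. z \<in> f ` ?K \<Longrightarrow> cmod z \<le> b" unfolding bounded_iff by metis
  have "cmod (f x) \<le> max 1 b" for x
  proof (cases "x \<in> ?K")
    case True
    then show ?thesis using b[of "f x"] by (simp add: le_max_iff_disj)
  next
    case False
    then have "x \<in> topspace Z \<Longrightarrow> cmod (f x) \<le> 1" by auto
    moreover have "x \<notin> topspace Z \<Longrightarrow> f x = 0" by (rule C0_D(3)[OF assms])
    ultimately show ?thesis by (cases "x \<in> topspace Z") (auto simp: le_max_iff_disj)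
  qed
  then show ?thesis by (intro exI[of _ "max 1 b"]) auto
qed

lemma C0_zero: "(\<lambda>_. 0) \<in> C0 Z"
  by (auto simp: C0_def)

lemma C0_add:
  assumes f: "f \<in> C0 Z" and g: "g \<in> C0 Z"
  shows "(\<lambda>x. f x + g x) \<in> C0 Z"
proof (rule C0_I)
  show "continuous_map Z euclidean (\<lambda>x. f x + g x)"
    by (intro continuous_map_add C0_D(1) f g)
  show "f x + g x = 0" if "x \<notin> topspace Z" for x
    using C0_D(3)[OF f that] C0_D(3)[OF g that] by simp
  show "\<exists>K. compactin Z K \<and> {x \<in> topspace Z. \<epsilon> \<le> cmod (f x + g x)} \<subseteq> K" if "\<epsilon> > 0" for \<epsilon>
  proof (intro exI conjI)
    show "compactin Z ({x \<in> topspace Z. \<epsilon> / 2 \<le> cmod (f x)} \<union> {x \<in> topspace Z. \<epsilon> / 2 \<le> cmod (g x)})"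
      using that by (intro compactin_Un C0_D(2) f g) auto
    show "{x \<in> topspace Z. \<epsilon> \<le> cmod (f x + g x)} \<subseteq>
      {x \<in> topspace Z. \<epsilon> / 2 \<le> cmod (f x)} \<union> {x \<in> topspace Z. \<epsilon> / 2 \<le> cmod (g x)}"
    proof clarsimp
      fix x assume "\<epsilon> \<le> cmod (f x + g x)" "\<not> \<epsilon> \<le> cmod (g x) * 2"
      then show "\<epsilon> \<le> cmod (f x) * 2" using norm_triangle_ineq[of "f x" "g x"] by linarith
    qed
  qed
qed

lemma continuous_map_complex_mult:
  fixes f g :: "'z \<Rightarrow> complex"
  assumes "continuous_map Z euclidean f" "continuous_map Z euclidean g"
  shows "continuous_map Z euclidean (\<lambda>x. f x * g x)"
  using assms by (simp add: continuous_map_atin limitin_canonical_iff tendsto_mult)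

lemma C0_mult_bounded:
  assumes f: "f \<in> C0 Z" and h: "continuous_map Z euclidean h" and M: "\<And>x. x \<in> topspace Z \<Longrightarrow> cmod (h x) \<le> M"
  shows "(\<lambda>x. h x * f x) \<in> C0 Z"
proof (rule C0_I)
  show "continuous_map Z euclidean (\<lambda>x. h x * f x)"
    by (intro continuous_map_complex_mult C0_D(1) f h)
  show "h x * f x = 0" if "x \<notin> topspace Z" for x
    using C0_D(3)[OF f that] by simp
  show "\<exists>K. compactin Z K \<and> {x \<in> topspace Z. \<epsilon> \<le> cmod (h x * f x)} \<subseteq> K" if "\<epsilon> > 0" for \<epsilon>
  proof (intro exI conjI)
    \<comment> \<open>\<open>M\<close> itself may vanish.\<close>
    define N where "N = max 1 M"
    have N: "N > 0" "M \<le> N" by (auto simp: N_def)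
    show "compactin Z {x \<in> topspace Z. \<epsilon> / N \<le> cmod (f x)}"
      using that N by (intro C0_D(2) f) auto
    show "{x \<in> topspace Z. \<epsilon> \<le> cmod (h x * f x)} \<subseteq> {x \<in> topspace Z. \<epsilon> / N \<le> cmod (f x)}"
    proof clarify
      fix x assume x: "x \<in> topspace Z" "\<epsilon> \<le> cmod (h x * f x)"
      have "\<epsilon> \<le> cmod (h x) * cmod (f x)" using x by (simp add: norm_mult)
      also have "\<dots> \<le> N * cmod (f x)" using M[OF x(1)] N by (intro mult_right_mono) auto
      finally show "\<epsilon> / N \<le> cmod (f x)" using N by (simp add: field_simps)
    qed
  qed
qed

lemma C0_scale: "f \<in> C0 Z \<Longrightarrow> (\<lambda>x. c * f x) \<in> C0 Z"
  by (rule C0_mult_bounded[where M = "cmod c"]) auto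

lemma C0_cnj: "f \<in> C0 Z \<Longrightarrow> (\<lambda>x. cnj (f x)) \<in> C0 Z"
proof (rule C0_I)
  assume f: "f \<in> C0 Z"
  show "continuous_map Z euclidean (\<lambda>x. cnj (f x))"
    using continuous_map_compose[OF C0_D(1)[OF f], of euclidean cnj]
    by (simp add: o_def continuous_on_cnj continuous_on_id)
  show "cnj (f x) = 0" if "x \<notin> topspace Z" for x
    using C0_D(3)[OF f that] by simp
  show "\<exists>K. compactin Z K \<and> {x \<in> topspace Z. \<epsilon> \<le> cmod (cnj (f x))} \<subseteq> K" if "\<epsilon> > 0" for \<epsilon>
    using C0_D(2)[OF f that] by auto
qed

text \<open>For finitely many basic open sets \<open>U\<^sub>i\<close>, values \<open>c\<^sub>i\<close> in a countable dense set and a tolerance,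
  consider the functions close to \<open>c\<^sub>i\<close> on \<open>U\<^sub>i\<close> and small off all \<open>U\<^sub>i\<close>.  There are countably many
  such classes, they cover \<open>C\<^sub>0(Z)\<close>, and two members of the same class are close; so it suffices to
  pick one member of each.\<close>

lemma C0_separable:
  assumes "second_countable Z"
  shows "\<exists>D\<subseteq>C0 Z. countable D \<and> (\<forall>f\<in>C0 Z. \<forall>\<epsilon>>0. \<exists>d\<in>D. \<forall>x. cmod (f x - d x) \<le> \<epsilon>)"
proof -
  obtain \<B> where "countable_base Z \<B>"
    using assms by (auto simp: second_countable_iff_countable_base)
  note B = countable_baseD[OF this]
  obtain Q :: "complex set" where Q: "countable Q" "\<And>X. open X \<Longrightarrow> X \<noteq> {} \<Longrightarrow> \<exists>d\<in>Q. d \<in> X"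
    using countable_dense_exists by blast
  define C where "C l n f \<longleftrightarrow> f \<in> C0 Z \<and>
      (\<forall>(U, c)\<in>set l. \<forall>x\<in>U. cmod (f x - c) < 1 / real (Suc n)) \<and>
      (\<forall>x. (\<forall>(U, c)\<in>set l. x \<notin> U) \<longrightarrow> cmod (f x) < 1 / real (Suc n))" for l :: "('a set \<times> complex) list" and n f
  define I where "I = {(l, n). l \<in> lists (\<B> \<times> Q) \<and> (\<exists>f. C l n f)}"
  define pick where "pick = (\<lambda>(l, n). SOME f. C l n f)"
  have pick: "C l n (pick (l, n))" if "C l n f" for l n f
    unfolding pick_def using someI[of "C l n", OF that] by simp
  have close: "cmod (f x - g x) \<le> 2 / real (Suc n)" if f: "C l n f" and g: "C l n g" for l n f g x
  proof (cases "\<exists>(U, c)\<in>set l. x \<in> U")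
    case True
    then obtain U c where "(U, c) \<in> set l" "x \<in> U" by blast
    then have "cmod (f x - c) < 1 / real (Suc n)" "cmod (g x - c) < 1 / real (Suc n)"
      using f g unfolding C_def by fast+
    then have "cmod (f x - g x) < 1 / real (Suc n) + 1 / real (Suc n)"
      using norm_triangle_ineq4[of "f x - c" "g x - c"] by simp
    then show ?thesis by simp
  next
    case False
    then have "cmod (f x) < 1 / real (Suc n)" "cmod (g x) < 1 / real (Suc n)"
      using f g unfolding C_def by fast+
    then have "cmod (f x - g x) < 1 / real (Suc n) + 1 / real (Suc n)"
      using norm_triangle_ineq4[of "f x" "g x"] by linarith
    then show ?thesis by simp
  qed
  have covers: "\<exists>l. l \<in> lists (\<B> \<times> Q) \<and> C l n f" if f: "f \<in> C0 Z" for f n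
  proof -
    define \<delta> where "\<delta> = 1 / real (Suc n)"
    have \<delta>: "\<delta> > 0" by (simp add: \<delta>_def)
    let ?K = "{x \<in> topspace Z. \<delta> \<le> cmod (f x)}"
    have "\<forall>z\<in>?K. \<exists>p. fst p \<in> \<B> \<and> snd p \<in> Q \<and> z \<in> fst p \<and> (\<forall>x\<in>fst p. cmod (f x - snd p) < \<delta>)"
    proof
      fix z assume z: "z \<in> ?K"
      have "ball (f z) \<delta> \<noteq> {}" using \<delta> by simp
      then obtain c where c: "c \<in> Q" "c \<in> ball (f z) \<delta>" using Q(2)[of "ball (f z) \<delta>"] by auto
      have "openin Z {x \<in> topspace Z. f x \<in> ball c \<delta>}"
        by (rule openin_continuous_map_preimage[OF C0_D(1)[OF f]]) simp
      moreover have "z \<in> {x \<in> topspace Z. f x \<in> ball c \<delta>}" using z c by (simp add: dist_commute)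
      ultimately obtain V where V: "V \<in> \<B>" "z \<in> V" "V \<subseteq> {x \<in> topspace Z. f x \<in> ball c \<delta>}"
        using B(3) by (elim bexE[OF B(3)] conjE)
      have "cmod (f x - c) < \<delta>" if "x \<in> V" for x
      proof -
        have "f x \<in> ball c \<delta>" using V(3) that by auto
        then show ?thesis by (simp add: dist_norm norm_minus_commute)
      qed
      then show "\<exists>p. fst p \<in> \<B> \<and> snd p \<in> Q \<and> z \<in> fst p \<and> (\<forall>x\<in>fst p. cmod (f x - snd p) < \<delta>)"
        using V(1,2) c(1) by (intro exI[of _ "(V, c)"]) simp
    qed
    from bchoice[OF this] obtain p
      where "\<forall>z\<in>?K. fst (p z) \<in> \<B> \<and> snd (p z) \<in> Q \<and> z \<in> fst (p z) \<and>
        (\<forall>x\<in>fst (p z). cmod (f x - snd (p z)) < \<delta>)" by (rule exE)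
    then have p: "fst (p z) \<in> \<B>" "snd (p z) \<in> Q" "z \<in> fst (p z)"
        "\<And>x. x \<in> fst (p z) \<Longrightarrow> cmod (f x - snd (p z)) < \<delta>" if "z \<in> ?K" for z
      using that by simp_all
    have "\<exists>\<F>. finite \<F> \<and> \<F> \<subseteq> (\<lambda>z. fst (p z)) ` ?K \<and> ?K \<subseteq> \<Union>\<F>"
    proof (rule compactinD[OF C0_D(2)[OF f \<delta>]])
      show "openin Z U" if "U \<in> (\<lambda>z. fst (p z)) ` ?K" for U using that p(1) B(2) by auto
      show "?K \<subseteq> \<Union> ((\<lambda>z. fst (p z)) ` ?K)" using p(3) by auto
    qed
    then obtain \<F> where F: "finite \<F>" "\<F> \<subseteq> (\<lambda>z. fst (p z)) ` ?K" "?K \<subseteq> \<Union>\<F>" by (elim exE conjE)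
    obtain K0 where K0: "K0 \<subseteq> ?K" "finite K0" "\<F> = (\<lambda>z. fst (p z)) ` K0"
      using finite_subset_image[OF F(1,2)] by (elim exE conjE)
    obtain zs where zs: "set zs = K0" using finite_list[OF K0(2)] by (rule exE)
    have "map p zs \<in> lists (\<B> \<times> Q)"
    proof -
      have "p z \<in> \<B> \<times> Q" if "z \<in> K0" for z
      proof -
        have "z \<in> ?K" using that K0(1) by (rule rev_subsetD)
        then show ?thesis using p(1,2)[of z] by (simp only: mem_Times_iff simp_thms)
      qed
      then show ?thesis unfolding in_lists_conv_set set_map zs by (intro ballI) (elim imageE, simp only:)
    qed
    moreover have "C (map p zs) n f"
      unfolding C_def \<delta>_def[symmetric]
    proof (intro conjI f ballI allI impI)
      fix q assume "q \<in> set (map p zs)"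
      then obtain z where "z \<in> ?K" "q = p z" using zs K0(1) by auto
      then show "case q of (U, c) \<Rightarrow> \<forall>x\<in>U. cmod (f x - c) < \<delta>"
        using p(4)[of z] by (simp add: case_prod_beta)
    next
      fix x assume x: "\<forall>(U, c)\<in>set (map p zs). x \<notin> U"
      have "x \<notin> \<Union>\<F>" using x zs by (auto simp: K0(3) case_prod_beta)
      then have "x \<notin> ?K" using F(3) by blast
      then show "cmod (f x) < \<delta>"
        using C0_D(3)[OF f, of x] \<delta> by (cases "x \<in> topspace Z") auto
    qed
    ultimately show ?thesis by blast
  qed
  show ?thesis
  proof (intro exI[of _ "pick ` I"] conjI ballI allI impI)
    show "pick ` I \<subseteq> C0 Z"
    proof clarify
      fix l n assume "(l, n) \<in> I"
      then obtain f where "C l n f" by (auto simp: I_def)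
      then show "pick (l, n) \<in> C0 Z" using pick[of l n f] unfolding C_def by blast
    qed
    have "I \<subseteq> lists (\<B> \<times> Q) \<times> (UNIV :: nat set)" by (auto simp: I_def)
    moreover have "countable (lists (\<B> \<times> Q) \<times> (UNIV :: nat set))"
      using B(1) Q(1) by (intro countable_SIGMA countable_lists) auto
    ultimately show "countable (pick ` I)" by (meson countable_subset countable_image)
    fix f and \<epsilon> :: real assume f: "f \<in> C0 Z" and "\<epsilon> > 0"
    then obtain n where n: "inverse (real (Suc n)) < \<epsilon> / 2" using reals_Archimedean[of "\<epsilon> / 2"] by auto
    obtain l where l: "l \<in> lists (\<B> \<times> Q)" "C l n f" using covers[OF f, of n] by (elim exE conjE)
    have "(l, n) \<in> I" unfolding I_def using l by blast
    moreover have "cmod (f x - pick (l, n) x) \<le> \<epsilon>" for x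
    proof -
      have "cmod (f x - pick (l, n) x) \<le> 2 / real (Suc n)"
        by (rule close[OF l(2) pick[OF l(2)]])
      also have "\<dots> \<le> \<epsilon>" using n by (simp add: field_simps)
      finally show ?thesis .
    qed
    ultimately show "\<exists>d\<in>pick ` I. \<forall>x. cmod (f x - d x) \<le> \<epsilon>"
      by (intro bexI[of _ "pick (l, n)"] allI imageI)
  qed
qed

lemma C0_bump:
  assumes lc: "locally_compact_space Z" and H: "Hausdorff_space Z" and U: "openin Z U" "x \<in> U"
  shows "\<exists>f\<in>C0 Z. f x = 1 \<and> (\<forall>y. y \<notin> U \<longrightarrow> f y = 0) \<and> (\<forall>y. cmod (f y) \<le> 1)"
proof -
  have xZ: "x \<in> topspace Z" using openin_subset[OF U(1)] U(2) by blast
  obtain V K where VK: "openin Z V" "compactin Z K" "x \<in> V" "V \<subseteq> K"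
    using lc xZ unfolding locally_compact_space_def by blast
  define W where "W = U \<inter> V"
  have W: "openin Z W" "x \<in> W" "W \<subseteq> U" "W \<subseteq> K" using U VK by (auto simp: W_def)
  have cr: "completely_regular_space Z"
    using lc H locally_compact_Hausdorff_imp_regular_space locally_compact_regular_imp_completely_regular_space
    by blast
  have "closedin Z (topspace Z - W)" "x \<in> topspace Z - (topspace Z - W)" using W xZ by auto
  then obtain g :: "'a \<Rightarrow> real" where g: "continuous_map Z (top_of_set {0..1}) g" "g x = 0"
      "g ` (topspace Z - W) \<subseteq> {1}"
    using cr unfolding completely_regular_space_def by meson
  have gc: "continuous_map Z euclidean g" and g01: "\<And>y. y \<in> topspace Z \<Longrightarrow> 0 \<le> g y \<and> g y \<le> 1"
    using g(1) by (auto simp: continuous_map_in_subtopology)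
  define f where "f y = (if y \<in> topspace Z then complex_of_real (1 - g y) else 0)" for y
  have fW: "f y = 0" if "y \<notin> W" for y using g(3) that by (auto simp: f_def)
  have "f \<in> C0 Z"
  proof (rule C0_I)
    have "continuous_map Z euclidean (\<lambda>y. complex_of_real (1 - g y))"
      using continuous_map_compose[OF gc, of euclidean "\<lambda>r. complex_of_real (1 - r)"]
      by (simp add: o_def continuous_intros)
    then show "continuous_map Z euclidean f"
      by (rule continuous_map_eq) (simp add: f_def)
    show "\<exists>K. compactin Z K \<and> {x \<in> topspace Z. \<epsilon> \<le> cmod (f x)} \<subseteq> K" if "\<epsilon> > 0" for \<epsilon>
    proof (intro exI conjI)
      show "{x \<in> topspace Z. \<epsilon> \<le> cmod (f x)} \<subseteq> K"
      proof clarify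
        fix y assume "y \<in> topspace Z" "\<epsilon> \<le> cmod (f y)"
        have "y \<in> W"
        proof (rule ccontr)
          assume "y \<notin> W"
          then show False using fW[of y] \<open>\<epsilon> > 0\<close> \<open>\<epsilon> \<le> cmod (f y)\<close> by simp
        qed
        then show "y \<in> K" using W(4) by blast
      qed
    qed (rule VK(2))
  qed (simp add: f_def)
  moreover have "f x = 1" using xZ g(2) by (simp add: f_def)
  moreover have "f y = 0" if "y \<notin> U" for y using fW W(3) that by blast
  moreover have "cmod (f y) \<le> 1" for y
  proof (cases "y \<in> topspace Z")
    case True
    then have "cmod (f y) = \<bar>1 - g y\<bar>" unfolding f_def by (simp only: norm_of_real if_True)
    then show ?thesis using g01[OF True] by simp
  qed (simp add: f_def)
  ultimately show ?thesis by blast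
qed


section \<open>Separability of completions\<close>

text \<open>A space of families of functions with pointwise linear operations and a seminorm: these data
  determine the completion as a metric space.\<close>

locale seminormed_function_algebra =
  fixes A :: "('i \<Rightarrow> 'x \<Rightarrow> complex, 'm) star_algebra_scheme" and p :: "('i \<Rightarrow> 'x \<Rightarrow> complex) \<Rightarrow> real"
  assumes zero_eq: "sa_zero A = (\<lambda>s x. 0)"
    and add_eq: "sa_add A = (\<lambda>T R s x. T s x + R s x)"
    and scale_eq: "sa_scale A = (\<lambda>c T s x. c * T s x)"
    and zero_mem: "sa_zero A \<in> sa_carrier A"
    and add_mem: "T \<in> sa_carrier A \<Longrightarrow> R \<in> sa_carrier A \<Longrightarrow> sa_add A T R \<in> sa_carrier A"
    and scale_mem: "T \<in> sa_carrier A \<Longrightarrow> sa_scale A c T \<in> sa_carrier A"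
    and p_nonneg: "T \<in> sa_carrier A \<Longrightarrow> 0 \<le> p T"
    and p_scale: "T \<in> sa_carrier A \<Longrightarrow> p (sa_scale A c T) = cmod c * p T"
    and p_add: "T \<in> sa_carrier A \<Longrightarrow> R \<in> sa_carrier A \<Longrightarrow> p (sa_add A T R) \<le> p T + p R"
begin

abbreviation "V \<equiv> sa_carrier A"
abbreviation "CS \<equiv> cauchy_seqs A p"
abbreviation "cls \<equiv> cauchy_class A p"
abbreviation "B \<equiv> hausdorff_completion A p"
definition "d T R = p (sa_diff A T R)"

lemma diff_eq: "sa_diff A T R = (\<lambda>s x. T s x - R s x)"
  by (simp add: sa_diff_def add_eq scale_eq)

lemma diff_mem: "T \<in> V \<Longrightarrow> R \<in> V \<Longrightarrow> sa_diff A T R \<in> V"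
  unfolding sa_diff_def by (intro add_mem scale_mem)

lemma d_nonneg: "T \<in> V \<Longrightarrow> R \<in> V \<Longrightarrow> 0 \<le> d T R"
  unfolding d_def by (intro p_nonneg diff_mem)

lemma d_self: "T \<in> V \<Longrightarrow> d T T = 0"
proof -
  assume T: "T \<in> V"
  have "sa_diff A T T = sa_scale A 0 T" by (simp add: diff_eq scale_eq)
  then show ?thesis unfolding d_def using p_scale[OF T, of 0] by simp
qed

lemma d_sym: "T \<in> V \<Longrightarrow> R \<in> V \<Longrightarrow> d T R = d R T"
proof -
  assume T: "T \<in> V" "R \<in> V"
  have "sa_diff A T R = sa_scale A (-1) (sa_diff A R T)" by (simp add: diff_eq scale_eq)
  then show ?thesis unfolding d_def using p_scale[OF diff_mem[OF T(2,1)], of "-1"] by simp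
qed

lemma d_tri: "T \<in> V \<Longrightarrow> R \<in> V \<Longrightarrow> Q \<in> V \<Longrightarrow> d T Q \<le> d T R + d R Q"
proof -
  assume T: "T \<in> V" "R \<in> V" "Q \<in> V"
  have "sa_diff A T Q = sa_add A (sa_diff A T R) (sa_diff A R Q)" by (simp add: diff_eq add_eq)
  then show ?thesis unfolding d_def using p_add[OF diff_mem[OF T(1,2)] diff_mem[OF T(2,3)]] by simp
qed

lemma d_abs_diff:
  assumes "T \<in> V" "R \<in> V" "T' \<in> V" "R' \<in> V"
  shows "\<bar>d T R - d T' R'\<bar> \<le> d T T' + d R R'"
  using d_tri[of T T' R] d_tri[of T' R' R] d_tri[of T' T R'] d_tri[of T R R'] assms
    d_sym[of T T'] d_sym[of R R'] by linarith

lemma CS_mem: "f \<in> CS \<Longrightarrow> f n \<in> V"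
  by (simp add: cauchy_seqs_def)

lemma CS_cauchy: "f \<in> CS \<Longrightarrow> \<epsilon> > 0 \<Longrightarrow> \<exists>N. \<forall>m\<ge>N. \<forall>n\<ge>N. d (f m) (f n) < \<epsilon>"
  by (simp add: cauchy_seqs_def d_def)

lemma CS_I:
  "(\<And>n. f n \<in> V) \<Longrightarrow> (\<And>\<epsilon>. \<epsilon> > 0 \<Longrightarrow> \<exists>N. \<forall>m\<ge>N. \<forall>n\<ge>N. d (f m) (f n) < \<epsilon>) \<Longrightarrow> f \<in> CS"
  by (simp add: cauchy_seqs_def d_def)

lemma const_CS: "T \<in> V \<Longrightarrow> (\<lambda>n. T) \<in> CS"
  by (rule CS_I) (auto simp: d_self)

lemma mem_cls: "g \<in> cls f \<longleftrightarrow> g \<in> CS \<and> (\<lambda>n. d (f n) (g n)) \<longlonglongrightarrow> 0"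
  by (simp add: cauchy_class_def d_def)

lemma cls_self: "f \<in> CS \<Longrightarrow> f \<in> cls f"
  by (simp add: mem_cls d_self CS_mem)

lemma tendsto_0_tri:
  assumes "f \<in> CS" "g \<in> CS" "h \<in> CS"
    and "(\<lambda>n. d (f n) (g n)) \<longlonglongrightarrow> 0" "(\<lambda>n. d (g n) (h n)) \<longlonglongrightarrow> 0"
  shows "(\<lambda>n. d (f n) (h n)) \<longlonglongrightarrow> 0"
proof (rule tendsto_sandwich[OF _ _ tendsto_const])
  show "(\<lambda>n. d (f n) (g n) + d (g n) (h n)) \<longlonglongrightarrow> 0"
    using tendsto_add[OF assms(4,5)] by simp
qed (use assms in \<open>auto intro!: always_eventually d_nonneg d_tri CS_mem\<close>)

lemma cls_eq_iff:
  assumes f: "f \<in> CS" and g: "g \<in> CS"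
  shows "cls f = cls g \<longleftrightarrow> (\<lambda>n. d (f n) (g n)) \<longlonglongrightarrow> 0"
proof
  assume "cls f = cls g"
  then have "g \<in> cls f" using cls_self[OF g] by simp
  then show "(\<lambda>n. d (f n) (g n)) \<longlonglongrightarrow> 0" by (simp add: mem_cls)
next
  assume fg: "(\<lambda>n. d (f n) (g n)) \<longlonglongrightarrow> 0"
  have "(\<lambda>n. d (f n) (g n)) = (\<lambda>n. d (g n) (f n))" using d_sym CS_mem f g by blast
  then have gf: "(\<lambda>n. d (g n) (f n)) \<longlonglongrightarrow> 0" using fg by simp
  have "h \<in> cls f \<longleftrightarrow> h \<in> cls g" for h
    unfolding mem_cls using tendsto_0_tri[OF f g _ fg] tendsto_0_tri[OF g f _ gf] by blast
  then show "cls f = cls g" by blast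
qed

definition "rep X = (SOME f. f \<in> X)"

lemma rep_cls:
  assumes "f \<in> CS"
  shows "rep (cls f) \<in> CS" "(\<lambda>n. d (f n) (rep (cls f) n)) \<longlonglongrightarrow> 0"
proof -
  have "rep (cls f) \<in> cls f" unfolding rep_def by (rule someI[of "\<lambda>g. g \<in> cls f", OF cls_self[OF assms]])
  then show "rep (cls f) \<in> CS" "(\<lambda>n. d (f n) (rep (cls f) n)) \<longlonglongrightarrow> 0"
    by (simp_all add: mem_cls)
qed

lemma d_Cauchy:
  assumes f: "f \<in> CS" and g: "g \<in> CS"
  shows "convergent (\<lambda>n. d (f n) (g n))"
proof -
  have "Cauchy (\<lambda>n. d (f n) (g n))"
  proof (rule CauchyI)
    fix \<epsilon> :: real assume "\<epsilon> > 0"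
    then obtain N M where N: "\<forall>m\<ge>N. \<forall>n\<ge>N. d (f m) (f n) < \<epsilon> / 2" and M: "\<forall>m\<ge>M. \<forall>n\<ge>M. d (g m) (g n) < \<epsilon> / 2"
      using CS_cauchy[OF f, of "\<epsilon> / 2"] CS_cauchy[OF g, of "\<epsilon> / 2"] by auto
    have "norm (d (f m) (g m) - d (f n) (g n)) < \<epsilon>" if "m \<ge> max N M" "n \<ge> max N M" for m n
    proof -
      have "d (f m) (f n) < \<epsilon> / 2" "d (g m) (g n) < \<epsilon> / 2" using N M that by auto
      then show ?thesis
        using d_abs_diff[of "f m" "g m" "f n" "g n"] CS_mem f g by fastforce
    qed
    then show "\<exists>M. \<forall>m\<ge>M. \<forall>n\<ge>M. norm (d (f m) (g m) - d (f n) (g n)) < \<epsilon>" by blast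
  qed
  then show ?thesis by (simp add: Cauchy_convergent_iff)
qed

lemma completion_carrier: "sa_carrier B = cls ` CS"
  by (simp add: hausdorff_completion_def Let_def)

lemma completion_diff:
  "sa_diff B X Y = cls (\<lambda>n. sa_add A (rep X n) (rep (cls (\<lambda>n. sa_scale A (-1) (rep Y n))) n))"
  by (simp add: sa_diff_def hausdorff_completion_def Let_def rep_def)

lemma completion_norm: "sa_norm B X = lim (\<lambda>n. p (rep X n))"
  by (simp add: hausdorff_completion_def Let_def rep_def)

lemma add_CS:
  assumes f: "f \<in> CS" and g: "g \<in> CS"
  shows "(\<lambda>n. sa_add A (f n) (g n)) \<in> CS"
proof (rule CS_I)
  show "sa_add A (f n) (g n) \<in> V" for n using add_mem CS_mem f g by blast
  fix \<epsilon> :: real assume "\<epsilon> > 0"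
  then obtain N M where N: "\<forall>m\<ge>N. \<forall>n\<ge>N. d (f m) (f n) < \<epsilon> / 2" and M: "\<forall>m\<ge>M. \<forall>n\<ge>M. d (g m) (g n) < \<epsilon> / 2"
    using CS_cauchy[OF f, of "\<epsilon> / 2"] CS_cauchy[OF g, of "\<epsilon> / 2"] by auto
  have "d (sa_add A (f m) (g m)) (sa_add A (f n) (g n)) < \<epsilon>" if "m \<ge> max N M" "n \<ge> max N M" for m n
  proof -
    have "sa_diff A (sa_add A (f m) (g m)) (sa_add A (f n) (g n)) =
        sa_add A (sa_diff A (f m) (f n)) (sa_diff A (g m) (g n))"
      by (simp add: diff_eq add_eq algebra_simps)
    then have "d (sa_add A (f m) (g m)) (sa_add A (f n) (g n)) \<le> d (f m) (f n) + d (g m) (g n)"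
      unfolding d_def using p_add diff_mem CS_mem f g by metis
    moreover have "d (f m) (f n) < \<epsilon> / 2" "d (g m) (g n) < \<epsilon> / 2" using N M that by auto
    ultimately show ?thesis by linarith
  qed
  then show "\<exists>N. \<forall>m\<ge>N. \<forall>n\<ge>N. d (sa_add A (f m) (g m)) (sa_add A (f n) (g n)) < \<epsilon>" by blast
qed

lemma scale_CS:
  assumes f: "f \<in> CS"
  shows "(\<lambda>n. sa_scale A (-1) (f n)) \<in> CS"
proof (rule CS_I)
  show "sa_scale A (-1) (f n) \<in> V" for n using scale_mem CS_mem f by blast
  have "d (sa_scale A (-1) (f m)) (sa_scale A (-1) (f n)) = d (f m) (f n)" for m n
  proof -
    have "sa_diff A (sa_scale A (-1) (f m)) (sa_scale A (-1) (f n)) = sa_diff A (f n) (f m)"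
      by (simp add: diff_eq scale_eq)
    then show ?thesis using d_sym[OF CS_mem[OF f] CS_mem[OF f], of m n] by (simp add: d_def)
  qed
  then show "\<exists>N. \<forall>m\<ge>N. \<forall>n\<ge>N. d (sa_scale A (-1) (f m)) (sa_scale A (-1) (f n)) < \<epsilon>" if "\<epsilon> > 0" for \<epsilon>
    using CS_cauchy[OF f that] by simp
qed

text \<open>The operations of the completion involve chosen representatives; the errors so introduced are
  null sequences, hence invisible in the limit.\<close>

lemma completion_dist:
  assumes f: "f \<in> CS" and g: "g \<in> CS"
  shows "(\<lambda>n. d (f n) (g n)) \<longlonglongrightarrow> sa_dist B (cls f) (cls g)"
proof -
  let ?f = "rep (cls f)" and ?g = "rep (cls g)"
  let ?g' = "\<lambda>n. sa_scale A (-1) (?g n)"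
  let ?h = "rep (cls ?g')"
  let ?u = "\<lambda>n. sa_add A (?f n) (?h n)"
  let ?v = "rep (cls ?u)"
  note rf = rep_cls[OF f] and rg = rep_cls[OF g]
  have g': "?g' \<in> CS" by (rule scale_CS[OF rg(1)])
  note rh = rep_cls[OF g']
  have u: "?u \<in> CS" by (rule add_CS[OF rf(1) rh(1)])
  note rv = rep_cls[OF u]
  have "\<bar>p (?v n) - d (f n) (g n)\<bar> \<le> d (f n) (?f n) + d (g n) (?g n) + d (?g' n) (?h n) + d (?u n) (?v n)" for n
  proof -
    have mem: "f n \<in> V" "g n \<in> V" "?f n \<in> V" "?g n \<in> V" "?g' n \<in> V" "?h n \<in> V" "?u n \<in> V" "?v n \<in> V"
      using f g rf(1) rg(1) g' rh(1) u rv(1) CS_mem by blast+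
    let ?w = "sa_add A (?f n) (?g' n)"
    have w: "?w = sa_diff A (?f n) (?g n)" by (simp add: sa_diff_def)
    have wV: "?w \<in> V" using mem add_mem by blast
    have z: "p T = d T (sa_zero A)" for T by (simp add: d_def diff_eq zero_eq)
    have "\<bar>p (?v n) - p ?w\<bar> \<le> d (?v n) ?w + d (sa_zero A) (sa_zero A)"
      using d_abs_diff[OF mem(8) zero_mem wV zero_mem] by (simp only: z[of "?v n"] z[of ?w])
    also have "\<dots> \<le> d (?u n) (?v n) + d (?u n) ?w"
      using d_tri[OF mem(8) mem(7) wV] d_sym[OF mem(8) mem(7)] d_self[OF zero_mem] by simp
    also have "d (?u n) ?w = d (?g' n) (?h n)"
    proof -
      have "sa_diff A (?u n) ?w = sa_diff A (?h n) (?g' n)" by (simp add: diff_eq add_eq)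
      then show ?thesis using d_sym[OF mem(5,6)] by (simp add: d_def)
    qed
    finally have 1: "\<bar>p (?v n) - p ?w\<bar> \<le> d (?u n) (?v n) + d (?g' n) (?h n)" .
    have "\<bar>d (f n) (g n) - d (?f n) (?g n)\<bar> \<le> d (f n) (?f n) + d (g n) (?g n)"
      by (rule d_abs_diff[OF mem(1,2,3,4)])
    moreover have "p ?w = d (?f n) (?g n)" unfolding w d_def ..
    ultimately show ?thesis using 1 by linarith
  qed
  then have bound: "\<forall>\<^sub>F n in sequentially. norm (p (?v n) - d (f n) (g n))
      \<le> d (f n) (?f n) + d (g n) (?g n) + d (?g' n) (?h n) + d (?u n) (?v n)"
    unfolding real_norm_def by (intro always_eventually allI)
  have "(\<lambda>n. d (f n) (?f n) + d (g n) (?g n) + d (?g' n) (?h n) + d (?u n) (?v n)) \<longlonglongrightarrow> 0"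
    using tendsto_add[OF tendsto_add[OF tendsto_add[OF rf(2) rg(2)] rh(2)] rv(2)] by simp
  with bound have lim0: "(\<lambda>n. p (?v n) - d (f n) (g n)) \<longlonglongrightarrow> 0"
    by (rule Lim_null_comparison)
  obtain L where L: "(\<lambda>n. d (f n) (g n)) \<longlonglongrightarrow> L"
    using d_Cauchy[OF f g] by (auto simp: convergent_def)
  have "(\<lambda>n. p (?v n)) \<longlonglongrightarrow> L" using tendsto_add[OF lim0 L] by simp
  then have "lim (\<lambda>n. p (?v n)) = L" by (rule limI)
  moreover have "sa_dist B (cls f) (cls g) = lim (\<lambda>n. p (?v n))"
    using f g by (simp add: sa_dist_def completion_carrier completion_norm completion_diff)
  ultimately show ?thesis using L by simp
qed

lemma completion_dist_cls_nonneg: "f \<in> CS \<Longrightarrow> g \<in> CS \<Longrightarrow> 0 \<le> sa_dist B (cls f) (cls g)"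
  by (rule LIMSEQ_le_const[OF completion_dist]) (simp_all add: d_nonneg CS_mem)

lemma completion_dist_cls_sym:
  assumes "f \<in> CS" "g \<in> CS"
  shows "sa_dist B (cls f) (cls g) = sa_dist B (cls g) (cls f)"
proof -
  have "(\<lambda>n. d (f n) (g n)) = (\<lambda>n. d (g n) (f n))"
    by (intro ext d_sym CS_mem assms)
  then show ?thesis
    using LIMSEQ_unique[OF completion_dist[OF assms]] completion_dist[OF assms(2,1)] by simp
qed

lemma completion_dist_cls_eq_0:
  assumes "f \<in> CS" "g \<in> CS"
  shows "sa_dist B (cls f) (cls g) = 0 \<longleftrightarrow> cls f = cls g"
proof
  assume "sa_dist B (cls f) (cls g) = 0"
  then show "cls f = cls g"
    using completion_dist[OF assms] cls_eq_iff[OF assms] by simp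
next
  assume "cls f = cls g"
  then have "(\<lambda>n. d (f n) (g n)) \<longlonglongrightarrow> 0" by (rule cls_eq_iff[OF assms, THEN iffD1])
  then show "sa_dist B (cls f) (cls g) = 0"
    by (rule LIMSEQ_unique[OF completion_dist[OF assms]])
qed

lemma completion_dist_cls_triangle:
  assumes "f \<in> CS" "g \<in> CS" "h \<in> CS"
  shows "sa_dist B (cls f) (cls h) \<le> sa_dist B (cls f) (cls g) + sa_dist B (cls g) (cls h)"
  by (rule LIMSEQ_le[OF completion_dist[OF assms(1,3)]
        tendsto_add[OF completion_dist[OF assms(1,2)] completion_dist[OF assms(2,3)]]])
    (simp add: d_tri CS_mem assms)

lemma completion_carrierE:
  assumes "X \<in> sa_carrier B"
  obtains f where "f \<in> CS" "X = cls f"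
  using assms unfolding completion_carrier by (elim imageE) (rule that)

lemma completion_metric: "Metric_space (sa_carrier B) (sa_dist B)"
proof
  show "0 \<le> sa_dist B X Y" for X Y
  proof (cases "X \<in> sa_carrier B \<and> Y \<in> sa_carrier B")
    case True
    then show ?thesis
      by (elim conjE completion_carrierE) (simp only: completion_dist_cls_nonneg)
  qed (auto simp: sa_dist_def)
  show "sa_dist B X Y = sa_dist B Y X" for X Y
  proof (cases "X \<in> sa_carrier B \<and> Y \<in> sa_carrier B")
    case True
    then show ?thesis
      by (elim conjE completion_carrierE) (hypsubst, rule completion_dist_cls_sym)
  qed (auto simp: sa_dist_def)
  show "sa_dist B X Y = 0 \<longleftrightarrow> X = Y" if "X \<in> sa_carrier B" "Y \<in> sa_carrier B" for X Y
    using that by (elim completion_carrierE) (simp only: completion_dist_cls_eq_0)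
  show "sa_dist B X Z \<le> sa_dist B X Y + sa_dist B Y Z"
    if "X \<in> sa_carrier B" "Y \<in> sa_carrier B" "Z \<in> sa_carrier B" for X Y Z
    using that by (elim completion_carrierE) (simp only: completion_dist_cls_triangle)
qed

theorem separable_completion_iff:
  "separable_algebra B \<longleftrightarrow>
    (\<exists>D\<subseteq>V. countable D \<and> (\<forall>T\<in>V. \<forall>\<epsilon>>0. \<exists>R\<in>D. p (sa_diff A T R) < \<epsilon>))"
proof -
  interpret M: Metric_space "sa_carrier B" "sa_dist B" by (rule completion_metric)
  have sep: "separable_algebra B \<longleftrightarrow>
    (\<exists>C\<subseteq>sa_carrier B. countable C \<and> (\<forall>X\<in>sa_carrier B. \<forall>\<epsilon>>0. \<exists>Y\<in>C. sa_dist B X Y < \<epsilon>))"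
  proof -
    have "M.mtopology closure_of C = topspace M.mtopology \<longleftrightarrow>
        (\<forall>X\<in>sa_carrier B. \<forall>\<epsilon>>0. \<exists>Y\<in>C. sa_dist B X Y < \<epsilon>)" if "C \<subseteq> sa_carrier B" for C
      unfolding M.metric_closure_of M.in_mball M.topspace_mtopology using that by blast
    then show ?thesis
      unfolding separable_algebra_def separable_space_def M.topspace_mtopology by (metis (no_types, lifting))
  qed
  show ?thesis
  proof
    assume "separable_algebra B"
    then obtain C where C: "C \<subseteq> sa_carrier B" "countable C"
      and dense: "\<And>X \<epsilon>. X \<in> sa_carrier B \<Longrightarrow> \<epsilon> > 0 \<Longrightarrow> \<exists>Y\<in>C. sa_dist B X Y < \<epsilon>"
      unfolding sep by metis
    have rep: "rep Y \<in> CS" "Y = cls (rep Y)" if "Y \<in> C" for Y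
    proof -
      obtain f where f: "f \<in> CS" "Y = cls f" using C(1) \<open>Y \<in> C\<close> by (auto simp: completion_carrier)
      show "rep Y \<in> CS" "Y = cls (rep Y)"
        unfolding f(2) using rep_cls[OF f(1)] cls_eq_iff[OF f(1) rep_cls(1)[OF f(1)]] by auto
    qed
    show "\<exists>D\<subseteq>V. countable D \<and> (\<forall>T\<in>V. \<forall>\<epsilon>>0. \<exists>R\<in>D. p (sa_diff A T R) < \<epsilon>)"
    proof (intro exI[of _ "\<Union>Y\<in>C. range (rep Y)"] conjI ballI allI impI)
      show "(\<Union>Y\<in>C. range (rep Y)) \<subseteq> V" using rep(1) CS_mem by auto
      show "countable (\<Union>Y\<in>C. range (rep Y))" using C(2) by auto
      fix T and \<epsilon> :: real assume T: "T \<in> V" "\<epsilon> > 0"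
      have "cls (\<lambda>n. T) \<in> sa_carrier B" using const_CS[OF T(1)] by (simp add: completion_carrier)
      then obtain Y where Y: "Y \<in> C" "sa_dist B (cls (\<lambda>n. T)) Y < \<epsilon>" using dense T(2) by blast
      have "(\<lambda>n. d T (rep Y n)) \<longlonglongrightarrow> sa_dist B (cls (\<lambda>n. T)) Y"
        using completion_dist[OF const_CS[OF T(1)] rep(1)[OF Y(1)]] rep(2)[OF Y(1)] by simp
      then have "eventually (\<lambda>n. d T (rep Y n) < \<epsilon>) sequentially" using Y(2) by (rule order_tendstoD)
      then obtain n where "d T (rep Y n) < \<epsilon>" by (auto simp: eventually_sequentially)
      then show "\<exists>R\<in>\<Union>Y\<in>C. range (rep Y). p (sa_diff A T R) < \<epsilon>"
        using Y(1) unfolding d_def by blast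
    qed
  next
    assume "\<exists>D\<subseteq>V. countable D \<and> (\<forall>T\<in>V. \<forall>\<epsilon>>0. \<exists>R\<in>D. p (sa_diff A T R) < \<epsilon>)"
    then obtain D where D: "D \<subseteq> V" "countable D"
      and dense: "\<And>T \<epsilon>. T \<in> V \<Longrightarrow> \<epsilon> > 0 \<Longrightarrow> \<exists>R\<in>D. d T R < \<epsilon>"
      unfolding d_def by metis
    show "separable_algebra B"
      unfolding sep
    proof (intro exI[of _ "(\<lambda>R. cls (\<lambda>n. R)) ` D"] conjI ballI allI impI)
      show "(\<lambda>R. cls (\<lambda>n. R)) ` D \<subseteq> sa_carrier B" using D(1) const_CS by (auto simp: completion_carrier)
      show "countable ((\<lambda>R. cls (\<lambda>n. R)) ` D)" using D(2) by simp
      fix X and \<epsilon> :: real assume "X \<in> sa_carrier B" and \<epsilon>: "\<epsilon> > 0"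
      then obtain f where f: "f \<in> CS" "X = cls f" by (auto simp: completion_carrier)
      obtain N where N: "\<forall>m\<ge>N. \<forall>n\<ge>N. d (f m) (f n) < \<epsilon> / 3" using CS_cauchy[OF f(1), of "\<epsilon> / 3"] \<epsilon> by auto
      obtain R where R: "R \<in> D" "d (f N) R < \<epsilon> / 3"
        using dense[OF CS_mem[OF f(1), of N], of "\<epsilon> / 3"] \<epsilon> by auto
      have RV: "R \<in> V" using R(1) D(1) by blast
      have "sa_dist B X (cls (\<lambda>n. R)) \<le> 2 * \<epsilon> / 3"
        unfolding f(2)
      proof (rule LIMSEQ_le_const2[OF completion_dist[OF f(1) const_CS[OF RV]]], intro exI allI impI)
        fix n assume "N \<le> n"
        then have "d (f n) (f N) < \<epsilon> / 3" using N by simp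
        then show "d (f n) R \<le> 2 * \<epsilon> / 3"
          using d_tri[OF CS_mem[OF f(1), of n] CS_mem[OF f(1), of N] RV] R(2) by linarith
      qed
      then show "\<exists>Y\<in>(\<lambda>R. cls (\<lambda>n. R)) ` D. sa_dist B X Y < \<epsilon>"
        using R(1) \<epsilon> by (intro bexI[of _ "cls (\<lambda>n. R)"]) auto
    qed
  qed
qed

end


section \<open>Completions of the algebraic crossed product\<close>

text \<open>The value at \<open>s\<close> of \<open>T\<close> applied to the basis vector \<open>s\<^sup>\<star>s\<close> in the regular representation
  over a point of \<open>X\<^bsub>s\<^sup>\<star>s\<^esub>\<close>.\<close>

definition upper_sum :: "('s::inverse_semigroup \<Rightarrow> 'x \<Rightarrow> complex) \<Rightarrow> 's \<Rightarrow> 'x \<Rightarrow> complex"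
  where "upper_sum T s x = (\<Sum>t\<in>{t \<in> sg_supp T. nat_le s t}. T t x)"

lemma upper_sum_eq:
  assumes "finite F" "sg_supp T \<subseteq> F"
  shows "upper_sum T s x = (\<Sum>t\<in>{t \<in> F. nat_le s t}. T t x)"
  unfolding upper_sum_def
  by (rule sum.mono_neutral_left) (use assms in \<open>auto simp: sg_supp_def\<close>)

lemma upper_sum_delta: "upper_sum (delta s a) t x = (if nat_le t s then a x else 0)"
proof -
  have "{u \<in> {s}. nat_le t u} = (if nat_le t s then {s} else {})" by auto
  moreover have "sg_supp (delta s a) \<subseteq> {s}" by (simp add: sg_supp_delta)
  ultimately show ?thesis
    using upper_sum_eq[of "{s}" "delta s a" t x] by (simp add: delta_def)
qed

lemma KS_alg_simps:
  "sa_zero (KS_alg \<theta> X) = (\<lambda>s x. 0)"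
  "sa_add (KS_alg \<theta> X) = (\<lambda>T R s x. T s x + R s x)"
  "sa_scale (KS_alg \<theta> X) = (\<lambda>c T s x. c * T s x)"
  by (simp_all add: KS_alg_def)

lemma KS_diff: "sa_diff (KS_alg \<theta> X) = (\<lambda>T R s x. T s x - R s x)"
  by (intro ext) (simp add: sa_diff_def KS_alg_simps)

lemma KS_carrier_iff:
  "T \<in> sa_carrier (KS_alg \<theta> X) \<longleftrightarrow> finite (sg_supp T) \<and> (\<forall>s. T s \<in> ideal_at \<theta> X (s\<^sup>\<star> * s))"
  by (simp add: KS_alg_def)

lemma sg_supp_add: "sg_supp (\<lambda>s x. T s x + R s x) \<subseteq> sg_supp T \<union> sg_supp R"
  by (auto simp: sg_supp_def)

lemma sg_supp_diff: "sg_supp (\<lambda>s x. T s x - R s x) \<subseteq> sg_supp T \<union> sg_supp R"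
  by (auto simp: sg_supp_def)

lemma sg_supp_scale: "sg_supp (\<lambda>s x. c * T s x) \<subseteq> sg_supp T"
  by (auto simp: sg_supp_def)

lemma upper_sum_diff:
  assumes "finite (sg_supp T)" "finite (sg_supp R)"
  shows "upper_sum (\<lambda>s x. T s x - R s x) s x = upper_sum T s x - upper_sum R s x"
proof -
  let ?F = "sg_supp T \<union> sg_supp R"
  have F: "finite ?F" using assms by simp
  show ?thesis
    using upper_sum_eq[OF F sg_supp_diff, of s x] upper_sum_eq[OF F, of T s x] upper_sum_eq[OF F, of R s x]
    by (simp add: sum_subtractf)
qed

lemma KS_zero_mem: "sa_zero (KS_alg \<theta> X) \<in> sa_carrier (KS_alg \<theta> X)"
  by (simp add: KS_carrier_iff KS_alg_simps ideal_at_def C0_zero sg_supp_def)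

lemma KS_add_mem:
  "T \<in> sa_carrier (KS_alg \<theta> X) \<Longrightarrow> R \<in> sa_carrier (KS_alg \<theta> X) \<Longrightarrow>
    sa_add (KS_alg \<theta> X) T R \<in> sa_carrier (KS_alg \<theta> X)"
  using finite_subset[OF sg_supp_add[of T R]]
  by (simp add: KS_carrier_iff KS_alg_simps ideal_at_def C0_add)

lemma KS_scale_mem:
  "T \<in> sa_carrier (KS_alg \<theta> X) \<Longrightarrow> sa_scale (KS_alg \<theta> X) c T \<in> sa_carrier (KS_alg \<theta> X)"
  using finite_subset[OF sg_supp_scale[of c T]]
  by (simp add: KS_carrier_iff KS_alg_simps ideal_at_def C0_scale)

lemma KS_delta_mem:
  "a \<in> ideal_at \<theta> X (s\<^sup>\<star> * s) \<Longrightarrow> delta s a \<in> sa_carrier (KS_alg \<theta> X)"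
  unfolding KS_carrier_iff by (simp add: sg_supp_delta) (simp add: delta_def ideal_at_def C0_zero)

lemma KS_carrier_bounded:
  assumes "T \<in> sa_carrier (KS_alg \<theta> X)"
  shows "\<exists>M. \<forall>s. 0 < M s \<and> (\<forall>x. cmod (T s x) \<le> M s)"
proof (rule choice)
  show "\<forall>s. \<exists>M. 0 < M \<and> (\<forall>x. cmod (T s x) \<le> M)"
    using assms unfolding KS_carrier_iff ideal_at_def by (intro allI C0_bounded) (elim conjE, erule spec)
qed

lemma scale_equality_from_inequality:
  assumes le: "\<And>T c. T \<in> sa_carrier (KS_alg \<theta> X) \<Longrightarrow> q (sa_scale (KS_alg \<theta> X) c T) \<le> cmod c * q T"
    and nonneg: "\<And>T. T \<in> sa_carrier (KS_alg \<theta> X) \<Longrightarrow> 0 \<le> (q T :: real)"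
    and T: "T \<in> sa_carrier (KS_alg \<theta> X)"
  shows "q (sa_scale (KS_alg \<theta> X) c T) = cmod c * q T"
proof (cases "c = 0")
  case True
  then show ?thesis using le[OF T, of c] nonneg[OF KS_scale_mem[OF T, of c]] by simp
next
  case False
  have "sa_scale (KS_alg \<theta> X) (inverse c) (sa_scale (KS_alg \<theta> X) c T) = T"
    using False by (simp add: KS_alg_simps mult.assoc[symmetric])
  then have "q T \<le> cmod (inverse c) * q (sa_scale (KS_alg \<theta> X) c T)"
    using le[OF KS_scale_mem[OF T, of c], of "inverse c"] by simp
  then have "cmod c * q T \<le> cmod c * (cmod (inverse c) * q (sa_scale (KS_alg \<theta> X) c T))"
    by (rule mult_left_mono) simp
  also have "\<dots> = q (sa_scale (KS_alg \<theta> X) c T)"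
    using False by (simp add: norm_inverse)
  finally show ?thesis using le[OF T, of c] by simp
qed

text \<open>Every element of the algebraic crossed product is the finite sum of its components \<open>\<delta>\<^sub>s T\<^sub>s\<close>.\<close>

lemma KS_seminorm_le_sum:
  assumes add: "\<And>T R. T \<in> sa_carrier (KS_alg \<theta> X) \<Longrightarrow> R \<in> sa_carrier (KS_alg \<theta> X) \<Longrightarrow>
      p (sa_add (KS_alg \<theta> X) T R) \<le> p T + p R"
    and bound: "\<And>s a M. a \<in> ideal_at \<theta> X (s\<^sup>\<star> * s) \<Longrightarrow> (\<And>x. cmod (a x) \<le> M) \<Longrightarrow> p (delta s a) \<le> M"
    and T: "T \<in> sa_carrier (KS_alg \<theta> X)"
    and F: "finite F" "sg_supp T \<subseteq> F" and M: "\<And>s x. s \<in> F \<Longrightarrow> cmod (T s x) \<le> M s"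
  shows "p T \<le> sum M F"
  using F(1) T F(2) M
proof (induction F arbitrary: T)
  case empty
  then have "T = delta undefined (\<lambda>_. 0)" by (auto simp: sg_supp_def delta_def)
  moreover have "p (delta undefined (\<lambda>_. 0)) \<le> 0"
    by (rule bound) (simp_all add: ideal_at_def C0_zero)
  ultimately show ?case by simp
next
  case (insert s F)
  have Ts: "T s \<in> ideal_at \<theta> X (s\<^sup>\<star> * s)" using insert.prems(1) by (simp add: KS_carrier_iff)
  define R where "R = T(s := (\<lambda>_. 0))"
  have supp: "sg_supp R \<subseteq> F" using insert.prems(2) by (auto simp: R_def sg_supp_def)
  have R: "R \<in> sa_carrier (KS_alg \<theta> X)"
    using insert.prems(1) finite_subset[OF supp insert.hyps(1)]
    by (auto simp: KS_carrier_iff R_def ideal_at_def C0_zero)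
  have "T = sa_add (KS_alg \<theta> X) (delta s (T s)) R"
    by (auto simp: KS_alg_simps R_def delta_def fun_eq_iff)
  then have "p T \<le> p (delta s (T s)) + p R"
    using add[OF KS_delta_mem[OF Ts] R] by simp
  also have "\<dots> \<le> M s + sum M F"
  proof (rule add_mono)
    show "p (delta s (T s)) \<le> M s" by (rule bound[OF Ts]) (simp add: insert.prems(3))
    show "p R \<le> sum M F"
    proof (rule insert.IH[OF R supp])
      show "cmod (R u x) \<le> M u" if "u \<in> F" for u x
        using that insert.hyps(2) insert.prems(3)[of u x] by (auto simp: R_def)
    qed
  qed
  finally show ?case using insert.hyps by simp
qed

context
  fixes \<theta> :: "'s::inverse_semigroup \<Rightarrow> 'x \<Rightarrow> 'x option" and X :: "'x topology"
    and p :: "('s \<Rightarrow> 'x \<Rightarrow> complex) \<Rightarrow> real"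
  assumes act: "sg_action \<theta> X" and lc: "locally_compact_space X" and H: "Hausdorff_space X"
    and p_nonneg: "\<And>T. T \<in> sa_carrier (KS_alg \<theta> X) \<Longrightarrow> 0 \<le> p T"
    and p_scale: "\<And>T c. T \<in> sa_carrier (KS_alg \<theta> X) \<Longrightarrow> p (sa_scale (KS_alg \<theta> X) c T) = cmod c * p T"
    and p_add: "\<And>T R. T \<in> sa_carrier (KS_alg \<theta> X) \<Longrightarrow> R \<in> sa_carrier (KS_alg \<theta> X) \<Longrightarrow>
      p (sa_add (KS_alg \<theta> X) T R) \<le> p T + p R"
    and upper: "\<And>s a M. a \<in> ideal_at \<theta> X (s\<^sup>\<star> * s) \<Longrightarrow> (\<And>x. cmod (a x) \<le> M) \<Longrightarrow> p (delta s a) \<le> M"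
    and lower: "\<And>T s x. T \<in> sa_carrier (KS_alg \<theta> X) \<Longrightarrow> x \<in> fixdom \<theta> (s\<^sup>\<star> * s) \<Longrightarrow>
      cmod (upper_sum T s x) \<le> p T"
begin

interpretation sfa: seminormed_function_algebra "KS_alg \<theta> X" p
  by unfold_locales
    (rule KS_alg_simps KS_zero_mem KS_add_mem KS_scale_mem p_nonneg p_scale p_add; assumption?)+

abbreviation (input) "supp_sg \<equiv> {s. fixdom \<theta> (s\<^sup>\<star> * s) \<noteq> {}}"

lemma fixdom_bump:
  assumes e: "e \<in> idems" and U: "openin (subtopology X (fixdom \<theta> e)) U" "x \<in> U"
  shows "\<exists>f\<in>ideal_at \<theta> X e. f x = 1 \<and> (\<forall>y. y \<notin> U \<longrightarrow> f y = 0) \<and> (\<forall>y. cmod (f y) \<le> 1)"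
  unfolding ideal_at_def
  by (rule C0_bump[OF locally_compact_space_open_subset Hausdorff_space_subtopology])
    (simp_all add: H lc action_openin_fixdom[OF act e] U)

text \<open>The dense set consists of the elements with support in the countable set of \<open>s\<close> with nonempty
  domain and components in countable dense subsets of the ideals; association lists enumerate it.\<close>

lemma separable_if_countable:
  assumes sc: "second_countable X" and ctb: "countable supp_sg"
  shows "separable_algebra (hausdorff_completion (KS_alg \<theta> X) p)"
  unfolding sfa.separable_completion_iff
proof -
  have "\<forall>s\<in>UNIV. \<exists>D. D \<subseteq> ideal_at \<theta> X (s\<^sup>\<star> * s) \<and> countable D \<and>
      (\<forall>f\<in>ideal_at \<theta> X (s\<^sup>\<star> * s). \<forall>\<epsilon>>0. \<exists>d\<in>D. \<forall>x. cmod (f x - d x) \<le> \<epsilon>)"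
    unfolding ideal_at_def using C0_separable[OF second_countable_subtopology[OF sc]] by simp
  from bchoice[OF this] obtain D where
    "\<forall>s\<in>UNIV. D s \<subseteq> ideal_at \<theta> X (s\<^sup>\<star> * s) \<and> countable (D s) \<and>
      (\<forall>f\<in>ideal_at \<theta> X (s\<^sup>\<star> * s). \<forall>\<epsilon>>0. \<exists>d\<in>D s. \<forall>x. cmod (f x - d x) \<le> \<epsilon>)" by (rule exE)
  then have D: "\<And>s. D s \<subseteq> ideal_at \<theta> X (s\<^sup>\<star> * s)" "\<And>s. countable (D s)"
    "\<And>s f \<epsilon>. f \<in> ideal_at \<theta> X (s\<^sup>\<star> * s) \<Longrightarrow> \<epsilon> > 0 \<Longrightarrow> \<exists>d\<in>D s. \<forall>x. cmod (f x - d x) \<le> \<epsilon>"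
    by simp_all
  define mk where "mk l s = (case map_of l s of None \<Rightarrow> (\<lambda>_. 0) | Some a \<Rightarrow> a)"
    for l :: "('s \<times> ('x \<Rightarrow> complex)) list" and s
  let ?L = "lists (SIGMA s:supp_sg. D s)"
  have "countable ?L" using D(2) ctb by (intro countable_lists countable_SIGMA) auto
  have mk_mem: "mk l \<in> sa_carrier (KS_alg \<theta> X)" if l: "l \<in> ?L" for l
    unfolding KS_carrier_iff
  proof (intro conjI allI)
    have "sg_supp (mk l) \<subseteq> fst ` set l"
      by (auto simp: sg_supp_def mk_def map_of_eq_None_iff split: option.splits)
    then show "finite (sg_supp (mk l))" by (rule finite_subset) simp
    show "mk l s \<in> ideal_at \<theta> X (s\<^sup>\<star> * s)" for s
    proof (cases "map_of l s")
      case None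
      then show ?thesis by (simp add: mk_def ideal_at_def C0_zero)
    next
      case (Some a)
      then have "(s, a) \<in> set l" by (rule map_of_SomeD)
      then have "(s, a) \<in> (SIGMA s:supp_sg. D s)" using l by (auto simp: in_lists_conv_set)
      then show ?thesis using Some D(1)[of s] by (auto simp: mk_def)
    qed
  qed
  show "\<exists>D\<subseteq>sa_carrier (KS_alg \<theta> X). countable D \<and>
    (\<forall>T\<in>sa_carrier (KS_alg \<theta> X). \<forall>\<epsilon>>0. \<exists>R\<in>D. p (sa_diff (KS_alg \<theta> X) T R) < \<epsilon>)"
  proof (intro exI[of _ "mk ` ?L"] conjI ballI allI impI)
    show "mk ` ?L \<subseteq> sa_carrier (KS_alg \<theta> X)" using mk_mem by (rule image_subsetI)
    show "countable (mk ` ?L)" using \<open>countable ?L\<close> by simp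
    fix T and \<epsilon> :: real assume T: "T \<in> sa_carrier (KS_alg \<theta> X)" and \<epsilon>: "\<epsilon> > 0"
    let ?F = "sg_supp T"
    have F: "finite ?F" and Ts: "\<And>s. T s \<in> ideal_at \<theta> X (s\<^sup>\<star> * s)" using T by (auto simp: KS_carrier_iff)
    define \<delta> where "\<delta> = \<epsilon> / (1 + real (card ?F))"
    have \<delta>: "\<delta> > 0" using \<epsilon> by (simp add: \<delta>_def)
    have "\<forall>s\<in>UNIV. \<exists>a. a \<in> D s \<and> (\<forall>x. cmod (T s x - a x) \<le> \<delta>)"
      using D(3)[OF Ts \<delta>] by blast
    from bchoice[OF this] obtain a where "\<forall>s\<in>UNIV. a s \<in> D s \<and> (\<forall>x. cmod (T s x - a s x) \<le> \<delta>)" by (rule exE)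
    then have a: "\<And>s. a s \<in> D s" "\<And>s x. cmod (T s x - a s x) \<le> \<delta>" by simp_all
    obtain ss where ss: "set ss = ?F" using finite_list[OF F] by (rule exE)
    let ?l = "map (\<lambda>s. (s, a s)) ss"
    have "s \<in> supp_sg" if "s \<in> ?F" for s
    proof -
      obtain x where "T s x \<noteq> 0" using \<open>s \<in> ?F\<close> by (auto simp: sg_supp_def)
      then have "x \<in> topspace (subtopology X (fixdom \<theta> (s\<^sup>\<star> * s)))"
        using C0_D(3) Ts[of s] unfolding ideal_at_def by metis
      then show ?thesis by auto
    qed
    then have l: "?l \<in> ?L" using a(1) ss by auto
    have mk: "mk ?l s = (if s \<in> ?F then a s else (\<lambda>_. 0))" for s
      by (simp add: mk_def map_of_map_restrict ss restrict_map_def)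
    have "p (sa_diff (KS_alg \<theta> X) T (mk ?l)) \<le> (\<Sum>s\<in>?F. \<delta>)"
    proof (rule KS_seminorm_le_sum[OF p_add upper])
      show "sa_diff (KS_alg \<theta> X) T (mk ?l) \<in> sa_carrier (KS_alg \<theta> X)"
        by (rule sfa.diff_mem[OF T mk_mem[OF l]])
      show "sg_supp (sa_diff (KS_alg \<theta> X) T (mk ?l)) \<subseteq> ?F"
        by (auto simp: sg_supp_def KS_diff mk split: if_splits)
      show "cmod (sa_diff (KS_alg \<theta> X) T (mk ?l) s x) \<le> \<delta>" if "s \<in> ?F" for s x
        using that a(2) by (simp add: KS_diff mk)
    qed (use F in auto)
    also have "\<dots> < \<epsilon>" using \<epsilon> by (simp add: \<delta>_def field_simps)
    finally show "\<exists>R\<in>mk ` ?L. p (sa_diff (KS_alg \<theta> X) T R) < \<epsilon>" using l by blast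
  qed
qed

text \<open>Choosing functions \<open>a\<^sub>s\<close> that take the value \<open>1\<close> at some point, the elements \<open>\<delta>\<^sub>s a\<^sub>s\<close> are at mutual distance at
  least \<open>1\<close>, so a countable dense set allows only countably many of them.  If \<open>R\<close> is close to \<open>\<delta>\<^sub>e f\<close> for a bump function \<open>f\<close>, then
  the upper sum of \<open>R\<close> at \<open>e\<close> is uniformly close to \<open>f\<close>; hence the sets where the upper sums of the
  members of a dense set exceed \<open>1/2\<close> form a base of \<open>X\<^sub>e\<close>.\<close>

lemma countable_if_separable:
  assumes "separable_algebra (hausdorff_completion (KS_alg \<theta> X) p)"
  shows "second_countable X" "countable supp_sg"
proof -
  obtain D where D: "D \<subseteq> sa_carrier (KS_alg \<theta> X)" "countable D"
    and dense: "\<And>T \<epsilon>. T \<in> sa_carrier (KS_alg \<theta> X) \<Longrightarrow> \<epsilon> > 0 \<Longrightarrow>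
      \<exists>R. R \<in> D \<and> p (sa_diff (KS_alg \<theta> X) T R) < \<epsilon>"
    using assms unfolding sfa.separable_completion_iff by metis
  have "\<forall>s\<in>supp_sg. \<exists>y. fst y \<in> fixdom \<theta> (s\<^sup>\<star> * s) \<and> snd y \<in> ideal_at \<theta> X (s\<^sup>\<star> * s) \<and> snd y (fst y) = 1"
  proof
    fix s assume "s \<in> supp_sg"
    then obtain x where x: "x \<in> fixdom \<theta> (s\<^sup>\<star> * s)" by blast
    have "openin (subtopology X (fixdom \<theta> (s\<^sup>\<star> * s))) (fixdom \<theta> (s\<^sup>\<star> * s))"
      by (simp add: openin_open_subtopology action_openin_fixdom[OF act idem_inv_mult])
    from fixdom_bump[OF idem_inv_mult this x]
    obtain f where "f \<in> ideal_at \<theta> X (s\<^sup>\<star> * s)" "f x = 1" by blast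
    then show "\<exists>y. fst y \<in> fixdom \<theta> (s\<^sup>\<star> * s) \<and> snd y \<in> ideal_at \<theta> X (s\<^sup>\<star> * s) \<and> snd y (fst y) = 1"
      using x by (intro exI[of _ "(x, f)"]) simp
  qed
  from bchoice[OF this] obtain y where "\<forall>s\<in>supp_sg. fst (y s) \<in> fixdom \<theta> (s\<^sup>\<star> * s) \<and>
      snd (y s) \<in> ideal_at \<theta> X (s\<^sup>\<star> * s) \<and> snd (y s) (fst (y s)) = 1" by (rule exE)
  then have y: "fst (y s) \<in> fixdom \<theta> (s\<^sup>\<star> * s)" "snd (y s) \<in> ideal_at \<theta> X (s\<^sup>\<star> * s)"
      "snd (y s) (fst (y s)) = 1" if "s \<in> supp_sg" for s
    using that by simp_all
  define T where "T s = delta s (snd (y s))" for s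
  have T: "T s \<in> sa_carrier (KS_alg \<theta> X)" if "s \<in> supp_sg" for s
    unfolding T_def by (rule KS_delta_mem[OF y(2)[OF that]])
  \<comment> \<open>\<open>s \<le> t\<close> and \<open>t \<le> s\<close> cannot both hold for \<open>s \<noteq> t\<close>, so one of the two upper sums sees only
    one of the two elements.\<close>
  have sep1: "1 \<le> p (sa_diff (KS_alg \<theta> X) (T s) (T t))"
    if s: "s \<in> supp_sg" and t: "t \<in> supp_sg" and "\<not> nat_le s t" for s t
  proof -
    have "finite (sg_supp (T s))" "finite (sg_supp (T t))" using T[OF s] T[OF t] by (auto simp: KS_carrier_iff)
    then have "upper_sum (sa_diff (KS_alg \<theta> X) (T s) (T t)) s (fst (y s)) = 1"
      using that(3) y(3)[OF s] by (simp add: KS_diff upper_sum_diff) (simp add: T_def upper_sum_delta)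
    then show ?thesis using lower[OF sfa.diff_mem[OF T[OF s] T[OF t]] y(1)[OF s]] by simp
  qed
  have sep: "1 \<le> p (sa_diff (KS_alg \<theta> X) (T s) (T t))"
    if s: "s \<in> supp_sg" and t: "t \<in> supp_sg" and "s \<noteq> t" for s t
  proof (cases "nat_le s t")
    case True
    then have "\<not> nat_le t s" using nat_le_antisym that(3) by blast
    then show ?thesis using sep1[OF t s] sfa.d_sym[OF T[OF s] T[OF t]] by (simp add: sfa.d_def)
  qed (rule sep1[OF s t])
  have "\<forall>s\<in>supp_sg. \<exists>R. R \<in> D \<and> p (sa_diff (KS_alg \<theta> X) (T s) R) < 1 / 2"
  proof
    show "\<exists>R. R \<in> D \<and> p (sa_diff (KS_alg \<theta> X) (T s) R) < 1 / 2" if "s \<in> supp_sg" for s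
      by (rule dense[OF T[OF that]]) simp
  qed
  from bchoice[OF this] obtain R where
    "\<forall>s\<in>supp_sg. R s \<in> D \<and> p (sa_diff (KS_alg \<theta> X) (T s) (R s)) < 1 / 2" by (rule exE)
  then have R: "R s \<in> D" "sfa.d (T s) (R s) < 1 / 2" if "s \<in> supp_sg" for s
    using that by (simp_all add: sfa.d_def)
  have "inj_on R supp_sg"
  proof (rule inj_onI, rule ccontr)
    fix s t assume st: "s \<in> supp_sg" "t \<in> supp_sg" "R s = R t" "s \<noteq> t"
    have RV: "R t \<in> sa_carrier (KS_alg \<theta> X)" using R(1)[OF st(2)] D(1) by blast
    have "sfa.d (T s) (T t) \<le> sfa.d (T s) (R t) + sfa.d (R t) (T t)"
      by (rule sfa.d_tri[OF T[OF st(1)] RV T[OF st(2)]])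
    also have "sfa.d (R t) (T t) = sfa.d (T t) (R t)" by (rule sfa.d_sym[OF RV T[OF st(2)]])
    also have "sfa.d (T s) (R t) + sfa.d (T t) (R t) < 1"
      using R(2)[OF st(1)] R(2)[OF st(2)] unfolding st(3) by linarith
    finally show False using sep[OF st(1,2,4)] by (simp add: sfa.d_def)
  qed
  moreover have "countable (R ` supp_sg)"
    using R(1) by (intro countable_subset[OF _ D(2)]) auto
  ultimately show ctb: "countable supp_sg" using countable_image_inj_on by blast

  show "second_countable X"
  proof (rule second_countable_if_fixdoms[OF act ctb])
    fix e :: 's assume e: "e \<in> idems"
    have ee: "e\<^sup>\<star> * e = e" using e by (simp add: idem_inv idemD)
    let ?Y = "subtopology X (fixdom \<theta> e)"
    have topY: "topspace ?Y = fixdom \<theta> e" by (rule topspace_fixdom[OF act e])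
    have cont: "continuous_map ?Y euclidean (upper_sum R e)" if R: "R \<in> sa_carrier (KS_alg \<theta> X)" for R
    proof -
      have "continuous_map ?Y euclidean (\<lambda>x. \<Sum>t\<in>{t \<in> sg_supp R. nat_le e t}. R t x)"
      proof (rule continuous_map_sum)
        show "finite {t \<in> sg_supp R. nat_le e t}" using R by (simp add: KS_carrier_iff)
        fix t assume "t \<in> {t \<in> sg_supp R. nat_le e t}"
        then have te: "t * e = e" using idemD[OF e] by (simp add: nat_le_def idem_inv[OF e] mult.assoc)
        have "fixdom \<theta> e \<subseteq> fixdom \<theta> (t\<^sup>\<star> * t)"
        proof
          fix x assume "x \<in> fixdom \<theta> e"
          then have "\<theta> e x = Some x" by (simp add: fixdom_def)
          then have "\<theta> t x = Some x" using action_mult[OF act, of t e x] te by simp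
          then show "x \<in> fixdom \<theta> (t\<^sup>\<star> * t)" using action_defined_iff[OF act, of t x] by blast
        qed
        moreover have "continuous_map (subtopology X (fixdom \<theta> (t\<^sup>\<star> * t))) euclidean (R t)"
          using R C0_D(1) by (auto simp: KS_carrier_iff ideal_at_def)
        ultimately show "continuous_map ?Y euclidean (R t)"
          using continuous_map_from_subtopology_mono by blast
      qed
      then show ?thesis by (simp add: upper_sum_def[abs_def])
    qed
    define base where "base R = {x \<in> topspace ?Y. upper_sum R e x \<in> {z. 1 / 2 < cmod z}}" for R
    have "countable_base ?Y (base ` D)"
      unfolding countable_base_def
    proof (intro conjI ballI allI impI)
      show "countable (base ` D)" using D(2) by simp
      have "open {z::complex. 1 / 2 < cmod z}" by (intro open_Collect_less continuous_intros)
      then have "openin ?Y (base R)" if "R \<in> D" for R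
        unfolding base_def using that D(1) by (intro openin_continuous_map_preimage[OF cont]) auto
      then show "openin ?Y V" if "V \<in> base ` D" for V using that by blast
      fix U x assume "openin ?Y U \<and> x \<in> U"
      then have U: "openin ?Y U" "x \<in> U" by auto
      obtain f where f: "f \<in> ideal_at \<theta> X e" "f x = 1" "\<And>y. y \<notin> U \<Longrightarrow> f y = 0"
        using fixdom_bump[OF e U] by blast
      have fV: "delta e f \<in> sa_carrier (KS_alg \<theta> X)" by (rule KS_delta_mem) (simp add: ee f(1))
      obtain R where R: "R \<in> D" "p (sa_diff (KS_alg \<theta> X) (delta e f) R) < 1 / 4"
        using dense[OF fV, of "1 / 4"] by auto
      have RV: "R \<in> sa_carrier (KS_alg \<theta> X)" using R(1) D(1) by blast
      have close: "cmod (f y - upper_sum R e y) < 1 / 4" if "y \<in> fixdom \<theta> e" for y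
      proof -
        have "upper_sum (sa_diff (KS_alg \<theta> X) (delta e f) R) e y = f y - upper_sum R e y"
          using fV RV by (simp add: KS_diff upper_sum_diff KS_carrier_iff upper_sum_delta)
        then show ?thesis
          using lower[OF sfa.diff_mem[OF fV RV], of y e] that R(2) by (simp add: ee)
      qed
      have Y: "x \<in> fixdom \<theta> e" using openin_subset[OF U(1)] U(2) topY by blast
      have "1 / 2 < cmod (upper_sum R e x)"
        using close[OF Y] norm_triangle_ineq2[of "f x" "upper_sum R e x"] f(2) by simp
      then have "x \<in> base R" using Y topY by (simp add: base_def del: topspace_subtopology)
      moreover have "base R \<subseteq> U"
      proof
        fix z assume "z \<in> base R"
        then have z: "z \<in> fixdom \<theta> e" "1 / 2 < cmod (upper_sum R e z)"
          using topY by (auto simp: base_def simp del: topspace_subtopology)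
        show "z \<in> U"
        proof (rule ccontr)
          assume "z \<notin> U"
          then show False using close[OF z(1)] f(3)[of z] z(2) by simp
        qed
      qed
      ultimately show "\<exists>V\<in>base ` D. x \<in> V \<and> V \<subseteq> U" using R(1) by blast
    qed
    then show "second_countable ?Y" by (auto simp: second_countable_iff_countable_base)
  qed
qed

text \<open>Two inequalities make the argument work for both norms: the seminorm is at most the
  supremum norm on each \<open>\<delta>\<^sub>s C\<^sub>0(X\<^bsub>s\<^sup>\<star>s\<^esub>)\<close>, and at least the supremum norm of each upper sum.\<close>

theorem separable_KS_completion_iff:
  "separable_algebra (hausdorff_completion (KS_alg \<theta> X) p) \<longleftrightarrow>
    second_countable X \<and> countable {s. fixdom \<theta> (s\<^sup>\<star> * s) \<noteq> {}}"
  using separable_if_countable countable_if_separable by blast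

end


section \<open>The regular representation over a point\<close>

lemma alpha_star: "alpha \<theta> (t\<^sup>\<star>) a x = (case \<theta> t x of None \<Rightarrow> 0 | Some y \<Rightarrow> a y)"
  by (simp add: alpha_def)

lemma alpha_sum: "alpha \<theta> s (\<lambda>x. \<Sum>i\<in>I. g i x) y = (\<Sum>i\<in>I. alpha \<theta> s (g i) y)"
  by (simp add: alpha_def split: option.split)

text \<open>The restriction of \<open>T\<close> to the fibre of the modules \<open>l\<^sup>2(S\<^sub>e, A\<^sub>e)\<close> at \<open>x\<close>: the basis vector \<open>t\<close> is
  sent by \<open>\<delta>\<^sub>s a\<close> to \<open>a(\<theta>\<^sub>t(x))\<close> times the basis vector \<open>st\<close> if \<open>s\<^sup>\<star>st = t\<close>, and to zero otherwise.  The formula reads off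
  the coefficient at \<open>r = st\<close>, where necessarily \<open>t = s\<^sup>\<star>r\<close>.\<close>

definition reg :: "('s::inverse_semigroup \<Rightarrow> 'x \<Rightarrow> 'x option) \<Rightarrow> 'x \<Rightarrow> ('s \<Rightarrow> 'x \<Rightarrow> complex) \<Rightarrow>
    ('s \<Rightarrow> complex) \<Rightarrow> 's \<Rightarrow> complex"
  where "reg \<theta> x T f r = (\<Sum>s\<in>sg_supp T.
    if s * (s\<^sup>\<star> * r) = r then alpha \<theta> ((s\<^sup>\<star> * r)\<^sup>\<star>) (T s) x * f (s\<^sup>\<star> * r) else 0)"

lemma reg_eq:
  assumes "finite F" "sg_supp T \<subseteq> F"
  shows "reg \<theta> x T f r = (\<Sum>s\<in>F.
    if s * (s\<^sup>\<star> * r) = r then alpha \<theta> ((s\<^sup>\<star> * r)\<^sup>\<star>) (T s) x * f (s\<^sup>\<star> * r) else 0)"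
  unfolding reg_def
  by (rule sum.mono_neutral_left) (use assms in \<open>auto simp: sg_supp_def\<close>)

lemma reg_add:
  assumes "finite (sg_supp T)" "finite (sg_supp R)"
  shows "reg \<theta> x (\<lambda>s x. T s x + R s x) f r = reg \<theta> x T f r + reg \<theta> x R f r"
proof -
  let ?F = "sg_supp T \<union> sg_supp R"
  have F: "finite ?F" using assms by simp
  have "alpha \<theta> u (\<lambda>x. T s x + R s x) y = alpha \<theta> u (T s) y + alpha \<theta> u (R s) y" for u s y
    by (simp add: alpha_def split: option.split)
  then show ?thesis
    unfolding reg_eq[OF F sg_supp_add] reg_eq[OF F Un_upper1] reg_eq[OF F Un_upper2]
      sum.distrib[symmetric]
    by (intro sum.cong) (auto simp: algebra_simps)
qed

lemma reg_scale:
  assumes "finite (sg_supp T)"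
  shows "reg \<theta> x (\<lambda>s x. c * T s x) f r = c * reg \<theta> x T f r"
proof -
  have "alpha \<theta> u (\<lambda>x. c * T s x) y = c * alpha \<theta> u (T s) y" for u s y
    by (simp add: alpha_def split: option.split)
  then show ?thesis
    unfolding reg_eq[OF assms sg_supp_scale] reg_eq[OF assms order_refl] sum_distrib_left
    by (intro sum.cong) auto
qed

subsection \<open>Norm bounds\<close>

text \<open>Square summability with norm at most \<open>c\<close>, phrased by finite partial sums so that norm bounds
  come first and summability follows from them.\<close>

definition l2_le :: "('s \<Rightarrow> complex) \<Rightarrow> real \<Rightarrow> bool"
  where "l2_le f c \<longleftrightarrow> (\<forall>F. finite F \<longrightarrow> L2_set (\<lambda>t. cmod (f t)) F \<le> c)"

lemma l2_leD: "l2_le f c \<Longrightarrow> finite F \<Longrightarrow> L2_set (\<lambda>t. cmod (f t)) F \<le> c"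
  by (simp add: l2_le_def)

lemma l2_le_nonneg: "l2_le f c \<Longrightarrow> 0 \<le> c"
  using l2_leD[of f c "{}"] by simp

lemma l2_le_point: "l2_le f c \<Longrightarrow> cmod (f t) \<le> c"
  using l2_leD[of f c "{t}"] by simp

lemma l2_le_add:
  assumes "l2_le f c" "l2_le g d"
  shows "l2_le (\<lambda>t. f t + g t) (c + d)"
  unfolding l2_le_def
proof (intro allI impI)
  fix F :: "'a set" assume F: "finite F"
  have "L2_set (\<lambda>t. cmod (f t + g t)) F \<le> L2_set (\<lambda>t. cmod (f t) + cmod (g t)) F"
    by (rule L2_set_mono) (auto intro: norm_triangle_ineq)
  also have "\<dots> \<le> L2_set (\<lambda>t. cmod (f t)) F + L2_set (\<lambda>t. cmod (g t)) F"
    by (rule L2_set_triangle_ineq)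
  also have "\<dots> \<le> c + d" using assms F by (intro add_mono l2_leD)
  finally show "L2_set (\<lambda>t. cmod (f t + g t)) F \<le> c + d" .
qed

lemma l2_le_scale:
  assumes "l2_le f c"
  shows "l2_le (\<lambda>t. z * f t) (cmod z * c)"
  unfolding l2_le_def
proof (intro allI impI)
  fix F :: "'a set" assume F: "finite F"
  have "L2_set (\<lambda>t. cmod (z * f t)) F = cmod z * L2_set (\<lambda>t. cmod (f t)) F"
    by (simp add: norm_mult L2_set_right_distrib)
  also have "\<dots> \<le> cmod z * c" using l2_leD[OF assms F] by (rule mult_left_mono) simp
  finally show "L2_set (\<lambda>t. cmod (z * f t)) F \<le> cmod z * c" .
qed

lemma l2_le_sum:
  assumes "finite I" "\<And>i. i \<in> I \<Longrightarrow> l2_le (f i) (c i)"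
  shows "l2_le (\<lambda>t. \<Sum>i\<in>I. f i t) (sum c I)"
  using assms
proof (induction I)
  case empty
  then show ?case by (simp add: l2_le_def L2_set_def)
next
  case (insert i I)
  then show ?case using l2_le_add[of "f i" "c i" "\<lambda>t. \<Sum>i\<in>I. f i t" "sum c I"] by simp
qed

text \<open>Each \<open>\<delta>\<^sub>s a\<close> acts by a weighted partial injection \<open>t \<mapsto> st\<close>, with inverse \<open>r \<mapsto> s\<^sup>\<star>r\<close>.\<close>

lemma l2_le_weighted_shift:
  fixes s :: "'s::inverse_semigroup"
  assumes f: "l2_le f c" and w: "\<And>t. cmod (w t) \<le> M"
  shows "l2_le (\<lambda>r. if s * (s\<^sup>\<star> * r) = r then w r * f (s\<^sup>\<star> * r) else 0) (M * c)"
  unfolding l2_le_def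
proof (intro allI impI)
  fix F :: "'s set" assume F: "finite F"
  have M: "0 \<le> M" using w[of undefined] norm_ge_zero order_trans by blast
  let ?F = "{r \<in> F. s * (s\<^sup>\<star> * r) = r}" and ?g = "\<lambda>r. s\<^sup>\<star> * r"
  let ?h = "\<lambda>r. if s * (s\<^sup>\<star> * r) = r then w r * f (s\<^sup>\<star> * r) else 0"
  have "(\<Sum>r\<in>F. (cmod (?h r))\<^sup>2) = (\<Sum>r\<in>?F. (cmod (w r * f (s\<^sup>\<star> * r)))\<^sup>2)"
    by (rule sum.mono_neutral_cong_right) (use F in auto)
  also have "\<dots> \<le> (\<Sum>r\<in>?F. M\<^sup>2 * (cmod (f (s\<^sup>\<star> * r)))\<^sup>2)"
    by (rule sum_mono) (simp add: norm_mult power_mult_distrib mult_right_mono power_mono w)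
  also have "\<dots> = M\<^sup>2 * (\<Sum>r\<in>?F. (cmod (f (?g r)))\<^sup>2)" by (simp add: sum_distrib_left)
  also have "(\<Sum>r\<in>?F. (cmod (f (?g r)))\<^sup>2) = (\<Sum>t\<in>?g ` ?F. (cmod (f t))\<^sup>2)"
  proof -
    have "inj_on ?g ?F"
    proof (rule inj_onI)
      fix r r' assume "r \<in> ?F" "r' \<in> ?F" "?g r = ?g r'"
      then have "r = s * (s\<^sup>\<star> * r')" by simp
      then show "r = r'" using \<open>r' \<in> ?F\<close> by simp
    qed
    then show ?thesis by (simp add: sum.reindex)
  qed
  finally have "L2_set (\<lambda>r. cmod (?h r)) F \<le> sqrt (M\<^sup>2 * (\<Sum>t\<in>?g ` ?F. (cmod (f t))\<^sup>2))"
    unfolding L2_set_def by (rule real_sqrt_le_mono)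
  also have "\<dots> = M * L2_set (\<lambda>t. cmod (f t)) (?g ` ?F)"
    using M by (simp add: real_sqrt_mult L2_set_def)
  also have "\<dots> \<le> M * c"
    using F M by (intro mult_left_mono l2_leD[OF f]) auto
  finally show "L2_set (\<lambda>r. cmod (?h r)) F \<le> M * c" .
qed

lemma l2_le_reg:
  assumes f: "l2_le f c" and fin: "finite (sg_supp T)"
    and M: "\<And>s x. s \<in> sg_supp T \<Longrightarrow> cmod (T s x) \<le> M s" and M0: "\<And>s. 0 \<le> M s"
  shows "l2_le (reg \<theta> x T f) (sum M (sg_supp T) * c)"
proof -
  have "l2_le (\<lambda>r. \<Sum>s\<in>sg_supp T.
      if s * (s\<^sup>\<star> * r) = r then alpha \<theta> ((s\<^sup>\<star> * r)\<^sup>\<star>) (T s) x * f (s\<^sup>\<star> * r) else 0) (\<Sum>s\<in>sg_supp T. M s * c)"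
  proof (intro l2_le_sum fin l2_le_weighted_shift f)
    show "cmod (alpha \<theta> ((s\<^sup>\<star> * r)\<^sup>\<star>) (T s) x) \<le> M s" if "s \<in> sg_supp T" for s r
      using M[OF that] M0[of s] by (simp add: alpha_def split: option.split)
  qed
  then show ?thesis by (simp add: reg_def[abs_def] sum_distrib_right)
qed

subsection \<open>Finitely supported vectors\<close>

text \<open>On finitely supported vectors all sums are finite, and the operators of the regular
  representation preserve them; the operator norm can be computed there.\<close>

definition vec_supp :: "('s \<Rightarrow> complex) \<Rightarrow> 's set"
  where "vec_supp f = {t. f t \<noteq> 0}"

definition vec_norm :: "('s \<Rightarrow> complex) \<Rightarrow> real"
  where "vec_norm f = L2_set (\<lambda>t. cmod (f t)) (vec_supp f)"

definition vec_inner :: "('s \<Rightarrow> complex) \<Rightarrow> ('s \<Rightarrow> complex) \<Rightarrow> complex"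
  where "vec_inner f g = (\<Sum>t\<in>vec_supp f. f t * cnj (g t))"

lemma vec_norm_eq:
  assumes "finite F" "vec_supp f \<subseteq> F"
  shows "vec_norm f = L2_set (\<lambda>t. cmod (f t)) F"
  unfolding vec_norm_def L2_set_def
  by (intro arg_cong[of _ _ sqrt] sum.mono_neutral_left) (use assms in \<open>auto simp: vec_supp_def\<close>)

lemma vec_inner_eq:
  assumes "finite F" "vec_supp f \<subseteq> F"
  shows "vec_inner f g = (\<Sum>t\<in>F. f t * cnj (g t))"
  unfolding vec_inner_def
  by (intro sum.mono_neutral_left) (use assms in \<open>auto simp: vec_supp_def\<close>)

lemma vec_norm_nonneg: "0 \<le> vec_norm f"
  by (simp add: vec_norm_def)

lemma vec_norm_le: "l2_le f c \<Longrightarrow> finite (vec_supp f) \<Longrightarrow> vec_norm f \<le> c"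
  by (simp add: vec_norm_def l2_leD)

lemma l2_le_vec_norm:
  assumes "finite (vec_supp f)"
  shows "l2_le f (vec_norm f)"
  unfolding l2_le_def
proof (intro allI impI)
  fix F :: "'a set" assume F: "finite F"
  have "L2_set (\<lambda>t. cmod (f t)) F \<le> L2_set (\<lambda>t. cmod (f t)) (F \<union> vec_supp f)"
    unfolding L2_set_def by (intro real_sqrt_le_mono sum_mono2) (use F assms in auto)
  also have "\<dots> = vec_norm f" by (rule vec_norm_eq[symmetric]) (use F assms in auto)
  finally show "L2_set (\<lambda>t. cmod (f t)) F \<le> vec_norm f" .
qed

lemma vec_inner_self: "vec_inner f f = complex_of_real ((vec_norm f)\<^sup>2)"
  by (simp add: vec_inner_def vec_norm_def L2_set_def sum_nonneg complex_norm_square[symmetric])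

lemma vec_Cauchy_Schwarz:
  assumes "finite (vec_supp f)" "finite (vec_supp g)"
  shows "cmod (vec_inner f g) \<le> vec_norm f * vec_norm g"
proof -
  let ?F = "vec_supp f \<union> vec_supp g"
  have F: "finite ?F" using assms by simp
  have "cmod (vec_inner f g) \<le> (\<Sum>t\<in>?F. \<bar>cmod (f t)\<bar> * \<bar>cmod (g t)\<bar>)"
    unfolding vec_inner_eq[OF F Un_upper1] by (rule sum_norm_le) (simp add: norm_mult)
  also have "\<dots> \<le> vec_norm f * vec_norm g"
    unfolding vec_norm_eq[OF F Un_upper1] vec_norm_eq[OF F Un_upper2] by (rule L2_set_mult_ineq)
  finally show ?thesis .
qed

lemma vec_supp_reg: "vec_supp (reg \<theta> x T f) \<subseteq> (\<Union>s\<in>sg_supp T. (\<lambda>t. s * t) ` vec_supp f)"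
proof
  fix r assume "r \<in> vec_supp (reg \<theta> x T f)"
  then have "reg \<theta> x T f r \<noteq> 0" by (simp add: vec_supp_def)
  then obtain s where s: "s \<in> sg_supp T"
    "(if s * (s\<^sup>\<star> * r) = r then alpha \<theta> ((s\<^sup>\<star> * r)\<^sup>\<star>) (T s) x * f (s\<^sup>\<star> * r) else 0) \<noteq> 0"
    unfolding reg_def by (rule sum.not_neutral_contains_not_neutral)
  then have "r = s * (s\<^sup>\<star> * r)" "s\<^sup>\<star> * r \<in> vec_supp f" by (auto simp: vec_supp_def split: if_splits)
  then show "r \<in> (\<Union>s\<in>sg_supp T. (\<lambda>t. s * t) ` vec_supp f)" using s(1) by blast
qed

lemma finite_vec_supp_reg:
  "finite (sg_supp T) \<Longrightarrow> finite (vec_supp f) \<Longrightarrow> finite (vec_supp (reg \<theta> x T f))"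
  by (rule finite_subset[OF vec_supp_reg]) auto

subsection \<open>Multiplicativity and adjoints\<close>

text \<open>The range condition of the partial injection of \<open>st\<close> is that of the composite of those of \<open>s\<close> and \<open>t\<close>.\<close>

lemma mult_range_iff:
  fixes s t r :: "'s::inverse_semigroup"
  shows "(s * t) * ((s * t)\<^sup>\<star> * r) = r \<longleftrightarrow> s * (s\<^sup>\<star> * r) = r \<and> t * (t\<^sup>\<star> * (s\<^sup>\<star> * r)) = s\<^sup>\<star> * r"
proof
  assume "(s * t) * ((s * t)\<^sup>\<star> * r) = r"
  then have *: "s * (t * (t\<^sup>\<star> * (s\<^sup>\<star> * r))) = r" by (simp add: sg_inv_mult mult.assoc)
  have c: "(s\<^sup>\<star> * s) * (t * t\<^sup>\<star>) = (t * t\<^sup>\<star>) * (s\<^sup>\<star> * s)"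
    by (rule idem_commute[OF idem_inv_mult idem_mult_inv])
  have "s\<^sup>\<star> * r = ((s\<^sup>\<star> * s) * (t * t\<^sup>\<star>)) * (s\<^sup>\<star> * r)"
    by (subst (1) *[symmetric]) (simp add: mult.assoc)
  also have "\<dots> = t * (t\<^sup>\<star> * ((s\<^sup>\<star> * s * s\<^sup>\<star>) * r))" unfolding c by (simp add: mult.assoc)
  finally have 2: "t * (t\<^sup>\<star> * (s\<^sup>\<star> * r)) = s\<^sup>\<star> * r" by (simp add: sg_inv)
  then show "s * (s\<^sup>\<star> * r) = r \<and> t * (t\<^sup>\<star> * (s\<^sup>\<star> * r)) = s\<^sup>\<star> * r" using * by simp
qed (simp add: sg_inv_mult mult.assoc)

context
  fixes \<theta> :: "'s::inverse_semigroup \<Rightarrow> 'x \<Rightarrow> 'x option" and X :: "'x topology"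
  assumes act: "sg_action \<theta> X"
begin

lemma pi_term_eq: "pi_term \<theta> t a b x = alpha \<theta> (t\<^sup>\<star>) a x * b x"
proof (cases "\<theta> t x")
  case (Some y)
  then have "\<theta> (t\<^sup>\<star>) y = Some x" using action_inv_iff[OF act, of t x y] by simp
  then show ?thesis using Some by (simp add: pi_term_def alpha_def)
qed (simp add: pi_term_def alpha_def)

lemma alpha_pi_term:
  "alpha \<theta> (v\<^sup>\<star>) (pi_term \<theta> t a b) x = alpha \<theta> ((t * v)\<^sup>\<star>) a x * alpha \<theta> (v\<^sup>\<star>) b x"
  by (simp add: alpha_star pi_term_eq action_mult[OF act] split: option.split)

lemma sg_supp_mult:
  "sg_supp (sa_mult (KS_alg \<theta> X) T R) \<subseteq> (\<lambda>(s, t). s * t) ` (sg_supp T \<times> sg_supp R)"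
proof
  fix u assume "u \<in> sg_supp (sa_mult (KS_alg \<theta> X) T R)"
  then obtain x where x: "sa_mult (KS_alg \<theta> X) T R u x \<noteq> 0" by (auto simp: sg_supp_def)
  have "{(s, t). s \<in> sg_supp T \<and> t \<in> sg_supp R \<and> s * t = u} \<noteq> {}"
  proof
    assume empty: "{(s, t). s \<in> sg_supp T \<and> t \<in> sg_supp R \<and> s * t = u} = {}"
    have "sa_mult (KS_alg \<theta> X) T R u x = 0" unfolding KS_alg_def by (simp only: star_algebra.simps empty sum.empty)
    then show False using x by simp
  qed
  then show "u \<in> (\<lambda>(s, t). s * t) ` (sg_supp T \<times> sg_supp R)" by force
qed

lemma reg_mult:
  assumes T: "finite (sg_supp T)" and R: "finite (sg_supp R)"
  shows "reg \<theta> x (sa_mult (KS_alg \<theta> X) T R) f = reg \<theta> x T (reg \<theta> x R f)"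
proof
  fix r
  let ?P = "sg_supp T \<times> sg_supp R" and ?m = "\<lambda>(s, t). s * t"
  have fin: "finite ?P" using T R by simp
  let ?h = "\<lambda>(s, t). if (s * t) * ((s * t)\<^sup>\<star> * r) = r
    then alpha \<theta> (((s * t)\<^sup>\<star> * r)\<^sup>\<star>) (pi_term \<theta> t (T s) (R t)) x * f ((s * t)\<^sup>\<star> * r) else 0"
  have fib: "{(s, t). s \<in> sg_supp T \<and> t \<in> sg_supp R \<and> s * t = u} = {q \<in> ?P. ?m q = u}" for u by auto
  have mult: "sa_mult (KS_alg \<theta> X) T R u = (\<lambda>y. \<Sum>q\<in>{q \<in> ?P. ?m q = u}. pi_term \<theta> (snd q) (T (fst q)) (R (snd q)) y)" for u
    by (intro ext) (simp add: KS_alg_def fib case_prod_beta)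
  have "reg \<theta> x (sa_mult (KS_alg \<theta> X) T R) f r = (\<Sum>u\<in>?m ` ?P. if u * (u\<^sup>\<star> * r) = r
      then alpha \<theta> ((u\<^sup>\<star> * r)\<^sup>\<star>) (sa_mult (KS_alg \<theta> X) T R u) x * f (u\<^sup>\<star> * r) else 0)"
    by (rule reg_eq[OF finite_imageI[OF fin] sg_supp_mult])
  also have "\<dots> = (\<Sum>u\<in>?m ` ?P. sum ?h {q \<in> ?P. ?m q = u})"
  proof (rule sum.cong[OF refl])
    fix u
    have "sum ?h {q \<in> ?P. ?m q = u} = (\<Sum>q\<in>{q \<in> ?P. ?m q = u}. if u * (u\<^sup>\<star> * r) = r
        then alpha \<theta> ((u\<^sup>\<star> * r)\<^sup>\<star>) (pi_term \<theta> (snd q) (T (fst q)) (R (snd q))) x * f (u\<^sup>\<star> * r) else 0)"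
      by (rule sum.cong[OF refl]) auto
    then show "(if u * (u\<^sup>\<star> * r) = r
      then alpha \<theta> ((u\<^sup>\<star> * r)\<^sup>\<star>) (sa_mult (KS_alg \<theta> X) T R u) x * f (u\<^sup>\<star> * r) else 0) = sum ?h {q \<in> ?P. ?m q = u}"
      unfolding mult by (simp add: alpha_sum sum_distrib_right)
  qed
  also have "\<dots> = sum ?h ?P"
    by (rule sum.group[OF fin finite_imageI[OF fin] order_refl])
  also have "\<dots> = (\<Sum>(s, t)\<in>?P. if s * (s\<^sup>\<star> * r) = r then alpha \<theta> ((s\<^sup>\<star> * r)\<^sup>\<star>) (T s) x *
      (if t * (t\<^sup>\<star> * (s\<^sup>\<star> * r)) = s\<^sup>\<star> * r
       then alpha \<theta> ((t\<^sup>\<star> * (s\<^sup>\<star> * r))\<^sup>\<star>) (R t) x * f (t\<^sup>\<star> * (s\<^sup>\<star> * r)) else 0) else 0)"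
  proof (rule sum.cong[OF refl], clarify)
    fix s t
    have v: "(s * t)\<^sup>\<star> * r = t\<^sup>\<star> * (s\<^sup>\<star> * r)" by (simp add: sg_inv_mult mult.assoc)
    show "(if (s * t) * ((s * t)\<^sup>\<star> * r) = r
      then alpha \<theta> (((s * t)\<^sup>\<star> * r)\<^sup>\<star>) (pi_term \<theta> t (T s) (R t)) x * f ((s * t)\<^sup>\<star> * r) else 0) =
      (if s * (s\<^sup>\<star> * r) = r then alpha \<theta> ((s\<^sup>\<star> * r)\<^sup>\<star>) (T s) x *
      (if t * (t\<^sup>\<star> * (s\<^sup>\<star> * r)) = s\<^sup>\<star> * r
       then alpha \<theta> ((t\<^sup>\<star> * (s\<^sup>\<star> * r))\<^sup>\<star>) (R t) x * f (t\<^sup>\<star> * (s\<^sup>\<star> * r)) else 0) else 0)"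
      unfolding mult_range_iff unfolding v alpha_pi_term by (auto simp: mult.assoc)
  qed
  also have "\<dots> = reg \<theta> x T (reg \<theta> x R f) r"
    unfolding reg_def sum.cartesian_product[symmetric]
    by (intro sum.cong refl) (simp add: sum_distrib_left)
  finally show "reg \<theta> x (sa_mult (KS_alg \<theta> X) T R) f r = reg \<theta> x T (reg \<theta> x R f) r" .
qed

lemma sg_supp_star: "sg_supp (sa_star (KS_alg \<theta> X) T) \<subseteq> sg_inv ` sg_supp T"
proof
  fix r assume "r \<in> sg_supp (sa_star (KS_alg \<theta> X) T)"
  then have "T (r\<^sup>\<star>) \<noteq> (\<lambda>_. 0)" by (auto simp: sg_supp_def KS_alg_def)
  then have "r\<^sup>\<star> \<in> sg_supp T" by (simp add: sg_supp_def)
  then show "r \<in> sg_inv ` sg_supp T" by (metis imageI sg_inv_inv)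
qed

lemma reg_star:
  assumes T: "finite (sg_supp T)"
  shows "reg \<theta> x (sa_star (KS_alg \<theta> X) T) g t = (\<Sum>s\<in>sg_supp T.
    if s\<^sup>\<star> * (s * t) = t then cnj (alpha \<theta> (t\<^sup>\<star>) (T s) x) * g (s * t) else 0)"
proof -
  have inj: "inj_on sg_inv (sg_supp T)" by (rule inj_on_inverseI[of _ sg_inv]) simp
  have "reg \<theta> x (sa_star (KS_alg \<theta> X) T) g t = (\<Sum>s\<in>sg_supp T.
    if s\<^sup>\<star> * (s * t) = t then alpha \<theta> ((s * t)\<^sup>\<star>) (sa_star (KS_alg \<theta> X) T (s\<^sup>\<star>)) x * g (s * t) else 0)"
    using reg_eq[OF finite_imageI[OF T] sg_supp_star, of \<theta> x g t]
    by (simp add: sum.reindex[OF inj] cong: if_cong)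
  also have "\<dots> = (\<Sum>s\<in>sg_supp T.
    if s\<^sup>\<star> * (s * t) = t then cnj (alpha \<theta> (t\<^sup>\<star>) (T s) x) * g (s * t) else 0)"
  proof (intro sum.cong[OF refl] if_cong refl)
    fix s assume st: "s\<^sup>\<star> * (s * t) = t"
    have "alpha \<theta> ((s * t)\<^sup>\<star>) (sa_star (KS_alg \<theta> X) T (s\<^sup>\<star>)) x =
        (case \<theta> (s * t) x of None \<Rightarrow> 0 | Some y \<Rightarrow> alpha \<theta> ((s\<^sup>\<star>)\<^sup>\<star>) (\<lambda>x. cnj (T s x)) y)"
      by (simp add: alpha_star[of \<theta> "s * t"] KS_alg_def cong: option.case_cong)
    also have "\<dots> = alpha \<theta> ((s\<^sup>\<star> * (s * t))\<^sup>\<star>) (\<lambda>x. cnj (T s x)) x"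
      unfolding alpha_star action_mult[OF act, of "s\<^sup>\<star>"] by (simp split: option.split)
    also have "\<dots> = cnj (alpha \<theta> (t\<^sup>\<star>) (T s) x)"
      unfolding st by (simp add: alpha_star split: option.split)
    finally show "alpha \<theta> ((s * t)\<^sup>\<star>) (sa_star (KS_alg \<theta> X) T (s\<^sup>\<star>)) x * g (s * t) =
      cnj (alpha \<theta> (t\<^sup>\<star>) (T s) x) * g (s * t)" by simp
  qed
  finally show ?thesis .
qed

lemma reg_adjoint:
  assumes T: "finite (sg_supp T)" and f: "finite (vec_supp f)" and g: "finite (vec_supp g)"
  shows "vec_inner (reg \<theta> x T f) g = vec_inner f (reg \<theta> x (sa_star (KS_alg \<theta> X) T) g)"
proof -
  define G where "G = vec_supp (reg \<theta> x T f) \<union> (\<Union>s\<in>sg_supp T. (\<lambda>t. s * t) ` vec_supp f)"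
  have G: "finite G" unfolding G_def using T f finite_vec_supp_reg[OF T f] by auto
  have "vec_inner (reg \<theta> x T f) g = (\<Sum>r\<in>G. reg \<theta> x T f r * cnj (g r))"
    by (rule vec_inner_eq[OF G]) (simp add: G_def)
  also have "\<dots> = (\<Sum>r\<in>G. \<Sum>s\<in>sg_supp T. if s * (s\<^sup>\<star> * r) = r
      then alpha \<theta> ((s\<^sup>\<star> * r)\<^sup>\<star>) (T s) x * f (s\<^sup>\<star> * r) * cnj (g r) else 0)"
    unfolding reg_def sum_distrib_right by (intro sum.cong) auto
  also have "\<dots> = (\<Sum>s\<in>sg_supp T. \<Sum>r\<in>G. if s * (s\<^sup>\<star> * r) = r
      then alpha \<theta> ((s\<^sup>\<star> * r)\<^sup>\<star>) (T s) x * f (s\<^sup>\<star> * r) * cnj (g r) else 0)"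
    by (rule sum.swap)
  also have "\<dots> = (\<Sum>s\<in>sg_supp T. \<Sum>t\<in>vec_supp f. if s\<^sup>\<star> * (s * t) = t
      then alpha \<theta> (t\<^sup>\<star>) (T s) x * f t * cnj (g (s * t)) else 0)"
  proof (rule sum.cong[OF refl])
    fix s assume s: "s \<in> sg_supp T"
    have "(\<Sum>r\<in>G. if s * (s\<^sup>\<star> * r) = r
      then alpha \<theta> ((s\<^sup>\<star> * r)\<^sup>\<star>) (T s) x * f (s\<^sup>\<star> * r) * cnj (g r) else 0) =
      (\<Sum>r\<in>{r \<in> G. s * (s\<^sup>\<star> * r) = r \<and> s\<^sup>\<star> * r \<in> vec_supp f}.
        alpha \<theta> ((s\<^sup>\<star> * r)\<^sup>\<star>) (T s) x * f (s\<^sup>\<star> * r) * cnj (g r))"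
      by (rule sum.mono_neutral_cong_right) (use G in \<open>auto simp: vec_supp_def\<close>)
    also have "\<dots> = (\<Sum>t\<in>{t \<in> vec_supp f. s\<^sup>\<star> * (s * t) = t}.
        alpha \<theta> (t\<^sup>\<star>) (T s) x * f t * cnj (g (s * t)))"
    proof (rule sum.reindex_bij_witness[where i = "\<lambda>t. s * t" and j = "\<lambda>r. s\<^sup>\<star> * r"])
      fix t assume t: "t \<in> {t \<in> vec_supp f. s\<^sup>\<star> * (s * t) = t}"
      then have "s * t \<in> G" unfolding G_def using s by blast
      then show "s * t \<in> {r \<in> G. s * (s\<^sup>\<star> * r) = r \<and> s\<^sup>\<star> * r \<in> vec_supp f}" using t by simp
    qed auto
    also have "\<dots> = (\<Sum>t\<in>vec_supp f. if s\<^sup>\<star> * (s * t) = t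
      then alpha \<theta> (t\<^sup>\<star>) (T s) x * f t * cnj (g (s * t)) else 0)"
      by (rule sum.mono_neutral_cong_left) (use f in auto)
    finally show "(\<Sum>r\<in>G. if s * (s\<^sup>\<star> * r) = r
      then alpha \<theta> ((s\<^sup>\<star> * r)\<^sup>\<star>) (T s) x * f (s\<^sup>\<star> * r) * cnj (g r) else 0) =
      (\<Sum>t\<in>vec_supp f. if s\<^sup>\<star> * (s * t) = t
      then alpha \<theta> (t\<^sup>\<star>) (T s) x * f t * cnj (g (s * t)) else 0)" .
  qed
  also have "\<dots> = (\<Sum>t\<in>vec_supp f. \<Sum>s\<in>sg_supp T. if s\<^sup>\<star> * (s * t) = t
      then alpha \<theta> (t\<^sup>\<star>) (T s) x * f t * cnj (g (s * t)) else 0)"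
    by (rule sum.swap)
  also have "\<dots> = vec_inner f (reg \<theta> x (sa_star (KS_alg \<theta> X) T) g)"
    unfolding vec_inner_def reg_star[OF T] cnj_sum sum_distrib_left
    by (intro sum.cong refl) auto
  finally show ?thesis .
qed

text \<open>A term \<open>t\<close> of \<open>T\<close> sends the basis vector \<open>s\<^sup>\<star>s\<close> to a multiple of the basis vector \<open>s\<close>
  exactly if \<open>s \<le> t\<close>.\<close>

lemma reg_indicator:
  assumes T: "finite (sg_supp T)" and x: "x \<in> fixdom \<theta> (s\<^sup>\<star> * s)"
  shows "reg \<theta> x T (\<lambda>t. if t = s\<^sup>\<star> * s then 1 else 0) s = upper_sum T s x"
proof -
  let ?e = "s\<^sup>\<star> * s"
  have "alpha \<theta> (?e\<^sup>\<star>) a x = a x" for a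
    using x by (simp add: alpha_star fixdom_def)
  then have "reg \<theta> x T (\<lambda>t. if t = ?e then 1 else 0) s = (\<Sum>t\<in>sg_supp T. if nat_le s t then T t x else 0)"
    unfolding reg_def nat_le_iff_left_mult by (intro sum.cong refl) (auto simp: mult.assoc)
  also have "\<dots> = upper_sum T s x"
    unfolding upper_sum_def by (rule sum.inter_filter[OF T, symmetric])
  finally show ?thesis .
qed

end


section \<open>The full crossed product\<close>

lemma cstar_seminorm_zero: "cstar_seminorm A (\<lambda>_. 0)"
  by (simp add: cstar_seminorm_def)

context
  fixes \<theta> :: "'s::inverse_semigroup \<Rightarrow> 'x \<Rightarrow> 'x option" and X :: "'x topology"
  assumes act: "sg_action \<theta> X"
begin

subsection \<open>A C*-seminorm from the regular representation\<close>

definition reg_bound :: "'x \<Rightarrow> ('s \<Rightarrow> 'x \<Rightarrow> complex) \<Rightarrow> real \<Rightarrow> bool"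
  where "reg_bound x T c \<longleftrightarrow> 0 \<le> c \<and>
    (\<forall>f. finite (vec_supp f) \<longrightarrow> vec_norm (reg \<theta> x T f) \<le> c * vec_norm f)"

definition reg_norm :: "'x \<Rightarrow> ('s \<Rightarrow> 'x \<Rightarrow> complex) \<Rightarrow> real"
  where "reg_norm x T = Inf {c. reg_bound x T c}"

text \<open>The infimum of all operator bounds is itself one, so inequalities between norms can be
  proved by exhibiting bounds.\<close>

lemma reg_norm_le: "reg_bound x T c \<Longrightarrow> reg_norm x T \<le> c"
  unfolding reg_norm_def by (rule cInf_lower) (auto simp: reg_bound_def intro: bdd_belowI[of _ 0])

lemma reg_bound_reg_norm:
  assumes "reg_bound x T c"
  shows "reg_bound x T (reg_norm x T)"
  unfolding reg_bound_def
proof (intro conjI allI impI)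
  have ne: "{c. reg_bound x T c} \<noteq> {}" using assms by blast
  show "0 \<le> reg_norm x T"
    unfolding reg_norm_def by (rule cInf_greatest[OF ne]) (simp add: reg_bound_def)
  fix f :: "'s \<Rightarrow> complex" assume f: "finite (vec_supp f)"
  show "vec_norm (reg \<theta> x T f) \<le> reg_norm x T * vec_norm f"
  proof (cases "vec_norm f = 0")
    case True
    have "vec_norm (reg \<theta> x T f) \<le> c * vec_norm f" using assms f unfolding reg_bound_def by blast
    then show ?thesis using True by simp
  next
    case False
    then have pos: "vec_norm f > 0" using vec_norm_nonneg[of f] by linarith
    have "vec_norm (reg \<theta> x T f) / vec_norm f \<le> reg_norm x T"
      unfolding reg_norm_def
      by (rule cInf_greatest[OF ne]) (use f pos in \<open>auto simp: reg_bound_def pos_divide_le_eq\<close>)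
    then show ?thesis using pos by (simp add: pos_divide_le_eq)
  qed
qed

lemma reg_bound_exists:
  assumes T: "T \<in> sa_carrier (KS_alg \<theta> X)"
  shows "\<exists>c. reg_bound x T c"
proof -
  obtain M where M: "\<And>s. 0 < M s" "\<And>s x. cmod (T s x) \<le> M s"
    using KS_carrier_bounded[OF T] by metis
  have fin: "finite (sg_supp T)" using T by (simp add: KS_carrier_iff)
  have "reg_bound x T (sum M (sg_supp T))"
    unfolding reg_bound_def
  proof (intro conjI allI impI)
    show "0 \<le> sum M (sg_supp T)" by (intro sum_nonneg less_imp_le M(1))
    fix f :: "'s \<Rightarrow> complex" assume f: "finite (vec_supp f)"
    show "vec_norm (reg \<theta> x T f) \<le> sum M (sg_supp T) * vec_norm f"
      by (rule vec_norm_le[OF l2_le_reg[OF l2_le_vec_norm[OF f] fin]])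
        (simp_all add: M less_imp_le finite_vec_supp_reg fin f)
  qed
  then show ?thesis by (rule exI)
qed

lemma reg_bound_carrier: "T \<in> sa_carrier (KS_alg \<theta> X) \<Longrightarrow> reg_bound x T (reg_norm x T)"
  using reg_bound_exists[of T x] reg_bound_reg_norm[of x T] by blast

lemma reg_norm_nonneg: "T \<in> sa_carrier (KS_alg \<theta> X) \<Longrightarrow> 0 \<le> reg_norm x T"
  using reg_bound_carrier[of T x] by (simp add: reg_bound_def)

lemma vec_norm_reg_le:
  "T \<in> sa_carrier (KS_alg \<theta> X) \<Longrightarrow> finite (vec_supp f) \<Longrightarrow>
    vec_norm (reg \<theta> x T f) \<le> reg_norm x T * vec_norm f"
  using reg_bound_carrier[of T x] by (simp add: reg_bound_def)

lemma reg_bound_add: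
  assumes T: "T \<in> sa_carrier (KS_alg \<theta> X)" and R: "R \<in> sa_carrier (KS_alg \<theta> X)"
  shows "reg_bound x (sa_add (KS_alg \<theta> X) T R) (reg_norm x T + reg_norm x R)"
  unfolding reg_bound_def
proof (intro conjI allI impI)
  show "0 \<le> reg_norm x T + reg_norm x R" using reg_norm_nonneg T R by (simp add: add_nonneg_nonneg)
  fix f :: "'s \<Rightarrow> complex" assume f: "finite (vec_supp f)"
  have fin: "finite (sg_supp T)" "finite (sg_supp R)" using T R by (auto simp: KS_carrier_iff)
  have eq: "reg \<theta> x (sa_add (KS_alg \<theta> X) T R) f = (\<lambda>r. reg \<theta> x T f r + reg \<theta> x R f r)"
    by (intro ext) (simp add: KS_alg_simps reg_add fin)
  have "vec_norm (reg \<theta> x (sa_add (KS_alg \<theta> X) T R) f) \<le> vec_norm (reg \<theta> x T f) + vec_norm (reg \<theta> x R f)"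
  proof (rule vec_norm_le)
    show "l2_le (reg \<theta> x (sa_add (KS_alg \<theta> X) T R) f) (vec_norm (reg \<theta> x T f) + vec_norm (reg \<theta> x R f))"
      unfolding eq by (intro l2_le_add l2_le_vec_norm finite_vec_supp_reg fin f)
    show "finite (vec_supp (reg \<theta> x (sa_add (KS_alg \<theta> X) T R) f))"
      using KS_add_mem[OF T R] by (intro finite_vec_supp_reg f) (simp add: KS_carrier_iff)
  qed
  also have "\<dots> \<le> (reg_norm x T + reg_norm x R) * vec_norm f"
    using vec_norm_reg_le[OF T f, of x] vec_norm_reg_le[OF R f, of x] by (simp add: distrib_right)
  finally show "vec_norm (reg \<theta> x (sa_add (KS_alg \<theta> X) T R) f) \<le> (reg_norm x T + reg_norm x R) * vec_norm f" .
qed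

lemma reg_bound_scale:
  assumes T: "T \<in> sa_carrier (KS_alg \<theta> X)"
  shows "reg_bound x (sa_scale (KS_alg \<theta> X) c T) (cmod c * reg_norm x T)"
  unfolding reg_bound_def
proof (intro conjI allI impI)
  show "0 \<le> cmod c * reg_norm x T" using reg_norm_nonneg[OF T] by simp
  fix f :: "'s \<Rightarrow> complex" assume f: "finite (vec_supp f)"
  have fin: "finite (sg_supp T)" using T by (auto simp: KS_carrier_iff)
  have eq: "reg \<theta> x (sa_scale (KS_alg \<theta> X) c T) f = (\<lambda>r. c * reg \<theta> x T f r)"
    by (intro ext) (simp add: KS_alg_simps reg_scale fin)
  have "vec_norm (reg \<theta> x (sa_scale (KS_alg \<theta> X) c T) f) \<le> cmod c * vec_norm (reg \<theta> x T f)"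
  proof (rule vec_norm_le)
    show "l2_le (reg \<theta> x (sa_scale (KS_alg \<theta> X) c T) f) (cmod c * vec_norm (reg \<theta> x T f))"
      unfolding eq by (intro l2_le_scale l2_le_vec_norm finite_vec_supp_reg fin f)
    show "finite (vec_supp (reg \<theta> x (sa_scale (KS_alg \<theta> X) c T) f))"
      using KS_scale_mem[OF T] by (intro finite_vec_supp_reg f) (simp add: KS_carrier_iff)
  qed
  also have "\<dots> \<le> cmod c * reg_norm x T * vec_norm f"
    using mult_left_mono[OF vec_norm_reg_le[OF T f, of x], of "cmod c"] by (simp add: mult.assoc)
  finally show "vec_norm (reg \<theta> x (sa_scale (KS_alg \<theta> X) c T) f) \<le> cmod c * reg_norm x T * vec_norm f" .
qed

text \<open>The adjoint identity gives \<open>\<parallel>T\<^sup>*g\<parallel>\<^sup>2 = \<langle>TT\<^sup>*g, g\<rangle>\<close> and \<open>\<parallel>Tf\<parallel>\<^sup>2 = \<langle>f, T\<^sup>*Tf\<rangle>\<close>;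
  by the Cauchy-Schwarz inequality \<open>\<parallel>T\<^sup>*\<parallel> \<le> \<parallel>T\<parallel>\<close> and \<open>\<parallel>T\<parallel>\<^sup>2 \<le> \<parallel>T\<^sup>*T\<parallel>\<close>.\<close>

lemma reg_bound_star:
  assumes T: "T \<in> sa_carrier (KS_alg \<theta> X)"
  shows "reg_bound x (sa_star (KS_alg \<theta> X) T) (reg_norm x T)"
  unfolding reg_bound_def
proof (intro conjI allI impI)
  show "0 \<le> reg_norm x T" by (rule reg_norm_nonneg[OF T])
  fix g :: "'s \<Rightarrow> complex" assume g: "finite (vec_supp g)"
  have fin: "finite (sg_supp T)" using T by (simp add: KS_carrier_iff)
  define f where "f = reg \<theta> x (sa_star (KS_alg \<theta> X) T) g"
  have f: "finite (vec_supp f)"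
    unfolding f_def by (intro finite_vec_supp_reg g finite_subset[OF sg_supp_star[OF act]] finite_imageI fin)
  have "(vec_norm f)\<^sup>2 = cmod (vec_inner f f)"
    by (simp only: vec_inner_self norm_of_real) simp
  also have "vec_inner f f = vec_inner (reg \<theta> x T f) g"
    unfolding reg_adjoint[OF act fin f g] by (simp add: f_def)
  also have "cmod (vec_inner (reg \<theta> x T f) g) \<le> vec_norm (reg \<theta> x T f) * vec_norm g"
    by (intro vec_Cauchy_Schwarz finite_vec_supp_reg fin f g)
  also have "\<dots> \<le> (reg_norm x T * vec_norm f) * vec_norm g"
    by (intro mult_right_mono vec_norm_reg_le T f vec_norm_nonneg)
  finally have "vec_norm f * vec_norm f \<le> vec_norm f * (reg_norm x T * vec_norm g)"
    by (simp add: power2_eq_square mult_ac)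
  then have "vec_norm f \<le> reg_norm x T * vec_norm g"
    using vec_norm_nonneg[of f] vec_norm_nonneg[of g] reg_norm_nonneg[OF T, of x]
    by (cases "vec_norm f = 0") auto
  then show "vec_norm (reg \<theta> x (sa_star (KS_alg \<theta> X) T) g) \<le> reg_norm x T * vec_norm g"
    by (simp add: f_def)
qed

lemma reg_bound_mult:
  assumes T: "reg_bound x T c" "finite (sg_supp T)" and R: "reg_bound x R d" "finite (sg_supp R)"
  shows "reg_bound x (sa_mult (KS_alg \<theta> X) T R) (c * d)"
  unfolding reg_bound_def
proof (intro conjI allI impI)
  show "0 \<le> c * d" using T(1) R(1) by (simp add: reg_bound_def)
  fix f :: "'s \<Rightarrow> complex" assume f: "finite (vec_supp f)"
  have "vec_norm (reg \<theta> x T (reg \<theta> x R f)) \<le> c * vec_norm (reg \<theta> x R f)"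
    using T(1) finite_vec_supp_reg[OF R(2) f] by (simp add: reg_bound_def)
  also have "\<dots> \<le> c * (d * vec_norm f)"
    using T(1) R(1) f by (intro mult_left_mono) (simp_all add: reg_bound_def)
  finally show "vec_norm (reg \<theta> x (sa_mult (KS_alg \<theta> X) T R) f) \<le> c * d * vec_norm f"
    by (simp add: reg_mult[OF act T(2) R(2)] mult.assoc)
qed

lemma cstar_seminorm_reg_norm: "cstar_seminorm (KS_alg \<theta> X) (reg_norm x)"
  unfolding cstar_seminorm_def
proof (intro conjI ballI allI)
  fix T assume T: "T \<in> sa_carrier (KS_alg \<theta> X)"
  have fin: "finite (sg_supp T)" using T by (simp add: KS_carrier_iff)
  note bT = reg_bound_carrier[OF T, of x]
  show "0 \<le> reg_norm x T" by (rule reg_norm_nonneg[OF T])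
  show "reg_norm x (sa_scale (KS_alg \<theta> X) c T) = cmod c * reg_norm x T" for c
    by (rule scale_equality_from_inequality[OF reg_norm_le[OF reg_bound_scale] reg_norm_nonneg T])
  show "reg_norm x (sa_add (KS_alg \<theta> X) T R) \<le> reg_norm x T + reg_norm x R"
    if "R \<in> sa_carrier (KS_alg \<theta> X)" for R
    by (rule reg_norm_le[OF reg_bound_add[OF T that]])
  show "reg_norm x (sa_mult (KS_alg \<theta> X) T R) \<le> reg_norm x T * reg_norm x R"
    if R: "R \<in> sa_carrier (KS_alg \<theta> X)" for R
  proof -
    have "finite (sg_supp R)" using R by (simp add: KS_carrier_iff)
    then show ?thesis by (intro reg_norm_le reg_bound_mult bT fin reg_bound_carrier R)
  qed
  let ?S = "sa_star (KS_alg \<theta> X) T"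
  let ?P = "sa_mult (KS_alg \<theta> X) ?S T"
  have finS: "finite (sg_supp ?S)"
    by (intro finite_subset[OF sg_supp_star[OF act]] finite_imageI fin)
  have bP: "reg_bound x ?P (reg_norm x T * reg_norm x T)"
    by (rule reg_bound_mult[OF reg_bound_star[OF T] finS bT fin])
  have P: "reg_bound x ?P (reg_norm x ?P)" by (rule reg_bound_reg_norm[OF bP])
  have "reg_bound x T (sqrt (reg_norm x ?P))"
    unfolding reg_bound_def
  proof (intro conjI allI impI)
    show "0 \<le> sqrt (reg_norm x ?P)" using P by (simp add: reg_bound_def)
    fix f :: "'s \<Rightarrow> complex" assume f: "finite (vec_supp f)"
    have Tf: "finite (vec_supp (reg \<theta> x T f))" by (rule finite_vec_supp_reg[OF fin f])
    have "(vec_norm (reg \<theta> x T f))\<^sup>2 = cmod (vec_inner (reg \<theta> x T f) (reg \<theta> x T f))"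
      by (simp only: vec_inner_self norm_of_real) simp
    also have "\<dots> = cmod (vec_inner f (reg \<theta> x ?P f))"
      by (simp add: reg_adjoint[OF act fin f Tf] reg_mult[OF act finS fin])
    also have "\<dots> \<le> vec_norm f * vec_norm (reg \<theta> x ?P f)"
      unfolding reg_mult[OF act finS fin] by (intro vec_Cauchy_Schwarz f finite_vec_supp_reg finS fin)
    also have "\<dots> \<le> vec_norm f * (reg_norm x ?P * vec_norm f)"
      using P f by (intro mult_left_mono vec_norm_nonneg) (simp add: reg_bound_def)
    finally have "(vec_norm (reg \<theta> x T f))\<^sup>2 \<le> reg_norm x ?P * (vec_norm f)\<^sup>2"
      by (simp add: power2_eq_square mult_ac)
    then have "sqrt ((vec_norm (reg \<theta> x T f))\<^sup>2) \<le> sqrt (reg_norm x ?P * (vec_norm f)\<^sup>2)"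
      by (rule real_sqrt_le_mono)
    then show "vec_norm (reg \<theta> x T f) \<le> sqrt (reg_norm x ?P) * vec_norm f"
      by (simp add: real_sqrt_mult vec_norm_nonneg)
  qed
  then have "reg_norm x T \<le> sqrt (reg_norm x ?P)" by (rule reg_norm_le)
  then have "(reg_norm x T)\<^sup>2 \<le> (sqrt (reg_norm x ?P))\<^sup>2"
    by (rule power_mono) (rule reg_norm_nonneg[OF T])
  also have "\<dots> = reg_norm x ?P" using P by (simp add: reg_bound_def)
  finally show "reg_norm x ?P = (reg_norm x T)\<^sup>2"
    using reg_norm_le[OF bP] by (simp add: power2_eq_square)
qed

lemma upper_sum_le_reg_norm:
  assumes T: "T \<in> sa_carrier (KS_alg \<theta> X)" and x: "x \<in> fixdom \<theta> (s\<^sup>\<star> * s)"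
  shows "cmod (upper_sum T s x) \<le> reg_norm x T"
proof -
  let ?f = "\<lambda>t. if t = s\<^sup>\<star> * s then 1 else 0 :: complex"
  have supp: "vec_supp ?f = {s\<^sup>\<star> * s}" by (auto simp: vec_supp_def)
  have fin: "finite (sg_supp T)" using T by (simp add: KS_carrier_iff)
  have f: "finite (vec_supp ?f)" by (simp add: supp)
  have "vec_norm ?f = 1" by (simp add: vec_norm_def supp)
  then have "vec_norm (reg \<theta> x T ?f) \<le> reg_norm x T" using vec_norm_reg_le[OF T f, of x] by simp
  moreover have "cmod (reg \<theta> x T ?f s) \<le> vec_norm (reg \<theta> x T ?f)"
    by (intro l2_le_point l2_le_vec_norm finite_vec_supp_reg fin f)
  ultimately show ?thesis by (simp add: reg_indicator[OF act fin x])
qed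

subsection \<open>Upper bounds for C*-seminorms\<close>

lemma ideal_at_outside: "a \<in> ideal_at \<theta> X e \<Longrightarrow> x \<notin> fixdom \<theta> e \<Longrightarrow> a x = 0"
  unfolding ideal_at_def using C0_D(3) by fastforce

lemma delta_star_mult_delta:
  assumes a: "a \<in> ideal_at \<theta> X (s\<^sup>\<star> * s)"
  shows "sa_mult (KS_alg \<theta> X) (sa_star (KS_alg \<theta> X) (delta s a)) (delta s a) =
    delta (s\<^sup>\<star> * s) (\<lambda>x. cnj (a x) * a x)"
proof -
  have "pi_term \<theta> s (alpha \<theta> s (\<lambda>x. cnj (a x))) a x = cnj (a x) * a x" for x
  proof (cases "\<theta> s x")
    case None
    then have "a x = 0" using ideal_at_outside[OF a] action_defined_iff[OF act, of s x] by simp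
    then show ?thesis by (simp add: pi_term_eq[OF act])
  next
    case (Some y)
    then have "\<theta> (s\<^sup>\<star>) y = Some x" using action_inv_iff[OF act] by simp
    then show ?thesis using Some by (simp add: pi_term_eq[OF act] alpha_def)
  qed
  then have "pi_term \<theta> s (alpha \<theta> s (\<lambda>x. cnj (a x))) a = (\<lambda>x. cnj (a x) * a x)" by (rule ext)
  then show ?thesis by (simp add: KS_alg_star_delta KS_alg_mult_delta)
qed

context
  fixes p assumes p: "cstar_seminorm (KS_alg \<theta> X) p"
begin

lemma cstar_delta_norm:
  assumes a: "a \<in> ideal_at \<theta> X (s\<^sup>\<star> * s)"
  shows "(p (delta s a))\<^sup>2 = p (delta (s\<^sup>\<star> * s) (\<lambda>x. cnj (a x) * a x))"
  using p KS_delta_mem[OF a] unfolding cstar_seminorm_def by (simp flip: delta_star_mult_delta[OF a])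

lemma cstar_delta_add:
  assumes "a \<in> ideal_at \<theta> X (s\<^sup>\<star> * s)" "b \<in> ideal_at \<theta> X (s\<^sup>\<star> * s)"
  shows "p (delta s (\<lambda>x. a x + b x)) \<le> p (delta s a) + p (delta s b)"
proof -
  have "delta s (\<lambda>x. a x + b x) = sa_add (KS_alg \<theta> X) (delta s a) (delta s b)"
    by (auto simp: KS_alg_simps delta_def fun_eq_iff)
  then show ?thesis using p assms KS_delta_mem unfolding cstar_seminorm_def by metis
qed

lemma cstar_delta_scale:
  assumes "a \<in> ideal_at \<theta> X (s\<^sup>\<star> * s)"
  shows "p (delta s (\<lambda>x. c * a x)) = cmod c * p (delta s a)"
proof -
  have "delta s (\<lambda>x. c * a x) = sa_scale (KS_alg \<theta> X) c (delta s a)"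
    by (auto simp: KS_alg_simps delta_def fun_eq_iff)
  then show ?thesis using p assms KS_delta_mem unfolding cstar_seminorm_def by metis
qed

text \<open>A real function \<open>b\<close> with \<open>\<bar>b\<bar> \<le> 1\<close> is the mean of \<open>u = b + i\<surd>(1 - b\<^sup>2)\<close> and its conjugate.
  Both have modulus \<open>1\<close>, so multiplying \<open>a\<close> by either leaves \<open>\<bar>a\<bar>\<^sup>2\<close>, and hence \<open>p\<close>, unchanged.\<close>

lemma cstar_delta_mult_real:
  assumes e: "e \<in> idems" and b: "(\<lambda>x. complex_of_real (b x)) \<in> ideal_at \<theta> X e" "\<And>x. \<bar>b x\<bar> \<le> 1"
    and a: "a \<in> ideal_at \<theta> X e"
  shows "p (delta e (\<lambda>x. complex_of_real (b x) * a x)) \<le> p (delta e a)"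
proof -
  have ee: "e\<^sup>\<star> * e = e" using e by (simp add: idem_inv idemD)
  define u where "u x = complex_of_real (b x) + \<i> * complex_of_real (sqrt (1 - (b x)\<^sup>2))" for x
  have b2: "(b x)\<^sup>2 \<le> 1" for x using b(2)[of x] by (simp add: abs_square_le_1)
  have unit: "cmod (u x) = 1" for x
    using b2[of x] by (simp add: u_def cmod_def)
  have contu: "continuous_map (subtopology X (fixdom \<theta> e)) euclidean u"
  proof -
    have "continuous_map (subtopology X (fixdom \<theta> e)) euclidean (\<lambda>x. complex_of_real (b x))"
      using b(1) unfolding ideal_at_def by (rule C0_D(1))
    moreover have "continuous_map euclidean euclidean (\<lambda>z::complex. z + \<i> * complex_of_real (sqrt (1 - (Re z)\<^sup>2)))"
      by (simp only: continuous_map_iff_continuous2) (intro continuous_intros)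
    ultimately have "continuous_map (subtopology X (fixdom \<theta> e)) euclidean
        ((\<lambda>z::complex. z + \<i> * complex_of_real (sqrt (1 - (Re z)\<^sup>2))) \<circ> (\<lambda>x. complex_of_real (b x)))"
      by (rule continuous_map_compose)
    then show ?thesis by (simp add: o_def u_def[abs_def])
  qed
  have contc: "continuous_map (subtopology X (fixdom \<theta> e)) euclidean (\<lambda>x. cnj (u x))"
  proof -
    have "continuous_map euclidean euclidean cnj"
      by (simp add: continuous_on_cnj continuous_on_id)
    from continuous_map_compose[OF contu this] show ?thesis by (simp add: o_def)
  qed
  have iso: "p (delta e (\<lambda>x. v x * a x)) = p (delta e a)" "(\<lambda>x. v x * a x) \<in> ideal_at \<theta> X e"
    if v: "continuous_map (subtopology X (fixdom \<theta> e)) euclidean v" "\<And>x. cmod (v x) = 1" for v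
  proof -
    show va: "(\<lambda>x. v x * a x) \<in> ideal_at \<theta> X e"
      using C0_mult_bounded[OF a[unfolded ideal_at_def] v(1), of 1] v(2) by (simp add: ideal_at_def)
    have "cnj (v x * a x) * (v x * a x) = cnj (a x) * a x" for x
    proof -
      have "cnj (v x) * v x = 1"
        using complex_norm_square[of "v x"] v(2)[of x] by (simp add: mult.commute)
      moreover have "cnj (v x * a x) * (v x * a x) = (cnj (v x) * v x) * (cnj (a x) * a x)"
        by (simp add: mult_ac)
      ultimately show ?thesis by simp
    qed
    then have sq: "(\<lambda>x. cnj (v x * a x) * (v x * a x)) = (\<lambda>x. cnj (a x) * a x)" by (rule ext)
    have "(p (delta e (\<lambda>x. v x * a x)))\<^sup>2 = p (delta e (\<lambda>x. cnj (v x * a x) * (v x * a x)))"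
      using cstar_delta_norm[of "\<lambda>x. v x * a x" e] va by (simp only: ee)
    also have "\<dots> = (p (delta e a))\<^sup>2"
      using cstar_delta_norm[of a e] a by (simp only: ee sq)
    finally have "(p (delta e (\<lambda>x. v x * a x)))\<^sup>2 = (p (delta e a))\<^sup>2" .
    moreover have "0 \<le> p (delta e (\<lambda>x. v x * a x))" "0 \<le> p (delta e a)"
      using p KS_delta_mem[of _ \<theta> X e] va a unfolding cstar_seminorm_def ee by blast+
    ultimately show "p (delta e (\<lambda>x. v x * a x)) = p (delta e a)"
      by (simp add: power2_eq_iff_nonneg)
  qed
  note i1 = iso[of u, OF contu unit]
  have i2: "p (delta e (\<lambda>x. cnj (u x) * a x)) = p (delta e a)" "(\<lambda>x. cnj (u x) * a x) \<in> ideal_at \<theta> X e"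
    by (rule iso[OF contc], simp add: unit)+
  have half: "(\<lambda>x. (1/2) * (v x * a x)) \<in> ideal_at \<theta> X e" if "(\<lambda>x. v x * a x) \<in> ideal_at \<theta> X e" for v
    using that unfolding ideal_at_def by (rule C0_scale)
  have "(\<lambda>x. complex_of_real (b x) * a x) = (\<lambda>x. (1/2) * (u x * a x) + (1/2) * (cnj (u x) * a x))"
    by (simp add: u_def fun_eq_iff field_simps)
  then have "p (delta e (\<lambda>x. complex_of_real (b x) * a x)) \<le>
      p (delta e (\<lambda>x. (1/2) * (u x * a x))) + p (delta e (\<lambda>x. (1/2) * (cnj (u x) * a x)))"
    using cstar_delta_add[of "\<lambda>x. (1/2) * (u x * a x)" e "\<lambda>x. (1/2) * (cnj (u x) * a x)"]
      half[OF i1(2)] half[OF i2(2)] by (simp only: ee)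
  also have "\<dots> = p (delta e a)"
    using cstar_delta_scale[of "\<lambda>x. u x * a x" e "1/2"] cstar_delta_scale[of "\<lambda>x. cnj (u x) * a x" e "1/2"]
      i1 i2 by (simp only: ee) (simp add: norm_divide)
  finally show ?thesis .
qed

text \<open>For such \<open>b\<close>, taking \<open>a = b\<close> gives \<open>p(b)\<^sup>2 = p(b\<^sup>2) \<le> p(b)\<close>.\<close>

lemma cstar_delta_real_le_1:
  assumes e: "e \<in> idems" and b: "(\<lambda>x. complex_of_real (b x)) \<in> ideal_at \<theta> X e" "\<And>x. \<bar>b x\<bar> \<le> 1"
  shows "p (delta e (\<lambda>x. complex_of_real (b x))) \<le> 1"
proof -
  have ee: "e\<^sup>\<star> * e = e" using e by (simp add: idem_inv idemD)
  let ?q = "p (delta e (\<lambda>x. complex_of_real (b x)))"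
  have "?q\<^sup>2 = p (delta e (\<lambda>x. complex_of_real (b x) * complex_of_real (b x)))"
    using cstar_delta_norm[of "\<lambda>x. complex_of_real (b x)" e] b(1) by (simp add: ee)
  also have "\<dots> \<le> ?q" by (rule cstar_delta_mult_real[OF e b b(1)])
  finally have "?q * ?q \<le> ?q" by (simp add: power2_eq_square)
  show ?thesis
  proof (rule ccontr)
    assume "\<not> ?q \<le> 1"
    then have "1 * ?q < ?q * ?q" by (intro mult_strict_right_mono) auto
    then show False using \<open>?q * ?q \<le> ?q\<close> by simp
  qed
qed

text \<open>The C*-identity reduces \<open>\<delta>\<^sub>s a\<close> to the real function \<open>\<bar>a\<bar>\<^sup>2/M\<^sup>2\<close> on the ideal of \<open>s\<^sup>\<star>s\<close>.\<close>

lemma cstar_delta_le: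
  assumes a: "a \<in> ideal_at \<theta> X (s\<^sup>\<star> * s)" and M: "\<And>x. cmod (a x) \<le> M"
  shows "p (delta s a) \<le> M"
proof (cases "M = 0")
  case True
  then have "a = (\<lambda>x. 0 * a x)" using M by (auto simp: fun_eq_iff)
  then have "p (delta s a) = 0" using cstar_delta_scale[OF a, of 0] by simp
  then show ?thesis using True by simp
next
  case False
  then have Mpos: "M > 0" using M[of undefined] norm_ge_zero[of "a undefined"] by linarith
  let ?e = "s\<^sup>\<star> * s"
  have ee: "?e\<^sup>\<star> * ?e = ?e" by (simp add: idem_inv[OF idem_inv_mult] idemD[OF idem_inv_mult])
  define b where "b x = (cmod (a x))\<^sup>2 / M\<^sup>2" for x
  have aa: "(\<lambda>x. cnj (a x) * a x) \<in> ideal_at \<theta> X ?e"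
    using C0_mult_bounded[of a "subtopology X (fixdom \<theta> ?e)" "\<lambda>x. cnj (a x)" M]
      C0_D(1)[OF C0_cnj[OF a[unfolded ideal_at_def]]] a M by (simp add: ideal_at_def)
  have eq: "(\<lambda>x. cnj (a x) * a x) = (\<lambda>x. complex_of_real (M\<^sup>2) * complex_of_real (b x))"
  proof
    fix x
    have "cnj (a x) * a x = complex_of_real ((cmod (a x))\<^sup>2)"
      using complex_norm_square[of "a x"] by (simp add: mult.commute)
    then show "cnj (a x) * a x = complex_of_real (M\<^sup>2) * complex_of_real (b x)"
      using Mpos by (simp add: b_def)
  qed
  have beq: "(\<lambda>x. complex_of_real (b x)) = (\<lambda>x. complex_of_real (1 / M\<^sup>2) * (cnj (a x) * a x))"
    unfolding fun_cong[OF eq] using Mpos by (auto simp: fun_eq_iff)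
  have b: "(\<lambda>x. complex_of_real (b x)) \<in> ideal_at \<theta> X ?e"
    unfolding beq using aa unfolding ideal_at_def by (rule C0_scale)
  have b1: "\<bar>b x\<bar> \<le> 1" for x
    using M[of x] Mpos by (simp add: b_def power_mono)
  have "(p (delta s a))\<^sup>2 = M\<^sup>2 * p (delta ?e (\<lambda>x. complex_of_real (b x)))"
    unfolding cstar_delta_norm[OF a] eq
    using cstar_delta_scale[of "\<lambda>x. complex_of_real (b x)" ?e "complex_of_real (M\<^sup>2)"] b ee
    by (simp add: norm_power)
  also have "\<dots> \<le> M\<^sup>2 * 1"
    by (intro mult_left_mono cstar_delta_real_le_1 idem_inv_mult b b1) simp
  finally have "(p (delta s a))\<^sup>2 \<le> M\<^sup>2" by simp
  then show ?thesis by (rule power2_le_imp_le) (use Mpos in simp)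
qed

end

lemma cstar_seminorm_le_enveloping_norm:
  assumes "cstar_seminorm (KS_alg \<theta> X) p" and T: "T \<in> sa_carrier (KS_alg \<theta> X)"
  shows "p T \<le> enveloping_norm (KS_alg \<theta> X) T"
  unfolding enveloping_norm_def
proof (rule cSup_upper)
  show "p T \<in> {p T | p. cstar_seminorm (KS_alg \<theta> X) p}" using assms(1) by (intro CollectI exI[of _ p] conjI refl)
  obtain M where M: "\<And>s x. cmod (T s x) \<le> M s" using KS_carrier_bounded[OF T] by metis
  show "bdd_above {p T | p. cstar_seminorm (KS_alg \<theta> X) p}"
  proof (rule bdd_aboveI, clarify)
    fix p assume p: "cstar_seminorm (KS_alg \<theta> X) p"
    show "p T \<le> sum M (sg_supp T)"
    proof (rule KS_seminorm_le_sum[of \<theta> X p T "sg_supp T" M])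
      show "p (sa_add (KS_alg \<theta> X) T R) \<le> p T + p R"
        if "T \<in> sa_carrier (KS_alg \<theta> X)" "R \<in> sa_carrier (KS_alg \<theta> X)" for T R
        using p that by (simp add: cstar_seminorm_def)
      show "p (delta s a) \<le> M'"
        if "a \<in> ideal_at \<theta> X (s\<^sup>\<star> * s)" "\<And>x. cmod (a x) \<le> M'" for s a M'
        using cstar_delta_le[OF p that] .
    qed (use T M in \<open>simp_all add: KS_carrier_iff\<close>)
  qed
qed

lemma enveloping_norm_le:
  assumes "\<And>p. cstar_seminorm (KS_alg \<theta> X) p \<Longrightarrow> p T \<le> c"
  shows "enveloping_norm (KS_alg \<theta> X) T \<le> c"
  unfolding enveloping_norm_def
proof (rule cSup_least)
  show "{p T | p. cstar_seminorm (KS_alg \<theta> X) p} \<noteq> {}"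
  proof -
    have "0 \<in> {p T | p. cstar_seminorm (KS_alg \<theta> X) p}"
      by (intro CollectI exI[of _ "\<lambda>_. 0"] conjI refl cstar_seminorm_zero)
    then show ?thesis by (metis empty_iff)
  qed
  show "y \<le> c" if "y \<in> {p T | p. cstar_seminorm (KS_alg \<theta> X) p}" for y
    using that by (elim CollectE exE conjE) (simp only: assms)
qed

theorem separable_full_KS_crossed_product_iff:
  assumes lc: "locally_compact_space X" and H: "Hausdorff_space X"
  shows "separable_algebra (full_KS_crossed_product \<theta> X) \<longleftrightarrow>
    second_countable X \<and> countable {s. fixdom \<theta> (s\<^sup>\<star> * s) \<noteq> {}}"
  unfolding full_KS_crossed_product_def enveloping_cstar_algebra_def
proof (rule separable_KS_completion_iff[OF act lc H])
  let ?q = "enveloping_norm (KS_alg \<theta> X)"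
  note le = cstar_seminorm_le_enveloping_norm
  show nonneg: "0 \<le> ?q T" if "T \<in> sa_carrier (KS_alg \<theta> X)" for T
    using le[OF cstar_seminorm_zero that] .
  show "?q (sa_scale (KS_alg \<theta> X) c T) = cmod c * ?q T" if "T \<in> sa_carrier (KS_alg \<theta> X)" for T c
  proof (rule scale_equality_from_inequality[OF _ nonneg that])
    fix T c assume T: "T \<in> sa_carrier (KS_alg \<theta> X)"
    show "?q (sa_scale (KS_alg \<theta> X) c T) \<le> cmod c * ?q T"
    proof (rule enveloping_norm_le)
      fix p assume p: "cstar_seminorm (KS_alg \<theta> X) p"
      then have "p (sa_scale (KS_alg \<theta> X) c T) = cmod c * p T" using T by (simp add: cstar_seminorm_def)
      also have "\<dots> \<le> cmod c * ?q T" by (intro mult_left_mono le p T) simp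
      finally show "p (sa_scale (KS_alg \<theta> X) c T) \<le> cmod c * ?q T" .
    qed
  qed
  show "?q (sa_add (KS_alg \<theta> X) T R) \<le> ?q T + ?q R"
    if T: "T \<in> sa_carrier (KS_alg \<theta> X)" and R: "R \<in> sa_carrier (KS_alg \<theta> X)" for T R
  proof (rule enveloping_norm_le)
    fix p assume p: "cstar_seminorm (KS_alg \<theta> X) p"
    then have "p (sa_add (KS_alg \<theta> X) T R) \<le> p T + p R" using T R by (simp add: cstar_seminorm_def)
    also have "\<dots> \<le> ?q T + ?q R" by (intro add_mono le p T R)
    finally show "p (sa_add (KS_alg \<theta> X) T R) \<le> ?q T + ?q R" .
  qed
  show "?q (delta s a) \<le> M" if "a \<in> ideal_at \<theta> X (s\<^sup>\<star> * s)" "\<And>x. cmod (a x) \<le> M" for s a M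
    by (rule enveloping_norm_le) (rule cstar_delta_le[OF _ that])
  show "cmod (upper_sum T s x) \<le> ?q T"
    if "T \<in> sa_carrier (KS_alg \<theta> X)" "x \<in> fixdom \<theta> (s\<^sup>\<star> * s)" for T s x
    using upper_sum_le_reg_norm[OF that] le[OF cstar_seminorm_reg_norm that(1), of x] by linarith
qed

end


section \<open>The reduced crossed product\<close>

lemma l2_le_restrict:
  assumes "l2_le f c"
  shows "l2_le (\<lambda>t. if t \<in> S then f t else 0) c"
  unfolding l2_le_def
proof (intro allI impI)
  fix F :: "'a set" assume F: "finite F"
  have "L2_set (\<lambda>t. cmod (if t \<in> S then f t else 0)) F \<le> L2_set (\<lambda>t. cmod (f t)) F"
    by (rule L2_set_mono) auto
  also have "\<dots> \<le> c" by (rule l2_leD[OF assms F])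
  finally show "L2_set (\<lambda>t. cmod (if t \<in> S then f t else 0)) F \<le> c" .
qed

lemma cnj_mult_self: "cnj z * z = complex_of_real ((cmod z)\<^sup>2)"
  using complex_norm_square[of z] by (simp add: mult.commute)

lemma l2_le_iff_sum_le:
  assumes "0 \<le> c"
  shows "l2_le (\<lambda>t. if t \<in> S then f t else 0) c \<longleftrightarrow>
    (\<forall>F. finite F \<and> F \<subseteq> S \<longrightarrow> (\<Sum>t\<in>F. (cmod (f t))\<^sup>2) \<le> c\<^sup>2)" (is "?L \<longleftrightarrow> ?R")
proof
  assume L: ?L
  show ?R
  proof (intro allI impI, elim conjE)
    fix F assume F: "finite F" "F \<subseteq> S"
    have eq: "(\<Sum>t\<in>F. (cmod (f t))\<^sup>2) = (\<Sum>t\<in>F. (cmod (if t \<in> S then f t else 0))\<^sup>2)"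
      by (rule sum.cong) (use F in auto)
    have "sqrt (\<Sum>t\<in>F. (cmod (f t))\<^sup>2) \<le> c"
      using l2_leD[OF L F(1)] unfolding L2_set_def eq .
    then have "(sqrt (\<Sum>t\<in>F. (cmod (f t))\<^sup>2))\<^sup>2 \<le> c\<^sup>2"
      by (rule power_mono) (simp add: sum_nonneg)
    then show "(\<Sum>t\<in>F. (cmod (f t))\<^sup>2) \<le> c\<^sup>2" by (simp add: sum_nonneg)
  qed
next
  assume R: ?R
  show ?L
    unfolding l2_le_def
  proof (intro allI impI)
    fix F :: "'a set" assume F: "finite F"
    have "(\<Sum>t\<in>F. (cmod (if t \<in> S then f t else 0))\<^sup>2) = (\<Sum>t\<in>F \<inter> S. (cmod (f t))\<^sup>2)"
      by (rule sum.mono_neutral_cong_right) (use F in auto)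
    also have "\<dots> \<le> c\<^sup>2" using R F by simp
    finally have "sqrt (\<Sum>t\<in>F. (cmod (if t \<in> S then f t else 0))\<^sup>2) \<le> sqrt (c\<^sup>2)"
      by (rule real_sqrt_le_mono)
    then show "L2_set (\<lambda>t. cmod (if t \<in> S then f t else 0)) F \<le> c"
      using assms by (simp add: L2_set_def)
  qed
qed

lemma l2_inner_self_bounds:
  assumes l2: "l2_le (\<lambda>t. if t \<in> source_fiber e then \<eta> t x else 0) c"
  shows "cmod (l2_inner e \<eta> \<eta> x) \<le> c\<^sup>2"
    and "l2_le (\<lambda>t. if t \<in> source_fiber e then \<eta> t x else 0) (sqrt (cmod (l2_inner e \<eta> \<eta> x)))"
proof -
  have c: "0 \<le> c" by (rule l2_le_nonneg[OF l2])
  let ?S = "source_fiber e" and ?g = "\<lambda>t. (cmod (\<eta> t x))\<^sup>2"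
  have bd: "sum ?g F \<le> c\<^sup>2" if "finite F" "F \<subseteq> ?S" for F
    using l2 that unfolding l2_le_iff_sum_le[OF c] by blast
  have summ: "?g summable_on ?S"
    by (rule nonneg_bdd_above_summable_on) (auto intro!: bdd_aboveI[of _ "c\<^sup>2"] bd)
  have "((\<lambda>t. complex_of_real (?g t)) has_sum complex_of_real (infsum ?g ?S)) ?S"
    using has_sum_infsum[OF summ] unfolding has_sum_def by (auto dest: tendsto_of_real)
  then have inner: "l2_inner e \<eta> \<eta> x = complex_of_real (infsum ?g ?S)"
    unfolding l2_inner_def cnj_mult_self by (rule infsumI)
  have nonneg: "0 \<le> infsum ?g ?S" by (rule infsum_nonneg) simp
  then have norm: "cmod (l2_inner e \<eta> \<eta> x) = infsum ?g ?S" by (simp add: inner)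
  show "cmod (l2_inner e \<eta> \<eta> x) \<le> c\<^sup>2"
    unfolding norm by (rule infsum_le_finite_sums[OF summ bd])
  have "sum ?g F \<le> infsum ?g ?S" if "finite F" "F \<subseteq> ?S" for F
    by (rule finite_sum_le_infsum[OF summ that]) simp
  then show "l2_le (\<lambda>t. if t \<in> ?S then \<eta> t x else 0) (sqrt (cmod (l2_inner e \<eta> \<eta> x)))"
    using l2_le_iff_sum_le[of "sqrt (infsum ?g ?S)" ?S "\<lambda>t. \<eta> t x"] nonneg by (simp add: norm)
qed

lemma l2_norm_le:
  assumes l2: "\<And>x. l2_le (\<lambda>t. if t \<in> source_fiber e then \<eta> t x else 0) c"
  shows "l2_norm e \<eta> \<le> c"
proof -
  have c: "0 \<le> c" by (rule l2_le_nonneg[OF l2])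
  have "sup_norm (l2_inner e \<eta> \<eta>) \<le> c\<^sup>2"
    unfolding sup_norm_def by (rule cSUP_least) (auto intro: l2_inner_self_bounds(1)[OF l2])
  then have "sqrt (sup_norm (l2_inner e \<eta> \<eta>)) \<le> sqrt (c\<^sup>2)" by (rule real_sqrt_le_mono)
  then show ?thesis using c by (simp add: l2_norm_def)
qed

lemma l2_le_l2_norm:
  assumes l2: "\<And>x. l2_le (\<lambda>t. if t \<in> source_fiber e then \<eta> t x else 0) c"
  shows "l2_le (\<lambda>t. if t \<in> source_fiber e then \<eta> t x else 0) (l2_norm e \<eta>)"
proof -
  have "cmod (l2_inner e \<eta> \<eta> x) \<le> sup_norm (l2_inner e \<eta> \<eta>)"
    unfolding sup_norm_def
    by (rule cSUP_upper) (auto intro!: bdd_aboveI[of _ "c\<^sup>2"] l2_inner_self_bounds(1)[OF l2])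
  then have le: "sqrt (cmod (l2_inner e \<eta> \<eta> x)) \<le> l2_norm e \<eta>"
    unfolding l2_norm_def by (rule real_sqrt_le_mono)
  show ?thesis
    using l2_inner_self_bounds(2)[where e = e and \<eta> = \<eta> and x = x, OF l2] le unfolding l2_le_def by (meson order_trans)
qed

text \<open>Evaluating a module element of norm at most \<open>1\<close> at a point yields a vector of norm at most \<open>1\<close>, to
  which the bounds for the regular representation over that point apply.\<close>

lemma l2_module_fibre_le:
  assumes \<xi>: "\<xi> \<in> l2_module \<theta> X e" and n: "l2_norm e \<xi> \<le> 1"
  shows "l2_le (\<lambda>t. \<xi> t x) 1"
proof -
  let ?S = "source_fiber e"
  obtain h where h: "h \<in> ideal_at \<theta> X e"
    "uniform_limit UNIV (\<lambda>F x. \<Sum>t\<in>F. cnj (\<xi> t x) * \<xi> t x) h (finite_subsets_at_top ?S)"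
    using \<xi> by (auto simp: l2_module_def)
  obtain M where M: "M > 0" "\<And>x. cmod (h x) \<le> M" using C0_bounded[of h] h(1) unfolding ideal_at_def by blast
  have out: "\<xi> t = (\<lambda>_. 0)" if "t \<notin> ?S" for t using \<xi> that by (simp add: l2_module_def)
  have restr: "(\<lambda>t. if t \<in> ?S then \<xi> t x else 0) = (\<lambda>t. \<xi> t x)" for x using out by auto
  have "l2_le (\<lambda>t. if t \<in> ?S then \<xi> t x else 0) (sqrt M)" for x
  proof -
    have "((\<lambda>t. complex_of_real ((cmod (\<xi> t x))\<^sup>2)) has_sum h x) ?S"
      using tendsto_uniform_limitI[OF h(2), of x] by (simp add: has_sum_def cnj_mult_self)
    then have hs: "((\<lambda>t. (cmod (\<xi> t x))\<^sup>2) has_sum Re (h x)) ?S"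
      using has_sum_Re by fastforce
    have "(\<Sum>t\<in>F. (cmod (\<xi> t x))\<^sup>2) \<le> M" if "finite F" "F \<subseteq> ?S" for F
    proof -
      have "(\<Sum>t\<in>F. (cmod (\<xi> t x))\<^sup>2) \<le> Re (h x)" by (rule finite_sum_le_has_sum[OF hs that]) simp
      also have "\<dots> \<le> M" using M(2)[of x] complex_Re_le_cmod order_trans by blast
      finally show ?thesis .
    qed
    then show ?thesis using M(1) by (simp add: l2_le_iff_sum_le)
  qed
  then have "l2_le (\<lambda>t. if t \<in> ?S then \<xi> t x else 0) (l2_norm e \<xi>)" by (rule l2_le_l2_norm)
  then have "l2_le (\<lambda>t. \<xi> t x) (l2_norm e \<xi>)" unfolding restr .
  then show ?thesis using n unfolding l2_le_def by (meson order_trans)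
qed

lemma zero_in_l2_module: "(\<lambda>t x. 0) \<in> l2_module \<theta> X e"
  using C0_zero by (auto simp: l2_module_def ideal_at_def intro!: bexI[of _ "\<lambda>_. 0"] uniform_limit_const)

lemma l2_norm_zero: "l2_norm e (\<lambda>t x. 0) \<le> 0"
  by (rule l2_norm_le) (simp add: l2_le_def L2_set_def)

lemma delta_in_l2_module:
  assumes e: "e \<in> idems" and y: "y \<in> ideal_at \<theta> X e" "\<And>x. cmod (y x) \<le> 1"
  shows "delta e y \<in> l2_module \<theta> X e" "l2_norm e (delta e y) \<le> 1"
proof -
  let ?S = "source_fiber e"
  have eS: "e \<in> ?S" using e by (simp add: source_fiber_def idem_inv idemD)
  have yy: "(\<lambda>x. cnj (y x) * y x) \<in> ideal_at \<theta> X e"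
    using C0_mult_bounded[of y "subtopology X (fixdom \<theta> e)" "\<lambda>x. cnj (y x)" 1]
      C0_D(1)[OF C0_cnj[OF y(1)[unfolded ideal_at_def]]] y by (simp add: ideal_at_def)
  have "uniform_limit UNIV (\<lambda>F x. \<Sum>t\<in>F. cnj (delta e y t x) * delta e y t x) (\<lambda>x. cnj (y x) * y x)
      (finite_subsets_at_top ?S)"
    unfolding uniform_limit_iff eventually_finite_subsets_at_top
  proof (intro allI impI exI[of _ "{e}"] conjI ballI, goal_cases)
    case (3 \<epsilon> Y x)
    have "(\<Sum>t\<in>Y. cnj (delta e y t x) * delta e y t x) = (\<Sum>t\<in>{e}. cnj (y x) * y x)"
      by (rule sum.mono_neutral_cong_right) (use 3 in \<open>auto simp: delta_def\<close>)
    then show ?case using 3 by simp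
  qed (use eS in auto)
  then show "delta e y \<in> l2_module \<theta> X e"
    using yy eS y(1) C0_zero[of "subtopology X (fixdom \<theta> e)"]
    by (auto simp: l2_module_def delta_def ideal_at_def)
  show "l2_norm e (delta e y) \<le> 1"
  proof (rule l2_norm_le)
    fix x
    have "(\<Sum>t\<in>F. (cmod (delta e y t x))\<^sup>2) \<le> 1\<^sup>2" if "finite F" for F
    proof -
      have "(\<Sum>t\<in>F. (cmod (delta e y t x))\<^sup>2) = (\<Sum>t\<in>F \<inter> {e}. (cmod (y x))\<^sup>2)"
        by (rule sum.mono_neutral_cong_right) (use that in \<open>auto simp: delta_def\<close>)
      also have "\<dots> \<le> 1\<^sup>2"
        using power_mono[OF y(2)[of x], of 2] by (cases "e \<in> F") auto
      finally show ?thesis .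
    qed
    then show "l2_le (\<lambda>t. if t \<in> ?S then delta e y t x else 0) 1"
      by (subst l2_le_iff_sum_le) auto
  qed
qed

context
  fixes \<theta> :: "'s::inverse_semigroup \<Rightarrow> 'x \<Rightarrow> 'x option" and X :: "'x topology"
  assumes act: "sg_action \<theta> X"
begin

lemma ell_eq_reg:
  assumes T: "finite (sg_supp T)" and \<xi>: "\<And>t. t \<notin> source_fiber e \<Longrightarrow> \<xi> t = (\<lambda>_. 0)"
  shows "ell \<theta> e T \<xi> r x = reg \<theta> x T (\<lambda>t. \<xi> t x) r"
proof -
  let ?I = "{s \<in> sg_supp T. s * (s\<^sup>\<star> * r) = r \<and> s\<^sup>\<star> * r \<in> source_fiber e}"
  have "ell \<theta> e T \<xi> r x = (\<Sum>s\<in>?I. alpha \<theta> ((s\<^sup>\<star> * r)\<^sup>\<star>) (T s) x * \<xi> (s\<^sup>\<star> * r) x)"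
    unfolding ell_def
  proof (rule sum.reindex_bij_witness[where i = "\<lambda>s. (s, s\<^sup>\<star> * r)" and j = fst], goal_cases)
    case (4 s)
    have "s\<^sup>\<star> * s * (s\<^sup>\<star> * r) = s\<^sup>\<star> * (s * (s\<^sup>\<star> * r))" by (simp only: mult.assoc)
    then show ?case using 4 by simp
  qed (auto simp: mult.assoc pi_term_eq[OF act])
  also have "\<dots> = reg \<theta> x T (\<lambda>t. \<xi> t x) r"
    unfolding reg_def
    by (rule sum.mono_neutral_cong_left) (use T \<xi> in auto)
  finally show ?thesis .
qed

context
  fixes e :: 's
begin

abbreviation "unit_ball \<equiv> {\<xi>. \<xi> \<in> l2_module \<theta> X e \<and> l2_norm e \<xi> \<le> 1}"
abbreviation "fibre_op_norm T \<equiv> l2_op_norm \<theta> X e (ell \<theta> e T)"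

lemma l2_le_ell:
  assumes T: "T \<in> sa_carrier (KS_alg \<theta> X)" and \<xi>: "\<xi> \<in> unit_ball"
    and M: "\<And>s x. cmod (T s x) \<le> M s"
  shows "l2_le (\<lambda>t. if t \<in> source_fiber e then ell \<theta> e T \<xi> t x else 0) (sum M (sg_supp T))"
proof -
  have fin: "finite (sg_supp T)" using T by (simp add: KS_carrier_iff)
  have out: "\<xi> t = (\<lambda>_. 0)" if "t \<notin> source_fiber e" for t using \<xi> that by (simp add: l2_module_def)
  have M0: "0 \<le> M s" for s using M[of s undefined] norm_ge_zero order_trans by blast
  have "l2_le (\<lambda>t. \<xi> t x) 1" using \<xi> by (intro l2_module_fibre_le[of \<xi> \<theta> X e]) auto
  from l2_le_reg[OF this fin M M0, of \<theta> x]
  have "l2_le (\<lambda>r. reg \<theta> x T (\<lambda>t. \<xi> t x) r) (sum M (sg_supp T))" by simp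
  moreover have "ell \<theta> e T \<xi> r x = reg \<theta> x T (\<lambda>t. \<xi> t x) r" for r
    by (rule ell_eq_reg[OF fin out])
  ultimately show ?thesis by (simp only:) (rule l2_le_restrict)
qed

lemma fibre_op_norm_le:
  assumes "\<And>\<xi>. \<xi> \<in> unit_ball \<Longrightarrow> l2_norm e (ell \<theta> e T \<xi>) \<le> c"
  shows "fibre_op_norm T \<le> c"
  unfolding l2_op_norm_def
proof (rule cSup_least)
  have "(\<lambda>t x. 0) \<in> unit_ball" using zero_in_l2_module l2_norm_zero[of e] by (auto intro: order_trans)
  then show "{l2_norm e (ell \<theta> e T \<xi>) |\<xi>. \<xi> \<in> l2_module \<theta> X e \<and> l2_norm e \<xi> \<le> 1} \<noteq> {}" by blast
qed (use assms in blast)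

lemma l2_norm_ell_le:
  assumes T: "T \<in> sa_carrier (KS_alg \<theta> X)" and \<xi>: "\<xi> \<in> unit_ball"
  shows "l2_norm e (ell \<theta> e T \<xi>) \<le> fibre_op_norm T"
  unfolding l2_op_norm_def
proof (rule cSup_upper)
  show "l2_norm e (ell \<theta> e T \<xi>) \<in> {l2_norm e (ell \<theta> e T \<xi>) |\<xi>. \<xi> \<in> l2_module \<theta> X e \<and> l2_norm e \<xi> \<le> 1}"
    using \<xi> by blast
  obtain M where M: "\<And>s x. cmod (T s x) \<le> M s" using KS_carrier_bounded[OF T] by metis
  show "bdd_above {l2_norm e (ell \<theta> e T \<xi>) |\<xi>. \<xi> \<in> l2_module \<theta> X e \<and> l2_norm e \<xi> \<le> 1}"
  proof (rule bdd_aboveI)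
    fix v assume "v \<in> {l2_norm e (ell \<theta> e T \<xi>) |\<xi>. \<xi> \<in> l2_module \<theta> X e \<and> l2_norm e \<xi> \<le> 1}"
    then obtain \<zeta> where "v = l2_norm e (ell \<theta> e T \<zeta>)" "\<zeta> \<in> unit_ball" by blast
    then show "v \<le> sum M (sg_supp T)" using l2_norm_le[OF l2_le_ell[OF T _ M]] by simp
  qed
qed

lemma l2_le_fibre_op_norm:
  assumes T: "T \<in> sa_carrier (KS_alg \<theta> X)" and \<xi>: "\<xi> \<in> unit_ball"
  shows "l2_le (\<lambda>t. if t \<in> source_fiber e then ell \<theta> e T \<xi> t x else 0) (fibre_op_norm T)"
proof -
  obtain M where M: "\<And>s x. cmod (T s x) \<le> M s" using KS_carrier_bounded[OF T] by metis
  have "l2_le (\<lambda>t. if t \<in> source_fiber e then ell \<theta> e T \<xi> t x else 0) (l2_norm e (ell \<theta> e T \<xi>))"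
    by (rule l2_le_l2_norm[OF l2_le_ell[OF T \<xi> M]])
  then show ?thesis
    using l2_norm_ell_le[OF T \<xi>] unfolding l2_le_def by (meson order_trans)
qed

lemma fibre_op_norm_nonneg: "T \<in> sa_carrier (KS_alg \<theta> X) \<Longrightarrow> 0 \<le> fibre_op_norm T"
proof -
  assume T: "T \<in> sa_carrier (KS_alg \<theta> X)"
  have "(\<lambda>t x. 0) \<in> unit_ball" using zero_in_l2_module l2_norm_zero[of e] by (auto intro: order_trans)
  from l2_le_nonneg[OF l2_le_fibre_op_norm[OF T this]] show ?thesis .
qed

lemma fibre_op_norm_le_sum:
  assumes T: "T \<in> sa_carrier (KS_alg \<theta> X)" and M: "\<And>s x. cmod (T s x) \<le> M s"
  shows "fibre_op_norm T \<le> sum M (sg_supp T)"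
  by (rule fibre_op_norm_le) (rule l2_norm_le[OF l2_le_ell[OF T _ M]])

lemma fibre_op_norm_add:
  assumes T: "T \<in> sa_carrier (KS_alg \<theta> X)" and R: "R \<in> sa_carrier (KS_alg \<theta> X)"
  shows "fibre_op_norm (sa_add (KS_alg \<theta> X) T R) \<le> fibre_op_norm T + fibre_op_norm R"
proof (rule fibre_op_norm_le, rule l2_norm_le)
  fix \<xi> x assume \<xi>: "\<xi> \<in> unit_ball"
  have out: "\<xi> t = (\<lambda>_. 0)" if "t \<notin> source_fiber e" for t using \<xi> that by (simp add: l2_module_def)
  have fin: "finite (sg_supp T)" "finite (sg_supp R)" "finite (sg_supp (sa_add (KS_alg \<theta> X) T R))"
    using T R KS_add_mem[OF T R] by (auto simp: KS_carrier_iff)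
  have add: "ell \<theta> e (sa_add (KS_alg \<theta> X) T R) \<xi> t x = ell \<theta> e T \<xi> t x + ell \<theta> e R \<xi> t x" for t
    using ell_eq_reg[of T e \<xi> t x] ell_eq_reg[of R e \<xi> t x] ell_eq_reg[of "sa_add (KS_alg \<theta> X) T R" e \<xi> t x]
      fin out by (simp add: KS_alg_simps reg_add)
  have eq: "(\<lambda>t. if t \<in> source_fiber e then ell \<theta> e (sa_add (KS_alg \<theta> X) T R) \<xi> t x else 0) =
    (\<lambda>t. (if t \<in> source_fiber e then ell \<theta> e T \<xi> t x else 0) +
         (if t \<in> source_fiber e then ell \<theta> e R \<xi> t x else 0))"
    by (auto simp: add)
  show "l2_le (\<lambda>t. if t \<in> source_fiber e then ell \<theta> e (sa_add (KS_alg \<theta> X) T R) \<xi> t x else 0)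
    (fibre_op_norm T + fibre_op_norm R)"
    unfolding eq by (intro l2_le_add l2_le_fibre_op_norm T R \<xi>)
qed

lemma fibre_op_norm_scale:
  assumes T: "T \<in> sa_carrier (KS_alg \<theta> X)"
  shows "fibre_op_norm (sa_scale (KS_alg \<theta> X) c T) \<le> cmod c * fibre_op_norm T"
proof (rule fibre_op_norm_le, rule l2_norm_le)
  fix \<xi> x assume \<xi>: "\<xi> \<in> unit_ball"
  have out: "\<xi> t = (\<lambda>_. 0)" if "t \<notin> source_fiber e" for t using \<xi> that by (simp add: l2_module_def)
  have fin: "finite (sg_supp T)" "finite (sg_supp (sa_scale (KS_alg \<theta> X) c T))"
    using T KS_scale_mem[OF T, of c] by (auto simp: KS_carrier_iff)
  have scale: "ell \<theta> e (sa_scale (KS_alg \<theta> X) c T) \<xi> t x = c * ell \<theta> e T \<xi> t x" for t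
    using ell_eq_reg[of T e \<xi> t x] ell_eq_reg[of "sa_scale (KS_alg \<theta> X) c T" e \<xi> t x]
      fin out by (simp add: KS_alg_simps reg_scale)
  have eq: "(\<lambda>t. if t \<in> source_fiber e then ell \<theta> e (sa_scale (KS_alg \<theta> X) c T) \<xi> t x else 0) =
    (\<lambda>t. c * (if t \<in> source_fiber e then ell \<theta> e T \<xi> t x else 0))"
    by (auto simp: scale)
  show "l2_le (\<lambda>t. if t \<in> source_fiber e then ell \<theta> e (sa_scale (KS_alg \<theta> X) c T) \<xi> t x else 0)
    (cmod c * fibre_op_norm T)"
    unfolding eq by (intro l2_le_scale l2_le_fibre_op_norm T \<xi>)
qed

end

text \<open>A bump function \<open>y\<close> with \<open>y(x) = 1\<close> turns the basis vector \<open>s\<^sup>\<star>s\<close> over \<open>x\<close> into the element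
  \<open>\<delta>\<^bsub>s\<^sup>\<star>s\<^esub> y\<close> of the unit ball of the module.\<close>

lemma upper_sum_le_fibre_op_norm:
  assumes lc: "locally_compact_space X" and H: "Hausdorff_space X"
    and T: "T \<in> sa_carrier (KS_alg \<theta> X)" and x: "x \<in> fixdom \<theta> (s\<^sup>\<star> * s)"
  shows "cmod (upper_sum T s x) \<le> fibre_op_norm (s\<^sup>\<star> * s) T"
proof -
  let ?e = "s\<^sup>\<star> * s" and ?Y = "subtopology X (fixdom \<theta> (s\<^sup>\<star> * s))"
  have fin: "finite (sg_supp T)" using T by (simp add: KS_carrier_iff)
  have op: "openin X (fixdom \<theta> ?e)" by (rule action_openin_fixdom[OF act idem_inv_mult])
  have "\<exists>y\<in>C0 ?Y. y x = 1 \<and> (\<forall>z. z \<notin> fixdom \<theta> ?e \<longrightarrow> y z = 0) \<and> (\<forall>z. cmod (y z) \<le> 1)"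
    by (rule C0_bump[OF locally_compact_space_open_subset Hausdorff_space_subtopology])
      (simp_all add: lc H op x openin_open_subtopology)
  then obtain y where y: "y \<in> ideal_at \<theta> X ?e" "y x = 1" "\<And>z. cmod (y z) \<le> 1"
    unfolding ideal_at_def by blast
  have ball: "delta ?e y \<in> unit_ball ?e"
    using delta_in_l2_module[OF idem_inv_mult y(1,3)] by simp
  have "delta ?e y t = (\<lambda>_. 0)" if "t \<notin> source_fiber ?e" for t
    using that idem_inv_mult[of s] by (auto simp: delta_def source_fiber_def idem_inv idemD)
  then have "ell \<theta> ?e T (delta ?e y) s x = reg \<theta> x T (\<lambda>t. delta ?e y t x) s"
    by (rule ell_eq_reg[OF fin])
  also have "(\<lambda>t. delta ?e y t x) = (\<lambda>t. if t = ?e then 1 else 0)"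
    by (auto simp: delta_def y(2))
  also have "reg \<theta> x T (\<lambda>t. if t = ?e then 1 else 0) s = upper_sum T s x"
    by (rule reg_indicator[OF act fin x])
  finally have ell: "ell \<theta> ?e T (delta ?e y) s x = upper_sum T s x" .
  have "s \<in> source_fiber ?e" by (simp add: source_fiber_def)
  then show ?thesis
    using l2_le_point[OF l2_le_fibre_op_norm[OF T ball, of x], of s] by (simp add: ell)
qed

lemma fibre_op_norm_le_reduced:
  assumes T: "T \<in> sa_carrier (KS_alg \<theta> X)" and e: "e \<in> idems"
  shows "fibre_op_norm e T \<le> KS_reduced_norm \<theta> X T"
proof -
  obtain M where M: "\<And>s x. cmod (T s x) \<le> M s" using KS_carrier_bounded[OF T] by metis
  show ?thesis
    unfolding KS_reduced_norm_def
    by (rule cSUP_upper[OF e]) (auto intro!: bdd_aboveI[of _ "sum M (sg_supp T)"] fibre_op_norm_le_sum T M)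
qed

lemma reduced_norm_le:
  assumes "\<And>e. e \<in> idems \<Longrightarrow> fibre_op_norm e T \<le> c"
  shows "KS_reduced_norm \<theta> X T \<le> c"
  unfolding KS_reduced_norm_def
  by (rule cSUP_least) (use assms idem_inv_mult in auto)

theorem separable_reduced_KS_crossed_product_iff:
  assumes lc: "locally_compact_space X" and H: "Hausdorff_space X"
  shows "separable_algebra (reduced_KS_crossed_product \<theta> X) \<longleftrightarrow>
    second_countable X \<and> countable {s. fixdom \<theta> (s\<^sup>\<star> * s) \<noteq> {}}"
  unfolding reduced_KS_crossed_product_def
proof (rule separable_KS_completion_iff[OF act lc H])
  let ?q = "KS_reduced_norm \<theta> X"
  note le = fibre_op_norm_le_reduced
  show nonneg: "0 \<le> ?q T" if "T \<in> sa_carrier (KS_alg \<theta> X)" for T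
    using fibre_op_norm_nonneg[OF that] le[OF that idem_inv_mult] by (rule order_trans)
  show "?q (sa_scale (KS_alg \<theta> X) c T) = cmod c * ?q T" if "T \<in> sa_carrier (KS_alg \<theta> X)" for T c
  proof (rule scale_equality_from_inequality[OF _ nonneg that])
    fix T c assume T: "T \<in> sa_carrier (KS_alg \<theta> X)"
    show "?q (sa_scale (KS_alg \<theta> X) c T) \<le> cmod c * ?q T"
    proof (rule reduced_norm_le)
      fix e :: 's assume e: "e \<in> idems"
      have "fibre_op_norm e (sa_scale (KS_alg \<theta> X) c T) \<le> cmod c * fibre_op_norm e T"
        by (rule fibre_op_norm_scale[OF T])
      also have "\<dots> \<le> cmod c * ?q T" by (intro mult_left_mono le T e) simp
      finally show "fibre_op_norm e (sa_scale (KS_alg \<theta> X) c T) \<le> cmod c * ?q T" .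
    qed
  qed
  show "?q (sa_add (KS_alg \<theta> X) T R) \<le> ?q T + ?q R"
    if T: "T \<in> sa_carrier (KS_alg \<theta> X)" and R: "R \<in> sa_carrier (KS_alg \<theta> X)" for T R
  proof (rule reduced_norm_le)
    fix e :: 's assume e: "e \<in> idems"
    have "fibre_op_norm e (sa_add (KS_alg \<theta> X) T R) \<le> fibre_op_norm e T + fibre_op_norm e R"
      by (rule fibre_op_norm_add[OF T R])
    also have "\<dots> \<le> ?q T + ?q R" by (intro add_mono le T R e)
    finally show "fibre_op_norm e (sa_add (KS_alg \<theta> X) T R) \<le> ?q T + ?q R" .
  qed
  show "?q (delta s a) \<le> M" if a: "a \<in> ideal_at \<theta> X (s\<^sup>\<star> * s)" and M: "\<And>x. cmod (a x) \<le> M" for s a M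
  proof (rule reduced_norm_le)
    fix e :: 's
    have M0: "0 \<le> M" using M[of undefined] norm_ge_zero order_trans by blast
    have "fibre_op_norm e (delta s a) \<le> (\<Sum>t\<in>sg_supp (delta s a). M)"
      by (rule fibre_op_norm_le_sum[OF KS_delta_mem[OF a]]) (simp add: delta_def M M0)
    also have "\<dots> \<le> M" using M0 by (simp add: sg_supp_delta)
    finally show "fibre_op_norm e (delta s a) \<le> M" .
  qed
  show "cmod (upper_sum T s x) \<le> ?q T"
    if T: "T \<in> sa_carrier (KS_alg \<theta> X)" and x: "x \<in> fixdom \<theta> (s\<^sup>\<star> * s)" for T s x
    using upper_sum_le_fibre_op_norm[OF lc H T x] le[OF T idem_inv_mult] by (rule order_trans)
qed

end

section \<open>Countability and separability\<close>

theorem corollary4p3p2: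
  fixes \<theta> :: "'s::inverse_semigroup \<Rightarrow> 'x \<Rightarrow> 'x option" and X :: "'x topology"
  assumes "locally_compact_space X" and "Hausdorff_space X"
    and "sg_action \<theta> X"
  shows "(second_countable X \<and> countable {s. fixdom \<theta> (s\<^sup>\<star> * s) \<noteq> {}} \<longleftrightarrow>
            second_countable (arrows (transformation_groupoid (KS_action \<theta> X) (KS_space \<theta> X)))) \<and>
         (second_countable (arrows (transformation_groupoid (KS_action \<theta> X) (KS_space \<theta> X))) \<longleftrightarrow>
            separable_algebra (full_KS_crossed_product \<theta> X)) \<and>
         (separable_algebra (full_KS_crossed_product \<theta> X) \<longleftrightarrow>
            separable_algebra (reduced_KS_crossed_product \<theta> X))"
  unfolding second_countable_KS_groupoid_iff[OF assms(3,1,2)]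
    separable_full_KS_crossed_product_iff[OF assms(3,1,2)]
    separable_reduced_KS_crossed_product_iff[OF assms(3,1,2)]
  by simp

end
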